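(* For all positive integers $n,p$, $$\beta^*(n,p,\infty)=O\left(\min\left\{n^{1/2}p,\,np^{1/2}\right\}+n+p\right).$$
   Context: A path system is a pair $S=(V,\Pi)$ where $V$ is a finite ground set of nodes and $\Pi$ is a multiset of finite sequences of nodes (paths), each containing each node at most once. Its size is $\|S\|=\sum_{\pi\in\Pi}|\pi|$ ($|\pi|$ = number of nodes). Write $x<_\pi y$ if $x,y\in\pi$ and $x$ strictly precedes $y$ in $\pi$. A $b$-bridge consists of $b$ distinct nodes $v_1,\dots,v_b$ and $b$ distinct paths $\pi_1,\dots,\pi_b$ with $v_i<_{\pi_i}v_{i+1}$ for $1\le i\le b-1$ and $v_1<_{\pi_b}v_b$; $\pi_b$ is the river and the others are arcs. An ordered path system is a path system with a total order on its paths; an ordered bridge is a bridge whose river comes after all of its arcs in this order. The ordered bridge girth is the least $b$ such that there is an ordered $b$-bridge ($\infty$ if none). $\beta^*(n,p,k)$ is the maximum possible size of an ordered path system with $n$ nodes, $p$ paths and ordered bridge girth $>k$. *)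

theory Defs
  imports Complex_Main "HOL-Library.Extended_Nat"
begin

(* An ordered path system on the node set {..<n} is a list of paths; the list order is
   the total order on the paths, and repeated entries model the multiset of paths.
   Each path is a list of nodes without repetition. *)

definition is_path_system :: "nat \<Rightarrow> nat list list \<Rightarrow> bool" where
  "is_path_system n P \<longleftrightarrow> (\<forall>\<pi>\<in>set P. distinct \<pi> \<and> set \<pi> \<subseteq> {..<n})"

definition ps_size :: "nat list list \<Rightarrow> nat" where
  "ps_size P = (\<Sum>\<pi>\<leftarrow>P. length \<pi>)"

definition prec :: "nat list \<Rightarrow> nat \<Rightarrow> nat \<Rightarrow> bool" where
  "prec \<pi> x y \<longleftrightarrow> (\<exists>i j. i < j \<and> j < length \<pi> \<and> \<pi> ! i = x \<and> \<pi> ! j = y)"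

definition ordered_bridge :: "nat list list \<Rightarrow> nat \<Rightarrow> (nat \<Rightarrow> nat) \<Rightarrow> (nat \<Rightarrow> nat) \<Rightarrow> bool" where
  "ordered_bridge P b v r \<longleftrightarrow>
     1 \<le> b \<and> inj_on v {1..b} \<and> inj_on r {1..b} \<and> (\<forall>i\<in>{1..b}. r i < length P) \<and>
     (\<forall>i\<in>{1..<b}. prec (P ! r i) (v i) (v (Suc i))) \<and>
     prec (P ! r b) (v 1) (v b) \<and>
     (\<forall>i\<in>{1..<b}. r i < r b)"

definition has_ordered_bridge :: "nat list list \<Rightarrow> nat \<Rightarrow> bool" where
  "has_ordered_bridge P b \<longleftrightarrow> (\<exists>v r. ordered_bridge P b v r)"

definition ordered_bridge_girth_gt :: "nat list list \<Rightarrow> enat \<Rightarrow> bool" where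
  "ordered_bridge_girth_gt P k \<longleftrightarrow> (\<forall>b. enat b \<le> k \<longrightarrow> \<not> has_ordered_bridge P b)"

definition beta_star :: "nat \<Rightarrow> nat \<Rightarrow> enat \<Rightarrow> nat" where
  "beta_star n p k = Max {ps_size P | P. is_path_system n P \<and> length P = p \<and> ordered_bridge_girth_gt P k}"

end

theory Submission
  imports Defs
begin

text \<open>
  The bound \<open>n \<surd>p\<close> holds because an ordered pair of nodes is traversed in this order by at most one path.

  For the bound \<open>\<surd>n p\<close> one shows that two paths have \<open>O(1)\<close> nodes in common on average; then count, at
  every node, the pairs of paths through it. Two paths may well meet often, but only in opposite
  orders, so all their common nodes reach each other. If crossings were abundant, this mutual
  reachability could be amplified. Call a node with walks to and from two paths \<open>\<tau>, \<tau>'\<close> a leg of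
  \<open>(\<tau>, \<tau>')\<close>. Legs of the same pair with disjoint labels reach each other's tips, forwards along \<open>\<tau>\<close> and
  backwards along \<open>\<tau>'\<close>, so three of them form a tripod: a node with walks to and from two other nodes.
  Sorting tripods by the last paths through these two nodes yields legs again. The labels of a walk
  double in number at each round (from \<open>w\<close> to \<open>2w + 1\<close>), the losses are \<open>2^O(w)\<close>, but the number of legs is cubed.
  So if the initial average is a large constant it grows beyond every bound, which is absurd.

  Bridges need distinct paths, so all walks have to be kept label-disjoint. The losses come from the
  set-pair inequality of Bollobas: among more than \<open>2^t\<close> pairs of disjoint sets of total size at most
  \<open>t\<close> there are two pairs that are cross-disjoint.
\<close>

subsection \<open>Set pairs and independent sets\<close>

text \<open>Only bridges whose river comes last are excluded, so every contradiction needs a path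
  later than all labels of the walk around it. This makes the last path through a node the right
  sorting key: the labels of a tripod precede the last paths through its feet, which can thus be
  rivers in the next round, and these precede the last path through its tip. The cube arises as
  follows. Groups of \<open>\<mu>\<close> legs, for about \<open>p^2\<close> pairs of paths, yield
  about \<open>p^2 * \<mu>^2\<close> pairs of feet, each with about \<open>\<mu>\<close> tips;
  sorted into at most \<open>p^2\<close> classes, they give groups of order \<open>\<mu>^3\<close>,
  up to losses. As \<open>w + 1\<close> exactly doubles, \<open>Z = 2^(w+1)\<close> is squared in
  each round. Hence the size \<open>Z^80\<close> only has to be squared to be restored, and the
  surplus pays for losses that are fixed powers of \<open>Z\<close>. The main obstacle is a label
  that occurs in most tripods of a class. Such a label is a path \<open>r\<close> crossed by closed
  walks from all feet, and the orders of these crossings along \<open>r\<close> and along the two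
  paths of the class contradict each other.\<close>

lemma card_sets_between:
  assumes "finite U" "A \<subseteq> U" "B \<subseteq> U" "A \<inter> B = {}"
  shows "card {R. A \<subseteq> R \<and> R \<subseteq> U - B} * 2 ^ (card A + card B) = 2 ^ card U"
proof -
  have fin: "finite A" "finite B" using assms finite_subset by blast+
  have "bij_betw (\<lambda>R. R \<union> A) (Pow (U - A - B)) {R. A \<subseteq> R \<and> R \<subseteq> U - B}"
    by (rule bij_betw_byWitness[where f' = "\<lambda>R. R - A"]) (use assms in auto)
  then have 1: "card {R. A \<subseteq> R \<and> R \<subseteq> U - B} = 2 ^ card (U - A - B)"
    using bij_betw_same_card card_Pow assms(1) by (metis finite_Diff)
  have "card (U - (A \<union> B)) = card U - card (A \<union> B)"
    using assms fin by (intro card_Diff_subset) auto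
  moreover have "card (A \<union> B) = card A + card B"
    using fin assms by (intro card_Un_disjoint) auto
  moreover have "card (A \<union> B) \<le> card U"
    using assms by (intro card_mono) auto
  ultimately have "card (U - A - B) + (card A + card B) = card U"
    by (simp add: Diff_Diff_Int set_diff_eq)
  then show ?thesis unfolding 1 by (metis power_add)
qed

text \<open>A uniformly random \<open>R\<close> in \<open>U\<close> contains \<open>A k\<close> and
  avoids \<open>B k\<close> with probability at least \<open>2^-t\<close>. For different
  \<open>k\<close> these events \<open>E k\<close> exclude each other, since a common
  \<open>R\<close> would separate \<open>A k\<close> from \<open>B l\<close> and \<open>A l\<close>
  from \<open>B k\<close>. A larger family thus contains two pairs that are disjoint in both
  directions, which is essential later because the order of two nodes on a path is not known in
  advance.\<close>

lemma set_pair_inequality: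
  fixes A B :: "'k \<Rightarrow> 'a set"
  assumes "finite K"
    and fin: "\<And>k. k \<in> K \<Longrightarrow> finite (A k) \<and> finite (B k)"
    and self: "\<And>k. k \<in> K \<Longrightarrow> A k \<inter> B k = {}"
    and size: "\<And>k. k \<in> K \<Longrightarrow> card (A k) + card (B k) \<le> t"
    and cross: "\<And>k l. k \<in> K \<Longrightarrow> l \<in> K \<Longrightarrow> k \<noteq> l \<Longrightarrow> A k \<inter> B l \<noteq> {} \<or> A l \<inter> B k \<noteq> {}"
  shows "card K \<le> 2 ^ t"
proof -
  define U where "U = (\<Union>k\<in>K. A k \<union> B k)"
  define E where "E k = {R. A k \<subseteq> R \<and> R \<subseteq> U - B k}" for k
  have finU: "finite U" unfolding U_def using assms(1) fin by auto
  have E1: "2 ^ card U \<le> card (E k) * 2 ^ t" if "k \<in> K" for k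
  proof -
    have "card (E k) * 2 ^ (card (A k) + card (B k)) = 2 ^ card U"
      unfolding E_def by (rule card_sets_between) (use finU that self in \<open>auto simp: U_def\<close>)
    moreover have "(2::nat) ^ (card (A k) + card (B k)) \<le> 2 ^ t"
      using size[OF that] by (intro power_increasing) auto
    ultimately show ?thesis by (metis mult_le_mono2)
  qed
  have sub: "E k \<subseteq> Pow U" for k unfolding E_def by auto
  then have finE: "finite (E k)" for k using finU by (metis finite_Pow_iff finite_subset)
  have disj: "E k \<inter> E l = {}" if "k \<in> K" "l \<in> K" "k \<noteq> l" for k l
  proof (rule ccontr)
    assume "E k \<inter> E l \<noteq> {}"
    then obtain R where "A k \<subseteq> R" "R \<subseteq> U - B k" "A l \<subseteq> R" "R \<subseteq> U - B l"
      unfolding E_def by auto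
    then show False using cross[OF that] by blast
  qed
  have "card K * 2 ^ card U \<le> (\<Sum>k\<in>K. card (E k) * 2 ^ t)"
    using sum_mono[OF E1, of K "\<lambda>k. k"] by simp
  also have "\<dots> = card (\<Union>k\<in>K. E k) * 2 ^ t"
    using disj finE assms(1) by (subst card_UN_disjoint) (auto simp: sum_distrib_right)
  also have "\<dots> \<le> card (Pow U) * 2 ^ t"
    using sub finU by (intro mult_right_mono card_mono) auto
  finally have "card K * 2 ^ card U \<le> 2 ^ t * 2 ^ card U"
    using finU by (simp add: card_Pow mult.commute)
  then show ?thesis by simp
qed

text \<open>Several disjointness requirements have to hold for the same \<open>k\<close> and
  \<open>l\<close>. Tagging the sets with the coordinate \<open>j\<close> turns them into a single
  set pair in which different coordinates cannot interfere.\<close>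

lemma set_pairs_cross_disjoint:
  fixes A B :: "'k \<Rightarrow> nat \<Rightarrow> 'a set"
  assumes "finite K"
    and fin: "\<And>k j. k \<in> K \<Longrightarrow> j < J \<Longrightarrow> finite (A k j) \<and> finite (B k j)"
    and self: "\<And>k j. k \<in> K \<Longrightarrow> j < J \<Longrightarrow> A k j \<inter> B k j = {}"
    and size: "\<And>k. k \<in> K \<Longrightarrow> (\<Sum>j<J. card (A k j) + card (B k j)) \<le> t"
    and big: "card K > 2 ^ t"
  obtains k l where "k \<in> K" "l \<in> K" "k \<noteq> l"
    "\<And>j. j < J \<Longrightarrow> A k j \<inter> B l j = {}" "\<And>j. j < J \<Longrightarrow> A l j \<inter> B k j = {}"
proof -
  define A' where "A' k = Sigma {..<J} (A k)" for k
  define B' where "B' k = Sigma {..<J} (B k)" for k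
  have "\<exists>k\<in>K. \<exists>l\<in>K. k \<noteq> l \<and> A' k \<inter> B' l = {} \<and> A' l \<inter> B' k = {}"
  proof (rule ccontr)
    assume neg: "\<not> ?thesis"
    have "card K \<le> 2 ^ t"
    proof (rule set_pair_inequality[where A = A' and B = B'])
      fix k assume k: "k \<in> K"
      show "finite (A' k) \<and> finite (B' k)" using fin[OF k] by (auto simp: A'_def B'_def)
      show "A' k \<inter> B' k = {}" using self[OF k] by (auto simp: A'_def B'_def)
      show "card (A' k) + card (B' k) \<le> t"
        using size[OF k] fin[OF k] by (simp add: A'_def B'_def sum.distrib)
    qed (use neg assms(1) in auto)
    then show False using big by simp
  qed
  then obtain k l where kl: "k \<in> K" "l \<in> K" "k \<noteq> l" "A' k \<inter> B' l = {}" "A' l \<inter> B' k = {}"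
    by auto
  show ?thesis
    by (rule that[OF kl(1-3)]) (use kl(4,5) in \<open>auto simp: A'_def B'_def\<close>)
qed

text \<open>A largest independent set dominates \<open>S\<close>: an element outside all its closed
  neighbourhoods could be added.\<close>

lemma independent_subset:
  assumes "finite S" and sym: "\<And>a b. R a b \<Longrightarrow> R b a"
    and deg: "\<And>a. a \<in> S \<Longrightarrow> card {b \<in> S. R a b} \<le> D"
  obtains I where "I \<subseteq> S" "card S \<le> (D + 1) * card I"
    "\<And>a b. a \<in> I \<Longrightarrow> b \<in> I \<Longrightarrow> a \<noteq> b \<Longrightarrow> \<not> R a b"
proof -
  define ind where "ind I \<longleftrightarrow> I \<subseteq> S \<and> (\<forall>a\<in>I. \<forall>b\<in>I. a \<noteq> b \<longrightarrow> \<not> R a b)" for I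
  have "ind {}" unfolding ind_def by simp
  moreover have "\<forall>I. ind I \<longrightarrow> card I < card S + 1"
    unfolding ind_def using assms(1) by (metis card_mono le_imp_less_Suc Suc_eq_plus1)
  ultimately obtain I where I: "ind I" and max: "\<And>J. ind J \<Longrightarrow> card J \<le> card I"
    using ex_has_greatest_nat[of ind "{}" card "card S + 1"] by (metis less_imp_le)
  have finI: "finite I" using I assms(1) finite_subset unfolding ind_def by blast
  have "S \<subseteq> (\<Union>a\<in>I. insert a {b \<in> S. R a b})"
  proof
    fix s assume s: "s \<in> S"
    show "s \<in> (\<Union>a\<in>I. insert a {b \<in> S. R a b})"
    proof (rule ccontr)
      assume no: "s \<notin> (\<Union>a\<in>I. insert a {b \<in> S. R a b})"
      then have "ind (insert s I)" using I s sym unfolding ind_def by blast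
      then have "card (insert s I) \<le> card I" by (rule max)
      moreover have "s \<notin> I" using no by auto
      ultimately show False using finI by simp
    qed
  qed
  then have "card S \<le> card (\<Union>a\<in>I. insert a {b \<in> S. R a b})"
    using finI assms(1) by (intro card_mono) auto
  also have "\<dots> \<le> (\<Sum>a\<in>I. card (insert a {b \<in> S. R a b}))"
    using finI by (rule card_UN_le)
  also have "\<dots> \<le> (\<Sum>a\<in>I. D + 1)"
  proof (rule sum_mono)
    fix a assume "a \<in> I"
    then have "card {b \<in> S. R a b} \<le> D" using I deg unfolding ind_def by blast
    then show "card (insert a {b \<in> S. R a b}) \<le> D + 1"
      using card_insert_le_m1[of "D+1" "{b \<in> S. R a b}" a] by simp
  qed
  finally have "card S \<le> (D + 1) * card I" by (simp add: mult.commute)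
  then show ?thesis using that I unfolding ind_def by blast
qed

subsection \<open>Walks that use every path at most once\<close>

text \<open>\<open>walk pr L x y\<close>: some walk from \<open>x\<close> to \<open>y\<close> uses every path of \<open>L\<close> exactly once, and no other path;
  \<open>pr k x y\<close> means that \<open>x\<close> precedes \<open>y\<close> on path \<open>k\<close>.\<close>

inductive walk :: "(nat \<Rightarrow> nat \<Rightarrow> nat \<Rightarrow> bool) \<Rightarrow> nat set \<Rightarrow> nat \<Rightarrow> nat \<Rightarrow> bool" for pr where
  walk_refl: "walk pr {} x x"
| walk_step: "walk pr L x y \<Longrightarrow> k \<notin> L \<Longrightarrow> pr k y z \<Longrightarrow> walk pr (insert k L) x z"

lemma walk_finite: "walk pr L x y \<Longrightarrow> finite L"
  by (induction rule: walk.induct) auto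

lemma walk_arc: "pr k x y \<Longrightarrow> walk pr {k} x y"
  using walk.walk_step[OF walk.walk_refl, of k pr x y] by simp

lemma walk_trans:
  assumes "walk pr M y z" "walk pr L x y" "L \<inter> M = {}"
  shows "walk pr (L \<union> M) x z"
  using assms
proof (induction rule: walk.induct)
  case (walk_refl x)
  then show ?case by simp
next
  case (walk_step M y z k z')
  then have "walk pr (insert k (L \<union> M)) x z'" by (intro walk.walk_step) auto
  then show ?case by simp
qed

lemma walk_split:
  assumes "walk pr L x y" "r \<in> L"
  obtains A B c d where "walk pr A x c" "pr r c d" "walk pr B d y" "L = insert r (A \<union> B)"
    "r \<notin> A" "r \<notin> B" "A \<inter> B = {}"
proof -
  have "\<exists>A B c d. walk pr A x c \<and> pr r c d \<and> walk pr B d y \<and> L = insert r (A \<union> B)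
     \<and> r \<notin> A \<and> r \<notin> B \<and> A \<inter> B = {}"
    using assms
  proof (induction rule: walk.induct)
    case (walk_refl x)
    then show ?case by simp
  next
    case (walk_step L x y k z)
    show ?case
    proof (cases "r = k")
      case True
      have "walk pr L x y \<and> pr r y z \<and> walk pr {} z z \<and> insert k L = insert r (L \<union> {})
        \<and> r \<notin> L \<and> r \<notin> {} \<and> L \<inter> {} = {}"
        using walk_step.hyps True walk.walk_refl[of pr z] by simp
      then show ?thesis by blast
    next
      case False
      then have "r \<in> L" using walk_step.prems by simp
      then obtain A B c d where *: "walk pr A x c" "pr r c d" "walk pr B d y" "L = insert r (A \<union> B)"
        "r \<notin> A" "r \<notin> B" "A \<inter> B = {}"
        using walk_step.IH by meson
      have "walk pr (insert k B) d z" using *(3,4) walk_step.hyps by (intro walk.walk_step) simp_all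
      moreover have "insert k L = insert r (A \<union> insert k B)" "r \<notin> insert k B" "A \<inter> insert k B = {}"
        using * walk_step.hyps(2) False by auto
      ultimately show ?thesis using *(1,2,5) by meson
    qed
  qed
  then show ?thesis using that by blast
qed

text \<open>Labels are distinct here but nodes may repeat; \<open>walk_to_bridge\<close> removes
  repetitions by minimality. Indices start at 1 to match the definition of a bridge.\<close>

lemma walk_sequence:
  assumes "walk pr L x y"
  obtains v r where "v (1::nat) = x" "v (Suc (card L)) = y" "inj_on r {1..card L}" "r ` {1..card L} = L"
    "\<And>i. i \<in> {1..card L} \<Longrightarrow> pr (r i) (v i) (v (Suc i))"
proof -
  have "\<exists>v r. v (1::nat) = x \<and> v (Suc (card L)) = y \<and> inj_on r {1..card L} \<and> r ` {1..card L} = L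
     \<and> (\<forall>i\<in>{1..card L}. pr (r i) (v i) (v (Suc i)))"
    using assms
  proof (induction rule: walk.induct)
    case (walk_refl x)
    then show ?case by (intro exI[of _ "\<lambda>_. x"]) auto
  next
    case (walk_step L x y k z)
    then obtain v r where vr: "v (1::nat) = x" "v (Suc (card L)) = y" "inj_on r {1..card L}"
      "r ` {1..card L} = L" "\<forall>i\<in>{1..card L}. pr (r i) (v i) (v (Suc i))" by auto
    have c: "card (insert k L) = Suc (card L)" using walk_step walk_finite by simp
    have iv: "{1..Suc (card L)} = insert (Suc (card L)) {1..card L}" by auto
    define v' where "v' = v(Suc (Suc (card L)) := z)"
    define r' where "r' = r(Suc (card L) := k)"
    have r'eq: "r' i = r i" if "i \<in> {1..card L}" for i using that by (auto simp: r'_def)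
    have rk: "r' (Suc (card L)) = k" by (simp add: r'_def)
    have "r' ` {1..card L} = L" using vr(4) r'eq by (metis (no_types, lifting) image_cong)
    moreover have "inj_on r' {1..card L}" using vr(3) r'eq by (metis (no_types, lifting) inj_on_cong)
    ultimately have "inj_on r' {1..Suc (card L)}" "r' ` {1..Suc (card L)} = insert k L"
      using walk_step.hyps(2) rk unfolding iv by auto
    moreover have "\<forall>i\<in>{1..Suc (card L)}. pr (r' i) (v' i) (v' (Suc i))"
    proof
      fix i assume i: "i \<in> {1..Suc (card L)}"
      show "pr (r' i) (v' i) (v' (Suc i))"
      proof (cases "i = Suc (card L)")
        case True then show ?thesis using vr(2) walk_step.hyps(3) by (simp add: r'_def v'_def)
      next
        case False then show ?thesis using vr(5) i by (auto simp: r'_def v'_def)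
      qed
    qed
    ultimately show ?case unfolding c
      by (intro exI[of _ v'] exI[of _ r']) (use vr in \<open>auto simp: v'_def\<close>)
  qed
  then show ?thesis using that by blast
qed

lemma walk_segment:
  assumes "inj_on r {1..m}" "\<And>i. i \<in> {1..m} \<Longrightarrow> pr (r i) (v i) (v (Suc i))"
    and "i \<le> j" "1 \<le> i" "j \<le> Suc m"
  shows "walk pr (r ` {i..<j}) (v i) (v j)"
  using assms(3,5)
proof (induction j rule: dec_induct)
  case base
  then show ?case by (simp add: walk.walk_refl)
next
  case (step j)
  have "r j \<notin> r ` {i..<j}"
  proof
    assume "r j \<in> r ` {i..<j}"
    then obtain l where "l \<in> {i..<j}" "r l = r j" by auto
    moreover have "l \<in> {1..m}" "j \<in> {1..m}" using calculation step assms(4) by auto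
    ultimately show False using assms(1) by (auto dest: inj_onD)
  qed
  moreover have "{i..<Suc j} = insert j {i..<j}" using step by auto
  moreover have "pr (r j) (v j) (v (Suc j))" using assms(2,4) step by simp
  ultimately show ?case using step walk.walk_step[of pr "r ` {i..<j}" "v i" "v j" "r j" "v (Suc j)"] by simp
qed

text \<open>In the application \<open>lam v\<close> is the last path through \<open>v\<close>.\<close>

locale bridge_free =
  fixes pr :: "nat \<Rightarrow> nat \<Rightarrow> nat \<Rightarrow> bool" and on :: "nat \<Rightarrow> nat set" and lam :: "nat \<Rightarrow> nat"
  assumes pr_trans: "pr k x y \<Longrightarrow> pr k y z \<Longrightarrow> pr k x z"
    and pr_irrefl: "\<not> pr k x x"
    and pr_total: "x \<in> on k \<Longrightarrow> y \<in> on k \<Longrightarrow> x \<noteq> y \<Longrightarrow> pr k x y \<or> pr k y x"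
    and pr_on: "pr k x y \<Longrightarrow> x \<in> on k \<and> y \<in> on k"
    and no_bridge: "walk pr L x y \<Longrightarrow> (\<And>l. l \<in> L \<Longrightarrow> l < k) \<Longrightarrow> \<not> pr k x y"
begin

text \<open>If \<open>t\<close> and \<open>t'\<close> visited the two places in the same order, the
  earlier of them, extended by walks at both ends, would be a detour for the later one, which would
  be the river of a bridge.\<close>

lemma reversed_crossings:
  assumes "t \<noteq> t'" and "pr t u v"
    and "walk pr A u u'" "walk pr A' u' u" "walk pr B v v'" "walk pr B' v' v"
    and "A \<inter> B' = {}" "A' \<inter> B = {}"
    and small: "\<And>l. l \<in> A \<union> A' \<union> B \<union> B' \<Longrightarrow> l < t \<and> l < t'"
  shows "\<not> pr t' u' v'"
proof
  assume p': "pr t' u' v'"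
  show False
  proof (cases "t < t'")
    case True
    have "t \<notin> A'" "t \<notin> B" using small by auto
    then have "walk pr (A' \<union> {t} \<union> B) u' v'"
      using assms by (intro walk_trans[of pr B v v'] walk_trans[of pr "{t}" u v] walk_arc) auto
    then show False using no_bridge[of _ u' v' t'] p' small True by blast
  next
    case False
    then have lt: "t' < t" using assms(1) by simp
    have "t' \<notin> A" "t' \<notin> B'" using small by auto
    then have "walk pr (A \<union> {t'} \<union> B') u v"
      using assms p' by (intro walk_trans[of pr B' v' v] walk_trans[of pr "{t'}" u' v'] walk_arc) auto
    then show False using no_bridge[of _ u v t] assms(2) small lt by blast
  qed
qed

text \<open>Otherwise the walk from \<open>u\<close> to \<open>c\<close>, possibly a stretch of
  \<open>r\<close> from \<open>c\<close> to \<open>d\<close>, and the walk from \<open>d\<close> to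
  \<open>v\<close> would form a detour with river \<open>t\<close>.\<close>

lemma crossing_reversed:
  assumes "pr t u v"
    and "walk pr T u c" "walk pr A d v" "T \<inter> A = {}" "r \<notin> T" "r \<notin> A" "r < t" "d \<in> on r" "c \<in> on r"
    and small: "\<And>l. l \<in> T \<union> A \<Longrightarrow> l < t"
  shows "pr r d c"
proof -
  have "c \<noteq> d"
  proof
    assume "c = d"
    then have "walk pr (T \<union> A) u v" using assms walk_trans by blast
    then show False using no_bridge[of _ u v t] assms by blast
  qed
  moreover have "\<not> pr r c d"
  proof
    assume "pr r c d"
    then have "walk pr (T \<union> {r} \<union> A) u v"
      using assms by (intro walk_trans[of pr A d v] walk_trans[of pr "{r}" c d] walk_arc) auto
    then show False using no_bridge[of _ u v t] assms by blast
  qed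
  ultimately show ?thesis using pr_total assms by blast
qed

text \<open>The orders in which \<open>t\<close> and \<open>t'\<close> visit the places \<open>k\<close> are opposite to each other, and both are
  opposite to that of \<open>r\<close>: impossible for two places. The sets \<open>E k\<close> allow for labels that the
  walks \<open>T' k\<close> and \<open>A' k\<close> of one place have in common.\<close>

lemma crossing_bound:
  fixes U U' c d c' d' :: "'k \<Rightarrow> nat" and T A T' A' V V' E :: "'k \<Rightarrow> nat set"
  assumes finK: "finite K" and tt': "t \<noteq> t'" and r: "r < t" "r < t'"
    and on: "\<And>k. k \<in> K \<Longrightarrow> U k \<in> on t" "\<And>k. k \<in> K \<Longrightarrow> U' k \<in> on t'"
    and inj: "inj_on U K" "inj_on U' K"
    and cd: "\<And>k. k \<in> K \<Longrightarrow> pr r (c k) (d k)" "\<And>k. k \<in> K \<Longrightarrow> pr r (c' k) (d' k)"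
    and same: "(\<forall>k\<in>K. c k = c' k) \<or> (\<forall>k\<in>K. d k = d' k)"
    and w: "\<And>k. k \<in> K \<Longrightarrow> walk pr (T k) (U k) (c k)" "\<And>k. k \<in> K \<Longrightarrow> walk pr (A k) (d k) (U k)"
      "\<And>k. k \<in> K \<Longrightarrow> walk pr (T' k) (U' k) (c' k)" "\<And>k. k \<in> K \<Longrightarrow> walk pr (A' k) (d' k) (U' k)"
      "\<And>k. k \<in> K \<Longrightarrow> walk pr (V k) (U k) (U' k)" "\<And>k. k \<in> K \<Longrightarrow> walk pr (V' k) (U' k) (U k)"
    and rn: "\<And>k. k \<in> K \<Longrightarrow> r \<notin> T k \<union> A k \<union> T' k \<union> A' k"
    and small: "\<And>k l. k \<in> K \<Longrightarrow> l \<in> T k \<union> A k \<union> T' k \<union> A' k \<union> V k \<union> V' k \<Longrightarrow> l < t \<and> l < t'"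
    and self: "\<And>k. k \<in> K \<Longrightarrow> T k \<inter> A k = {}" "\<And>k. k \<in> K \<Longrightarrow> V k \<inter> V' k = {}"
      "\<And>k. k \<in> K \<Longrightarrow> T' k \<inter> A' k \<subseteq> E k"
    and E: "\<And>k l. k \<in> K \<Longrightarrow> l \<in> K \<Longrightarrow> k \<noteq> l \<Longrightarrow> E k \<inter> E l = {}" "\<And>k. k \<in> K \<Longrightarrow> finite (E k)"
    and size: "\<And>k. k \<in> K \<Longrightarrow> card (T k) \<le> s \<and> card (A k) \<le> s \<and> card (T' k) \<le> s \<and> card (A' k) \<le> s
       \<and> card (V k) \<le> s \<and> card (V' k) \<le> s \<and> card (E k) \<le> s"
  shows "card K \<le> 2 ^ (9 * s)"
proof (rule ccontr)
  assume big: "\<not> card K \<le> 2 ^ (9 * s)"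
  \<comment> \<open>Coordinates 0 and 1 keep \<open>T\<close> apart from \<open>A\<close> and
    \<open>V\<close> apart from \<open>V'\<close>. Coordinates 2 and 3 together keep
    \<open>T'\<close> apart from \<open>A'\<close>: at one place these two may meet inside
    \<open>E k\<close>, so \<open>E k\<close> is removed there and compared separately with the
    remaining labels of the other place, while the sets \<open>E\<close> of two places are disjoint
    by hypothesis. The sizes add up to \<open>2s + 2s + 2s + 3s = 9s\<close>.\<close>
  define P where "P k j = [T k, V k, T' k - E k, E k] ! j" for k and j :: nat
  define Q where "Q k j = [A k, V' k, A' k - E k, (T' k \<union> A' k) - E k] ! j" for k and j :: nat
  have fin: "finite (T k)" "finite (A k)" "finite (T' k)" "finite (A' k)" "finite (V k)" "finite (V' k)"
    if "k \<in> K" for k using w that walk_finite by blast+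
  have lt4: "j < 4 \<longleftrightarrow> j = 0 \<or> j = 1 \<or> j = 2 \<or> j = 3" for j :: nat by auto
  obtain k l where kl: "k \<in> K" "l \<in> K" "k \<noteq> l"
    and PQ: "\<And>j. j < 4 \<Longrightarrow> P k j \<inter> Q l j = {}" "\<And>j. j < 4 \<Longrightarrow> P l j \<inter> Q k j = {}"
  proof (rule set_pairs_cross_disjoint[of K 4 P Q "9 * s"])
    fix k j assume k: "k \<in> K" and j: "j < (4::nat)"
    show "finite (P k j) \<and> finite (Q k j)"
      using j fin[OF k] E(2)[OF k] unfolding lt4 by (auto simp: P_def Q_def numeral_2_eq_2 numeral_3_eq_3)
    show "P k j \<inter> Q k j = {}"
      using j self[OF k] unfolding lt4 by (auto simp: P_def Q_def numeral_2_eq_2 numeral_3_eq_3)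
  next
    fix k assume k: "k \<in> K"
    have 1: "card (T' k - E k) \<le> s" "card (A' k - E k) \<le> s"
      using size[OF k] fin[OF k] by (meson card_Diff1_le card_mono Diff_subset order_trans)+
    have "card ((T' k \<union> A' k) - E k) \<le> card (T' k \<union> A' k)"
      using fin[OF k] by (intro card_mono) auto
    also have "\<dots> \<le> card (T' k) + card (A' k)" by (rule card_Un_le)
    finally have 2: "card ((T' k \<union> A' k) - E k) \<le> 2 * s" using size[OF k] by linarith
    have "(\<Sum>j<4. card (P k j) + card (Q k j)) =
      card (T k) + card (A k) + (card (V k) + card (V' k)) + (card (T' k - E k) + card (A' k - E k))
      + (card (E k) + card ((T' k \<union> A' k) - E k))"
      by (simp add: P_def Q_def eval_nat_numeral)
    then show "(\<Sum>j<4. card (P k j) + card (Q k j)) \<le> 9 * s"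
      using size[OF k] 1 2 by linarith
  qed (use finK big in auto)
  have PQ': "P a j \<inter> Q b j = {}" if "a = k \<and> b = l \<or> a = l \<and> b = k" "j < 4" for a b j
    using PQ that by auto
  have cdon: "c a \<in> on r" "d a \<in> on r" "c' a \<in> on r" "d' a \<in> on r" if "a \<in> K" for a
    using cd that pr_on by blast+
  \<comment> \<open>Both orders of the two places along \<open>t\<close> are possible, hence the
    symmetric condition on \<open>a\<close> and \<open>b\<close>.\<close>
  have main: False if ab: "a \<in> K" "b \<in> K" "a = k \<and> b = l \<or> a = l \<and> b = k" and p: "pr t (U a) (U b)" for a b
  proof -
    have ne: "a \<noteq> b" using ab kl by auto
    have ba: "b = k \<and> a = l \<or> b = l \<and> a = k" using ab by auto
    have d1: "T a \<inter> A b = {}" "V a \<inter> V' b = {}" "V b \<inter> V' a = {}"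
      using PQ'[OF ab(3), of 0] PQ'[OF ab(3), of 1] PQ'[OF ba, of 1] by (auto simp: P_def Q_def)
    have d2: "T' b \<inter> A' a = {}"
    proof -
      have "(T' b - E b) \<inter> (A' a - E a) = {}" "E b \<inter> ((T' a \<union> A' a) - E a) = {}" "E a \<inter> ((T' b \<union> A' b) - E b) = {}"
        using PQ'[OF ba, of 2] PQ'[OF ba, of 3] PQ'[OF ab(3), of 3]
        by (auto simp: P_def Q_def numeral_2_eq_2 numeral_3_eq_3)
      then show ?thesis using E(1)[OF ab(1,2) ne] by blast
    qed
    have "\<not> pr t' (U' a) (U' b)"
      by (rule reversed_crossings[OF tt' p w(5)[OF ab(1)] w(6)[OF ab(1)] w(5)[OF ab(2)] w(6)[OF ab(2)]])
        (use d1 small[OF ab(1)] small[OF ab(2)] in auto)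
    then have p': "pr t' (U' b) (U' a)"
      using pr_total on(2) ab inj(2) ne by (metis inj_onD)
    have c1: "pr r (d b) (c a)"
      by (rule crossing_reversed[OF p w(1)[OF ab(1)] w(2)[OF ab(2)] d1(1)])
        (use rn[OF ab(1)] rn[OF ab(2)] r small[OF ab(1)] small[OF ab(2)] cdon[OF ab(1)] cdon[OF ab(2)] in auto)
    have c2: "pr r (d' a) (c' b)"
      by (rule crossing_reversed[OF p' w(3)[OF ab(2)] w(4)[OF ab(1)] d2])
        (use rn[OF ab(1)] rn[OF ab(2)] r small[OF ab(1)] small[OF ab(2)] cdon[OF ab(1)] cdon[OF ab(2)] in auto)
    \<comment> \<open>The comparisons along \<open>r\<close> close up to a cycle. If entries agree:
      \<open>c b\<close>, \<open>d b\<close>, \<open>c a\<close>, \<open>d' a\<close>,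
      \<open>c' b = c b\<close>. If exits agree: \<open>d b\<close>, \<open>c a\<close>,
      \<open>d a = d' a\<close>, \<open>c' b\<close>, \<open>d' b = d b\<close>.\<close>
    show False using same
    proof
      assume "\<forall>k\<in>K. c k = c' k"
      then have "pr r (c b) (c b)"
        using c1 c2 cd(1)[OF ab(2)] cd(2)[OF ab(1)] ab by (metis pr_trans)
      then show False using pr_irrefl by blast
    next
      assume "\<forall>k\<in>K. d k = d' k"
      then have "pr r (d b) (d b)"
        using c1 c2 cd(1)[OF ab(1)] cd(2)[OF ab(2)] ab by (metis pr_trans)
      then show False using pr_irrefl by blast
    qed
  qed
  have "U k \<noteq> U l" using inj kl by (meson inj_onD)
  then have "pr t (U k) (U l) \<or> pr t (U l) (U k)" using pr_total on(1) kl by blast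
  then show False using main kl by blast
qed

end

subsection \<open>Tripods\<close>

text \<open>
  A tripod has a tip \<open>tx\<close> and feet \<open>tu, tu'\<close>. The walks from the tip go along \<open>tC\<close>, then the path \<open>tf\<close>, where
  they fork, then along \<open>tD\<close> or \<open>tD'\<close>; the walks to the tip go along \<open>tDm\<close> or \<open>tDm'\<close>, then the path
  \<open>tj\<close>, where they join, then along \<open>tCm\<close>. The label sets \<open>tV, tV'\<close> belong to walks between the feet
  and are unrelated to the others.
\<close>

record tripod =
  tx :: nat
  tu :: nat
  tu' :: nat
  tC :: "nat set"
  tD :: "nat set"
  tD' :: "nat set"
  tCm :: "nat set"
  tDm :: "nat set"
  tDm' :: "nat set"
  tV :: "nat set"
  tV' :: "nat set"
  tf :: nat
  tj :: nat

definition tcore :: "tripod \<Rightarrow> nat set" where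
  "tcore t = tC t \<union> tCm t \<union> {tf t, tj t}"

definition tlab :: "tripod \<Rightarrow> nat set" where
  "tlab t = tcore t \<union> tD t \<union> tD' t \<union> tDm t \<union> tDm' t"

definition tswap :: "tripod \<Rightarrow> tripod" where
  "tswap t = t\<lparr>tu := tu' t, tu' := tu t, tD := tD' t, tD' := tD t, tDm := tDm' t, tDm' := tDm t,
     tV := tV' t, tV' := tV t\<rparr>"

lemma tswap_tswap: "tswap (tswap t) = t"
  by (simp add: tswap_def)

lemma card_Un_bound: "card A \<le> a \<Longrightarrow> card B \<le> b \<Longrightarrow> card (A \<union> B) \<le> a + b"
  using card_Un_le[of A B] by linarith

context bridge_free
begin

definition tdisj :: "tripod \<Rightarrow> bool" where
  "tdisj t \<longleftrightarrow>
     tC t \<inter> tD t = {} \<and> tC t \<inter> tD' t = {} \<and> tC t \<inter> tCm t = {} \<and> tC t \<inter> tDm t = {} \<and> tC t \<inter> tDm' t = {} \<and>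
     tD t \<inter> tD' t = {} \<and> tD t \<inter> tCm t = {} \<and> tD t \<inter> tDm t = {} \<and> tD t \<inter> tDm' t = {} \<and> tD' t \<inter> tCm t = {} \<and>
     tD' t \<inter> tDm t = {} \<and> tD' t \<inter> tDm' t = {} \<and> tCm t \<inter> tDm t = {} \<and> tCm t \<inter> tDm' t = {} \<and> tDm t \<inter> tDm' t = {} \<and>
     tf t \<notin> tC t \<and> tf t \<notin> tD t \<and> tf t \<notin> tD' t \<and> tf t \<notin> tCm t \<and> tf t \<notin> tDm t \<and>
     tf t \<notin> tDm' t \<and> tj t \<notin> tC t \<and> tj t \<notin> tD t \<and> tj t \<notin> tD' t \<and> tj t \<notin> tCm t \<and>
     tj t \<notin> tDm t \<and> tj t \<notin> tDm' t \<and> tf t \<noteq> tj t \<and> tV t \<inter> tV' t = {}"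

text \<open>A walk between the feet consists of two walks of legs joined by one path, whence
  \<open>2 * w + 1\<close>.\<close>

definition tsize :: "nat \<Rightarrow> tripod \<Rightarrow> bool" where
  "tsize w t \<longleftrightarrow> card (tC t) \<le> w \<and> card (tD t) \<le> w \<and> card (tD' t) \<le> w
   \<and> card (tCm t) \<le> w \<and> card (tDm t) \<le> w \<and> card (tDm' t) \<le> w
   \<and> card (tV t) \<le> 2 * w + 1 \<and> card (tV' t) \<le> 2 * w + 1"

definition twalks :: "tripod \<Rightarrow> bool" where
  "twalks t \<longleftrightarrow> walk pr (tV t) (tu t) (tu' t) \<and> walk pr (tV' t) (tu' t) (tu t)
   \<and> (\<exists>s a a'. walk pr (tC t) (tx t) s \<and> pr (tf t) s a \<and> pr (tf t) s a'
        \<and> walk pr (tD t) a (tu t) \<and> walk pr (tD' t) a' (tu' t))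
   \<and> (\<exists>s a a'. walk pr (tDm t) (tu t) a \<and> walk pr (tDm' t) (tu' t) a'
        \<and> pr (tj t) a s \<and> pr (tj t) a' s \<and> walk pr (tCm t) s (tx t))"

text \<open>The last paths through the feet become the two paths of a leg in the next round. They
  must be later than all labels to serve as rivers, and different from each other; the last path
  through the tip must be later still, so that the tip can be a foot afterwards.\<close>

definition ttimes :: "tripod \<Rightarrow> bool" where
  "ttimes t \<longleftrightarrow> (\<forall>l\<in>tlab t \<union> tV t \<union> tV' t. l < lam (tu t) \<and> l < lam (tu' t))
   \<and> lam (tu t) < lam (tx t) \<and> lam (tu' t) < lam (tx t) \<and> lam (tu t) \<noteq> lam (tu' t)
   \<and> tu t \<in> on (lam (tu t)) \<and> tu' t \<in> on (lam (tu' t)) \<and> tx t \<in> on (lam (tx t))"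

definition tripod_ok :: "nat \<Rightarrow> tripod \<Rightarrow> bool" where
  "tripod_ok w t \<longleftrightarrow> tdisj t \<and> tsize w t \<and> twalks t \<and> ttimes t"

lemma tripod_disjoint:
  assumes "tripod_ok w t"
  shows "tC t \<inter> tD t = {}" "tC t \<inter> tD' t = {}" "tC t \<inter> tCm t = {}" "tC t \<inter> tDm t = {}" "tC t \<inter> tDm' t = {}"
    "tD t \<inter> tD' t = {}" "tD t \<inter> tCm t = {}" "tD t \<inter> tDm t = {}" "tD t \<inter> tDm' t = {}"
    "tD' t \<inter> tCm t = {}" "tD' t \<inter> tDm t = {}" "tD' t \<inter> tDm' t = {}"
    "tCm t \<inter> tDm t = {}" "tCm t \<inter> tDm' t = {}" "tDm t \<inter> tDm' t = {}"
    "tf t \<notin> tC t" "tf t \<notin> tD t" "tf t \<notin> tD' t" "tf t \<notin> tCm t" "tf t \<notin> tDm t" "tf t \<notin> tDm' t"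
    "tj t \<notin> tC t" "tj t \<notin> tD t" "tj t \<notin> tD' t" "tj t \<notin> tCm t" "tj t \<notin> tDm t" "tj t \<notin> tDm' t"
    "tf t \<noteq> tj t" "tV t \<inter> tV' t = {}"
  using assms unfolding tripod_ok_def tdisj_def by - (elim conjE, assumption)+

lemma tripod_ok_swap:
  assumes "tripod_ok w t"
  shows "tripod_ok w (tswap t)"
proof -
  have "tlab (tswap t) = tlab t" by (auto simp: tlab_def tcore_def tswap_def)
  then have "ttimes (tswap t)" using assms unfolding tripod_ok_def ttimes_def by (auto simp: tswap_def)
  moreover have "tsize w (tswap t)" using assms unfolding tripod_ok_def tsize_def by (simp add: tswap_def)
  moreover have "twalks (tswap t)" using assms unfolding tripod_ok_def twalks_def by (simp add: tswap_def) blast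
  moreover have "tdisj (tswap t)"
  proof -
    have sw: "tC (tswap t) = tC t" "tD (tswap t) = tD' t" "tD' (tswap t) = tD t" "tCm (tswap t) = tCm t"
      "tDm (tswap t) = tDm' t" "tDm' (tswap t) = tDm t" "tf (tswap t) = tf t" "tj (tswap t) = tj t"
      "tV (tswap t) = tV' t" "tV' (tswap t) = tV t" by (simp_all add: tswap_def)
    note dj = tripod_disjoint[OF assms]
    have a: "tD' t \<inter> tD t = {}" "tDm' t \<inter> tDm t = {}" "tV' t \<inter> tV t = {}"
      using dj(6,15,29) by (simp_all only: Int_commute)
    show ?thesis unfolding tdisj_def sw by (intro conjI) (fact dj a)+
  qed
  ultimately show ?thesis unfolding tripod_ok_def by simp
qed

text \<open>\<open>T\<close>, a stretch of \<open>r\<close> and \<open>A\<close> form a closed walk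
  at the foot \<open>u\<close>; \<open>T'\<close>, \<open>r\<close> and \<open>A'\<close> form one
  at \<open>u'\<close>. The flag \<open>b\<close> says whether the two closed walks enter
  \<open>r\<close> at the same node or leave it at the same node. \<open>E\<close> is the overlap
  tolerated in the second one.\<close>

definition crossdata ::
  "nat \<Rightarrow> nat \<Rightarrow> nat \<Rightarrow> nat \<Rightarrow> bool \<Rightarrow> nat \<Rightarrow> nat \<Rightarrow> nat set \<Rightarrow>
   nat \<Rightarrow> nat \<Rightarrow> nat \<Rightarrow> nat \<Rightarrow> nat set \<Rightarrow> nat set \<Rightarrow> nat set \<Rightarrow> nat set \<Rightarrow> bool" where
  "crossdata r m m' s b u u' E c d c' d' T A T' A' \<longleftrightarrow>
     pr r c d \<and> pr r c' d' \<and> (if b then c = c' else d = d')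
   \<and> walk pr T u c \<and> walk pr A d u \<and> walk pr T' u' c' \<and> walk pr A' d' u'
   \<and> r \<notin> T \<union> A \<union> T' \<union> A' \<and> (\<forall>l\<in>T \<union> A \<union> T' \<union> A'. l < m \<and> l < m')
   \<and> T \<inter> A = {} \<and> T' \<inter> A' \<subseteq> E
   \<and> card T \<le> s \<and> card A \<le> s \<and> card T' \<le> s \<and> card A' \<le> s"

definition crosses :: "nat \<Rightarrow> nat \<Rightarrow> nat \<Rightarrow> nat \<Rightarrow> bool \<Rightarrow> nat set \<Rightarrow> tripod \<Rightarrow> bool" where
  "crosses r m m' w b E t \<longleftrightarrow> (\<exists>c d c' d' T A T' A'. crossdata r m m' (6 * (w + 1)) b (tu t) (tu' t) E c d c' d' T A T' A')"

text \<open>This is \<open>crossing_bound\<close> with the feet as places on \<open>m\<close> and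
  \<open>m'\<close>. The number \<open>6 * (w + 1)\<close> exceeds both the number of labels of a
  tripod, at most \<open>6 * w + 2\<close>, and that of a walk between the feet, at most
  \<open>2 * w + 1\<close>; the exponent is 9 times as large.\<close>

lemma crossing_tripods:
  assumes finK: "finite K"
    and ok: "\<And>t. t \<in> K \<Longrightarrow> tripod_ok w t"
    and m: "\<And>t. t \<in> K \<Longrightarrow> lam (tu t) = m" "\<And>t. t \<in> K \<Longrightarrow> lam (tu' t) = m'"
    and inj: "inj_on tu K" "inj_on tu' K"
    and r: "r < m" "r < m'"
    and data: "\<forall>t\<in>K. crosses r m m' w b (E t) t"
    and E: "\<And>t t'. t \<in> K \<Longrightarrow> t' \<in> K \<Longrightarrow> t \<noteq> t' \<Longrightarrow> E t \<inter> E t' = {}" "\<And>t. t \<in> K \<Longrightarrow> finite (E t)"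
      "\<And>t. t \<in> K \<Longrightarrow> card (E t) \<le> 6 * (w + 1)"
  shows "card K \<le> 2 ^ (54 * (w + 1))"
proof (cases "K = {}")
  case True
  then show ?thesis by simp
next
  case False
  then obtain t0 where "t0 \<in> K" by auto
  then have ne: "m \<noteq> m'" using ok[of t0] m[of t0] unfolding tripod_ok_def ttimes_def by simp
  obtain c d c' d' T A T' A' where
    D: "\<And>t. t \<in> K \<Longrightarrow> crossdata r m m' (6 * (w + 1)) b (tu t) (tu' t) (E t) (c t) (d t) (c' t) (d' t) (T t) (A t) (T' t) (A' t)"
    using data unfolding crosses_def by metis
  have V: "card (tV t) \<le> 6 * (w + 1)" "card (tV' t) \<le> 6 * (w + 1)" if "t \<in> K" for t
    using ok[OF that] unfolding tripod_ok_def tsize_def by simp_all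
  have D': "pr r (c t) (d t)" "pr r (c' t) (d' t)" "if b then c t = c' t else d t = d' t"
    "walk pr (T t) (tu t) (c t)" "walk pr (A t) (d t) (tu t)" "walk pr (T' t) (tu' t) (c' t)" "walk pr (A' t) (d' t) (tu' t)"
    "r \<notin> T t \<union> A t \<union> T' t \<union> A' t" "\<forall>l\<in>T t \<union> A t \<union> T' t \<union> A' t. l < m \<and> l < m'"
    "T t \<inter> A t = {}" "T' t \<inter> A' t \<subseteq> E t"
    "card (T t) \<le> 6 * (w + 1)" "card (A t) \<le> 6 * (w + 1)" "card (T' t) \<le> 6 * (w + 1)" "card (A' t) \<le> 6 * (w + 1)"
    if "t \<in> K" for t
    using D[OF that, unfolded crossdata_def] by - (elim conjE, assumption)+
  have O: "tu t \<in> on m" "tu' t \<in> on m'" "walk pr (tV t) (tu t) (tu' t)" "walk pr (tV' t) (tu' t) (tu t)"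
    "tV t \<inter> tV' t = {}" "\<forall>l\<in>tV t \<union> tV' t. l < m \<and> l < m'" if "t \<in> K" for t
    using ok[OF that] m[OF that] unfolding tripod_ok_def tdisj_def twalks_def ttimes_def by simp_all
  have "card K \<le> 2 ^ (9 * (6 * (w + 1)))"
  proof (rule crossing_bound[OF finK ne r, where U = tu and U' = tu' and c = c and d = d and c' = c' and d' = d'
        and T = T and A = A and T' = T' and A' = A' and V = tV and V' = tV' and E = E])
    show "(\<forall>k\<in>K. c k = c' k) \<or> (\<forall>k\<in>K. d k = d' k)"
      using D'(3) by (cases b) simp_all
    show "\<And>k l. k \<in> K \<Longrightarrow> l \<in> T k \<union> A k \<union> T' k \<union> A' k \<union> tV k \<union> tV' k \<Longrightarrow> l < m \<and> l < m'"
      using D'(9) O(6) by blast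
    show "\<And>k. k \<in> K \<Longrightarrow>
         card (T k) \<le> 6 * (w + 1) \<and> card (A k) \<le> 6 * (w + 1) \<and> card (T' k) \<le> 6 * (w + 1) \<and> card (A' k) \<le> 6 * (w + 1) \<and>
         card (tV k) \<le> 6 * (w + 1) \<and> card (tV' k) \<le> 6 * (w + 1) \<and> card (E k) \<le> 6 * (w + 1)"
      by (intro conjI D'(12-15) V E(3))
  qed (fact O inj E D')+
  then show ?thesis by simp
qed

lemma tripod_walks:
  assumes "tripod_ok w t"
  obtains s a a' q b b' where
    "walk pr (tC t) (tx t) s" "pr (tf t) s a" "pr (tf t) s a'" "walk pr (tD t) a (tu t)" "walk pr (tD' t) a' (tu' t)"
    "walk pr (tDm t) (tu t) b" "walk pr (tDm' t) (tu' t) b'" "pr (tj t) b q" "pr (tj t) b' q" "walk pr (tCm t) q (tx t)"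
    "walk pr ({tf t} \<union> tD t) s (tu t)" "walk pr ({tf t} \<union> tD' t) s (tu' t)"
    "walk pr (tDm t \<union> {tj t}) (tu t) q" "walk pr (tDm' t \<union> {tj t}) (tu' t) q"
    "walk pr (tC t \<union> ({tf t} \<union> tD t)) (tx t) (tu t)" "walk pr (tC t \<union> ({tf t} \<union> tD' t)) (tx t) (tu' t)"
    "walk pr (tDm t \<union> {tj t} \<union> tCm t) (tu t) (tx t)" "walk pr (tDm' t \<union> {tj t} \<union> tCm t) (tu' t) (tx t)"
    "walk pr ({tj t} \<union> tCm t) b (tx t)" "walk pr (tC t \<union> {tf t}) (tx t) a"
proof -
  note dj = tripod_disjoint[OF assms]
  obtain s a a' q b b' where *: "walk pr (tC t) (tx t) s" "pr (tf t) s a" "pr (tf t) s a'" "walk pr (tD t) a (tu t)" "walk pr (tD' t) a' (tu' t)"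
    "walk pr (tDm t) (tu t) b" "walk pr (tDm' t) (tu' t) b'" "pr (tj t) b q" "pr (tj t) b' q" "walk pr (tCm t) q (tx t)"
    using assms unfolding tripod_ok_def twalks_def by (elim conjE exE) rule
  have 1: "walk pr ({tf t} \<union> tD t) s (tu t)" "walk pr ({tf t} \<union> tD' t) s (tu' t)"
    "walk pr (tDm t \<union> {tj t}) (tu t) q" "walk pr (tDm' t \<union> {tj t}) (tu' t) q"
  proof -
    show "walk pr ({tf t} \<union> tD t) s (tu t)" by (rule walk_trans[OF *(4) walk_arc[of pr, OF *(2)]]) (use dj(17) in simp)
    show "walk pr ({tf t} \<union> tD' t) s (tu' t)" by (rule walk_trans[OF *(5) walk_arc[of pr, OF *(3)]]) (use dj(18) in simp)
    show "walk pr (tDm t \<union> {tj t}) (tu t) q" by (rule walk_trans[OF walk_arc[of pr, OF *(8)] *(6)]) (use dj(26) in simp)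
    show "walk pr (tDm' t \<union> {tj t}) (tu' t) q" by (rule walk_trans[OF walk_arc[of pr, OF *(9)] *(7)]) (use dj(27) in simp)
  qed
  have 2: "walk pr (tC t \<union> ({tf t} \<union> tD t)) (tx t) (tu t)" "walk pr (tC t \<union> ({tf t} \<union> tD' t)) (tx t) (tu' t)"
    "walk pr (tDm t \<union> {tj t} \<union> tCm t) (tu t) (tx t)" "walk pr (tDm' t \<union> {tj t} \<union> tCm t) (tu' t) (tx t)"
  proof -
    show "walk pr (tC t \<union> ({tf t} \<union> tD t)) (tx t) (tu t)" by (rule walk_trans[OF 1(1) *(1)]) (use dj(1,16) in auto)
    show "walk pr (tC t \<union> ({tf t} \<union> tD' t)) (tx t) (tu' t)" by (rule walk_trans[OF 1(2) *(1)]) (use dj(2,16) in auto)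
    show "walk pr (tDm t \<union> {tj t} \<union> tCm t) (tu t) (tx t)" by (rule walk_trans[OF *(10) 1(3)]) (use dj(13,25) in auto)
    show "walk pr (tDm' t \<union> {tj t} \<union> tCm t) (tu' t) (tx t)" by (rule walk_trans[OF *(10) 1(4)]) (use dj(14,25) in auto)
  qed
  have 3: "walk pr ({tj t} \<union> tCm t) b (tx t)"
    by (rule walk_trans[OF *(10) walk_arc[of pr, OF *(8)]]) (use dj(25) in simp)
  have 4: "walk pr (tC t \<union> {tf t}) (tx t) a"
    by (rule walk_trans[OF walk_arc[of pr, OF *(2)] *(1)]) (use dj(16) in simp)
  show ?thesis by (rule that[OF * 1 2 3 4])
qed

lemma tripod_cards:
  assumes "tripod_ok w t"
  shows "card (tC t) \<le> w" "card (tD t) \<le> w" "card (tD' t) \<le> w" "card (tCm t) \<le> w" "card (tDm t) \<le> w" "card (tDm' t) \<le> w"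
    "card {tf t} \<le> 1" "card {tj t} \<le> 1"
  using assms unfolding tripod_ok_def tsize_def by simp_all

lemma tripod_finite:
  assumes "tripod_ok w t"
  shows "finite (tC t)" "finite (tD t)" "finite (tD' t)" "finite (tCm t)" "finite (tDm t)" "finite (tDm' t)"
  by - (rule tripod_walks[OF assms], erule walk_finite)+

lemma tripod_lab:
  assumes "tripod_ok w t"
  shows "finite (tlab t)" "card (tlab t) \<le> 6 * w + 2" "finite (tcore t)" "card (tcore t) \<le> 2 * w + 2"
    "\<forall>l\<in>tlab t. l < lam (tu t) \<and> l < lam (tu' t)"
proof -
  note cs = tripod_cards[OF assms]
  have 1: "card (tcore t) \<le> 2 * w + 2"
    using card_Un_bound[OF card_Un_bound[OF cs(1,4)] card_Un_bound[OF cs(7,8)]]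
    by (simp add: tcore_def insert_commute mult_2)
  show "card (tlab t) \<le> 6 * w + 2"
    using card_Un_bound[OF card_Un_bound[OF card_Un_bound[OF card_Un_bound[OF 1 cs(2)] cs(3)] cs(5)] cs(6)]
    by (simp add: tlab_def)
  show "finite (tlab t)" "finite (tcore t)" using tripod_finite[OF assms] by (simp_all add: tlab_def tcore_def)
  show "\<forall>l\<in>tlab t. l < lam (tu t) \<and> l < lam (tu' t)"
    using assms unfolding tripod_ok_def ttimes_def by blast
  show "card (tcore t) \<le> 2 * w + 2" by (rule 1)
qed

text \<open>Disjointness of unions of parts is proved by comparing colours.\<close>

definition tcol :: "tripod \<Rightarrow> nat \<Rightarrow> nat" where
  "tcol t l = (if l \<in> tC t then 0 else if l \<in> tD t then 1 else if l \<in> tD' t then 2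
     else if l \<in> tCm t then 3 else if l \<in> tDm t then 4 else if l \<in> tDm' t then 5 else if l = tf t then 6 else 7)"

lemma tripod_coloring:
  assumes "tripod_ok w t"
  shows "l \<in> tC t \<Longrightarrow> tcol t l = 0" "l \<in> tD t \<Longrightarrow> tcol t l = 1" "l \<in> tD' t \<Longrightarrow> tcol t l = 2"
    "l \<in> tCm t \<Longrightarrow> tcol t l = 3" "l \<in> tDm t \<Longrightarrow> tcol t l = 4" "l \<in> tDm' t \<Longrightarrow> tcol t l = 5"
    "tcol t (tf t) = 6" "tcol t (tj t) = 7"
proof -
  note dj = tripod_disjoint[OF assms]
  show "tcol t l = 0" if "l \<in> tC t" using that by (simp add: tcol_def)
  show "tcol t l = 1" if "l \<in> tD t" using that dj(1) by (auto simp: tcol_def)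
  show "tcol t l = 2" if "l \<in> tD' t" using that dj(2,6) by (auto simp: tcol_def)
  show "tcol t l = 3" if "l \<in> tCm t" using that dj(3,7,10) by (auto simp: tcol_def)
  show "tcol t l = 4" if "l \<in> tDm t" using that dj(4,8,11,13) by (auto simp: tcol_def)
  show "tcol t l = 5" if "l \<in> tDm' t" using that dj(5,9,12,14,15) by (auto simp: tcol_def)
  show "tcol t (tf t) = 6" using dj(16-21) by (simp add: tcol_def)
  show "tcol t (tj t) = 7" using dj(22-28) by (simp add: tcol_def)
qed

lemma crossdataI:
  assumes "tripod_ok w t" and m: "lam (tu t) = m" "lam (tu' t) = m'"
    and "pr r c d" "pr r c' d'" "if b then c = c' else d = d'"
    and "walk pr T (tu t) c" "walk pr A d (tu t)" "walk pr T' (tu' t) c'" "walk pr A' d' (tu' t)"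
    and "r \<notin> T \<union> A \<union> T' \<union> A'" and sub: "T \<union> A \<union> T' \<union> A' \<subseteq> tlab t"
    and "T \<inter> A = {}" "T' \<inter> A' \<subseteq> E"
  shows "crosses r m m' w b E t"
proof -
  note lab = tripod_lab[OF assms(1)]
  have cX: "card X \<le> 6 * (w + 1)" if "X \<subseteq> tlab t" for X
    using card_mono[OF lab(1) that] lab(2) by simp
  have "\<forall>l\<in>T \<union> A \<union> T' \<union> A'. l < m \<and> l < m'" using lab(5) sub m by blast
  moreover have "T \<subseteq> tlab t" "A \<subseteq> tlab t" "T' \<subseteq> tlab t" "A' \<subseteq> tlab t" using sub by blast+
  ultimately have "crossdata r m m' (6 * (w + 1)) b (tu t) (tu' t) E c d c' d' T A T' A'"
    unfolding crossdata_def by (intro conjI assms(4-) cX)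
  then show ?thesis unfolding crosses_def by blast
qed

section \<open>Closed walks from both feet through a given label of a tripod\<close>

context
  fixes w t m m'
  assumes ok: "tripod_ok w t" and m: "lam (tu t) = m" "lam (tu' t) = m'"
begin

text \<open>Both feet climb to the tip, follow the common descent through \<open>r\<close> and
  separate only afterwards at the fork. Ascents and descents are disjoint, so no overlap has to be
  tolerated.\<close>

lemma crossdata_C:
  assumes "r \<in> tC t"
  shows "crosses r m m' w True {} t"
proof -
  obtain s a a' q b b' where W: "walk pr (tC t) (tx t) s" "pr (tf t) s a" "pr (tf t) s a'" "walk pr (tD t) a (tu t)" "walk pr (tD' t) a' (tu' t)"
    "walk pr (tDm t) (tu t) b" "walk pr (tDm' t) (tu' t) b'" "pr (tj t) b q" "pr (tj t) b' q" "walk pr (tCm t) q (tx t)"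
    and W2: "walk pr ({tf t} \<union> tD t) s (tu t)" "walk pr ({tf t} \<union> tD' t) s (tu' t)"
    "walk pr (tDm t \<union> {tj t}) (tu t) q" "walk pr (tDm' t \<union> {tj t}) (tu' t) q"
    and dn: "walk pr (tC t \<union> ({tf t} \<union> tD t)) (tx t) (tu t)" and dn': "walk pr (tC t \<union> ({tf t} \<union> tD' t)) (tx t) (tu' t)"
    and up: "walk pr (tDm t \<union> {tj t} \<union> tCm t) (tu t) (tx t)" and up': "walk pr (tDm' t \<union> {tj t} \<union> tCm t) (tu' t) (tx t)"
    and W3: "walk pr ({tj t} \<union> tCm t) b (tx t)" "walk pr (tC t \<union> {tf t}) (tx t) a"
    by (rule tripod_walks[OF ok])
  note K = tripod_coloring[OF ok]
  have ne: "tf t \<noteq> tj t" "tj t \<noteq> tf t" using tripod_disjoint(28)[OF ok] by auto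
  obtain A B c d where S: "walk pr A (tx t) c" "pr r c d" "walk pr B d s" "tC t = insert r (A \<union> B)"
    "r \<notin> A" "r \<notin> B" "A \<inter> B = {}" by (rule walk_split[OF W(1) assms])
  \<comment> \<open>The colour of \<open>tC t\<close> is refined: the part \<open>A\<close> before
    \<open>r\<close> keeps 0, the part \<open>B\<close> after it gets 8, and \<open>r\<close> itself
    gets 9.\<close>
  define \<kappa> where "\<kappa> l = (if tcol t l = 0 then (if l \<in> B then 8 else if l = r then 9 else 0) else tcol t l)" for l
  have KA: "\<And>l. l \<in> A \<Longrightarrow> \<kappa> l = 0" "\<And>l. l \<in> B \<Longrightarrow> \<kappa> l = 8" "\<kappa> r = 9" "\<kappa> (tf t) = 6" "\<kappa> (tj t) = 7"
    "\<And>l. l \<in> tD t \<Longrightarrow> \<kappa> l = 1" "\<And>l. l \<in> tD' t \<Longrightarrow> \<kappa> l = 2" "\<And>l. l \<in> tCm t \<Longrightarrow> \<kappa> l = 3"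
    "\<And>l. l \<in> tDm t \<Longrightarrow> \<kappa> l = 4" "\<And>l. l \<in> tDm' t \<Longrightarrow> \<kappa> l = 5"
    using K S(4-7) by (auto simp: \<kappa>_def)
  have rn: "r \<noteq> tf t" "r \<noteq> tj t" using KA(3-5) by auto
  have sub: "A \<subseteq> tlab t" "B \<subseteq> tlab t" using S(4) by (auto simp: tlab_def tcore_def)
  show ?thesis
  proof (rule crossdataI[OF ok m, of r c d c d])
    show "walk pr (tDm t \<union> {tj t} \<union> tCm t \<union> A) (tu t) c"
      by (rule walk_trans[OF S(1) up]) (auto dest!: KA(1,2,6-10) simp: KA(3-5) ne rn)
    show "walk pr (B \<union> ({tf t} \<union> tD t)) d (tu t)"
      by (rule walk_trans[OF W2(1) S(3)]) (auto dest!: KA(1,2,6-10) simp: KA(3-5) ne rn)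
    show "walk pr (tDm' t \<union> {tj t} \<union> tCm t \<union> A) (tu' t) c"
      by (rule walk_trans[OF S(1) up']) (auto dest!: KA(1,2,6-10) simp: KA(3-5) ne rn)
    show "walk pr (B \<union> ({tf t} \<union> tD' t)) d (tu' t)"
      by (rule walk_trans[OF W2(2) S(3)]) (auto dest!: KA(1,2,6-10) simp: KA(3-5) ne rn)
    show "r \<notin> (tDm t \<union> {tj t} \<union> tCm t \<union> A) \<union> (B \<union> ({tf t} \<union> tD t)) \<union> (tDm' t \<union> {tj t} \<union> tCm t \<union> A) \<union> (B \<union> ({tf t} \<union> tD' t))"
      by (auto dest!: KA(1,2,6-10) simp: KA(3-5) ne rn)
    show "(tDm t \<union> {tj t} \<union> tCm t \<union> A) \<union> (B \<union> ({tf t} \<union> tD t)) \<union> (tDm' t \<union> {tj t} \<union> tCm t \<union> A) \<union> (B \<union> ({tf t} \<union> tD' t)) \<subseteq> tlab t"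
      using sub by (auto simp: tlab_def tcore_def)
    show "(tDm t \<union> {tj t} \<union> tCm t \<union> A) \<inter> (B \<union> ({tf t} \<union> tD t)) = {}"
      by (auto dest!: KA(1,2,6-10) simp: KA(3-5) ne rn)
    show "(tDm' t \<union> {tj t} \<union> tCm t \<union> A) \<inter> (B \<union> ({tf t} \<union> tD' t)) \<subseteq> {}"
      by (auto dest!: KA(1,2,6-10) simp: KA(3-5) ne rn)
  qed (use S(2) in simp_all)
qed

text \<open>Here the walks of the feet have already joined before they meet \<open>r\<close>, and
  they return over the tip and the fork.\<close>

lemma crossdata_Cm:
  assumes "r \<in> tCm t"
  shows "crosses r m m' w True {} t"
proof -
  obtain s a a' q b b' where W: "walk pr (tC t) (tx t) s" "pr (tf t) s a" "pr (tf t) s a'" "walk pr (tD t) a (tu t)" "walk pr (tD' t) a' (tu' t)"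
    "walk pr (tDm t) (tu t) b" "walk pr (tDm' t) (tu' t) b'" "pr (tj t) b q" "pr (tj t) b' q" "walk pr (tCm t) q (tx t)"
    and W2: "walk pr ({tf t} \<union> tD t) s (tu t)" "walk pr ({tf t} \<union> tD' t) s (tu' t)"
    "walk pr (tDm t \<union> {tj t}) (tu t) q" "walk pr (tDm' t \<union> {tj t}) (tu' t) q"
    and dn: "walk pr (tC t \<union> ({tf t} \<union> tD t)) (tx t) (tu t)" and dn': "walk pr (tC t \<union> ({tf t} \<union> tD' t)) (tx t) (tu' t)"
    and up: "walk pr (tDm t \<union> {tj t} \<union> tCm t) (tu t) (tx t)" and up': "walk pr (tDm' t \<union> {tj t} \<union> tCm t) (tu' t) (tx t)"
    and W3: "walk pr ({tj t} \<union> tCm t) b (tx t)" "walk pr (tC t \<union> {tf t}) (tx t) a"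
    by (rule tripod_walks[OF ok])
  note K = tripod_coloring[OF ok]
  have ne: "tf t \<noteq> tj t" "tj t \<noteq> tf t" using tripod_disjoint(28)[OF ok] by auto
  obtain A B c d where S: "walk pr A q c" "pr r c d" "walk pr B d (tx t)" "tCm t = insert r (A \<union> B)"
    "r \<notin> A" "r \<notin> B" "A \<inter> B = {}" by (rule walk_split[OF W(10) assms])
  define \<kappa> where "\<kappa> l = (if tcol t l = 3 then (if l \<in> B then 8 else if l = r then 9 else 3) else tcol t l)" for l
  have KA: "\<And>l. l \<in> A \<Longrightarrow> \<kappa> l = 3" "\<And>l. l \<in> B \<Longrightarrow> \<kappa> l = 8" "\<kappa> r = 9" "\<kappa> (tf t) = 6" "\<kappa> (tj t) = 7"
    "\<And>l. l \<in> tC t \<Longrightarrow> \<kappa> l = 0" "\<And>l. l \<in> tD t \<Longrightarrow> \<kappa> l = 1" "\<And>l. l \<in> tD' t \<Longrightarrow> \<kappa> l = 2"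
    "\<And>l. l \<in> tDm t \<Longrightarrow> \<kappa> l = 4" "\<And>l. l \<in> tDm' t \<Longrightarrow> \<kappa> l = 5"
    using K S(4-7) by (auto simp: \<kappa>_def)
  have rn: "r \<noteq> tf t" "r \<noteq> tj t" using KA(3-5) by auto
  have sub: "A \<subseteq> tlab t" "B \<subseteq> tlab t" using S(4) by (auto simp: tlab_def tcore_def)
  show ?thesis
  proof (rule crossdataI[OF ok m, of r c d c d])
    show "walk pr (tDm t \<union> {tj t} \<union> A) (tu t) c"
      by (rule walk_trans[OF S(1) W2(3)]) (auto dest!: KA(1,2,6-10) simp: KA(3-5) ne rn)
    show "walk pr (B \<union> (tC t \<union> ({tf t} \<union> tD t))) d (tu t)"
      by (rule walk_trans[OF dn S(3)]) (auto dest!: KA(1,2,6-10) simp: KA(3-5) ne rn)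
    show "walk pr (tDm' t \<union> {tj t} \<union> A) (tu' t) c"
      by (rule walk_trans[OF S(1) W2(4)]) (auto dest!: KA(1,2,6-10) simp: KA(3-5) ne rn)
    show "walk pr (B \<union> (tC t \<union> ({tf t} \<union> tD' t))) d (tu' t)"
      by (rule walk_trans[OF dn' S(3)]) (auto dest!: KA(1,2,6-10) simp: KA(3-5) ne rn)
    show "r \<notin> (tDm t \<union> {tj t} \<union> A) \<union> (B \<union> (tC t \<union> ({tf t} \<union> tD t))) \<union> (tDm' t \<union> {tj t} \<union> A) \<union> (B \<union> (tC t \<union> ({tf t} \<union> tD' t)))"
      by (auto dest!: KA(1,2,6-10) simp: KA(3-5) ne rn)
    show "(tDm t \<union> {tj t} \<union> A) \<union> (B \<union> (tC t \<union> ({tf t} \<union> tD t))) \<union> (tDm' t \<union> {tj t} \<union> A) \<union> (B \<union> (tC t \<union> ({tf t} \<union> tD' t))) \<subseteq> tlab t"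
      using sub by (auto simp: tlab_def tcore_def)
    show "(tDm t \<union> {tj t} \<union> A) \<inter> (B \<union> (tC t \<union> ({tf t} \<union> tD t))) = {}"
      by (auto dest!: KA(1,2,6-10) simp: KA(3-5) ne rn)
    show "(tDm' t \<union> {tj t} \<union> A) \<inter> (B \<union> (tC t \<union> ({tf t} \<union> tD' t))) \<subseteq> {}"
      by (auto dest!: KA(1,2,6-10) simp: KA(3-5) ne rn)
  qed (use S(2) in simp_all)
qed

text \<open>At the fork both closed walks enter \<open>r\<close> at the same node but may leave it
  at different ones.\<close>

lemma crossdata_f:
  assumes "r = tf t"
  shows "crosses r m m' w True {} t"
proof -
  obtain s a a' q b b' where W: "walk pr (tC t) (tx t) s" "pr (tf t) s a" "pr (tf t) s a'" "walk pr (tD t) a (tu t)" "walk pr (tD' t) a' (tu' t)"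
    "walk pr (tDm t) (tu t) b" "walk pr (tDm' t) (tu' t) b'" "pr (tj t) b q" "pr (tj t) b' q" "walk pr (tCm t) q (tx t)"
    and W2: "walk pr ({tf t} \<union> tD t) s (tu t)" "walk pr ({tf t} \<union> tD' t) s (tu' t)"
    "walk pr (tDm t \<union> {tj t}) (tu t) q" "walk pr (tDm' t \<union> {tj t}) (tu' t) q"
    and dn: "walk pr (tC t \<union> ({tf t} \<union> tD t)) (tx t) (tu t)" and dn': "walk pr (tC t \<union> ({tf t} \<union> tD' t)) (tx t) (tu' t)"
    and up: "walk pr (tDm t \<union> {tj t} \<union> tCm t) (tu t) (tx t)" and up': "walk pr (tDm' t \<union> {tj t} \<union> tCm t) (tu' t) (tx t)"
    and W3: "walk pr ({tj t} \<union> tCm t) b (tx t)" "walk pr (tC t \<union> {tf t}) (tx t) a"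
    by (rule tripod_walks[OF ok])
  note K = tripod_coloring[OF ok]
  have ne: "tf t \<noteq> tj t" "tj t \<noteq> tf t" using tripod_disjoint(28)[OF ok] by auto
  show ?thesis
  proof (rule crossdataI[OF ok m, of r s a s a'])
    show "walk pr (tDm t \<union> {tj t} \<union> tCm t \<union> tC t) (tu t) s"
      by (rule walk_trans[OF W(1) up]) (auto dest!: K(1-6) simp: K(7,8) ne)
    show "walk pr (tD t) a (tu t)"
      by (rule W(4))
    show "walk pr (tDm' t \<union> {tj t} \<union> tCm t \<union> tC t) (tu' t) s"
      by (rule walk_trans[OF W(1) up']) (auto dest!: K(1-6) simp: K(7,8) ne)
    show "walk pr (tD' t) a' (tu' t)"
      by (rule W(5))
    show "r \<notin> (tDm t \<union> {tj t} \<union> tCm t \<union> tC t) \<union> (tD t) \<union> (tDm' t \<union> {tj t} \<union> tCm t \<union> tC t) \<union> (tD' t)"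
      by (auto simp: assms dest!: K(1-6) simp: K(7,8) ne)
    show "(tDm t \<union> {tj t} \<union> tCm t \<union> tC t) \<union> (tD t) \<union> (tDm' t \<union> {tj t} \<union> tCm t \<union> tC t) \<union> (tD' t) \<subseteq> tlab t"
      by (auto simp: tlab_def tcore_def)
    show "(tDm t \<union> {tj t} \<union> tCm t \<union> tC t) \<inter> (tD t) = {}"
      by (auto dest!: K(1-6) simp: K(7,8) ne)
    show "(tDm' t \<union> {tj t} \<union> tCm t \<union> tC t) \<inter> (tD' t) \<subseteq> {}"
      by (auto dest!: K(1-6) simp: K(7,8) ne)
  qed (use assms W(2,3) in simp_all)
qed

text \<open>At the joining path the entries may differ while the exit is the same, the only case
  with flag \<open>False\<close>.\<close>

lemma crossdata_j:
  assumes "r = tj t"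
  shows "crosses r m m' w False {} t"
proof -
  obtain s a a' q b b' where W: "walk pr (tC t) (tx t) s" "pr (tf t) s a" "pr (tf t) s a'" "walk pr (tD t) a (tu t)" "walk pr (tD' t) a' (tu' t)"
    "walk pr (tDm t) (tu t) b" "walk pr (tDm' t) (tu' t) b'" "pr (tj t) b q" "pr (tj t) b' q" "walk pr (tCm t) q (tx t)"
    and W2: "walk pr ({tf t} \<union> tD t) s (tu t)" "walk pr ({tf t} \<union> tD' t) s (tu' t)"
    "walk pr (tDm t \<union> {tj t}) (tu t) q" "walk pr (tDm' t \<union> {tj t}) (tu' t) q"
    and dn: "walk pr (tC t \<union> ({tf t} \<union> tD t)) (tx t) (tu t)" and dn': "walk pr (tC t \<union> ({tf t} \<union> tD' t)) (tx t) (tu' t)"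
    and up: "walk pr (tDm t \<union> {tj t} \<union> tCm t) (tu t) (tx t)" and up': "walk pr (tDm' t \<union> {tj t} \<union> tCm t) (tu' t) (tx t)"
    and W3: "walk pr ({tj t} \<union> tCm t) b (tx t)" "walk pr (tC t \<union> {tf t}) (tx t) a"
    by (rule tripod_walks[OF ok])
  note K = tripod_coloring[OF ok]
  have ne: "tf t \<noteq> tj t" "tj t \<noteq> tf t" using tripod_disjoint(28)[OF ok] by auto
  show ?thesis
  proof (rule crossdataI[OF ok m, of r b q b' q])
    show "walk pr (tDm t) (tu t) b"
      by (rule W(6))
    show "walk pr (tCm t \<union> (tC t \<union> ({tf t} \<union> tD t))) q (tu t)"
      by (rule walk_trans[OF dn W(10)]) (auto dest!: K(1-6) simp: K(7,8) ne)
    show "walk pr (tDm' t) (tu' t) b'"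
      by (rule W(7))
    show "walk pr (tCm t \<union> (tC t \<union> ({tf t} \<union> tD' t))) q (tu' t)"
      by (rule walk_trans[OF dn' W(10)]) (auto dest!: K(1-6) simp: K(7,8) ne)
    show "r \<notin> (tDm t) \<union> (tCm t \<union> (tC t \<union> ({tf t} \<union> tD t))) \<union> (tDm' t) \<union> (tCm t \<union> (tC t \<union> ({tf t} \<union> tD' t)))"
      by (auto simp: assms dest!: K(1-6) simp: K(7,8) ne)
    show "(tDm t) \<union> (tCm t \<union> (tC t \<union> ({tf t} \<union> tD t))) \<union> (tDm' t) \<union> (tCm t \<union> (tC t \<union> ({tf t} \<union> tD' t))) \<subseteq> tlab t"
      by (auto simp: tlab_def tcore_def)
    show "(tDm t) \<inter> (tCm t \<union> (tC t \<union> ({tf t} \<union> tD t))) = {}"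
      by (auto dest!: K(1-6) simp: K(7,8) ne)
    show "(tDm' t) \<inter> (tCm t \<union> (tC t \<union> ({tf t} \<union> tD' t))) \<subseteq> {}"
      by (auto dest!: K(1-6) simp: K(7,8) ne)
  qed (use assms W(8,9) in simp_all)
qed

text \<open>The label lies on the branch down to \<open>tu t\<close>. The other foot can reach it
  over the tip, but to get home it must go on to \<open>tu t\<close>, climb to the tip again and
  descend on its own branch. The core is traversed twice, so it is the tolerated overlap.\<close>

lemma crossdata_D:
  assumes "r \<in> tD t"
  shows "crosses r m m' w True (tcore t) t"
proof -
  obtain s a a' q b b' where W: "walk pr (tC t) (tx t) s" "pr (tf t) s a" "pr (tf t) s a'" "walk pr (tD t) a (tu t)" "walk pr (tD' t) a' (tu' t)"
    "walk pr (tDm t) (tu t) b" "walk pr (tDm' t) (tu' t) b'" "pr (tj t) b q" "pr (tj t) b' q" "walk pr (tCm t) q (tx t)"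
    and W2: "walk pr ({tf t} \<union> tD t) s (tu t)" "walk pr ({tf t} \<union> tD' t) s (tu' t)"
    "walk pr (tDm t \<union> {tj t}) (tu t) q" "walk pr (tDm' t \<union> {tj t}) (tu' t) q"
    and dn: "walk pr (tC t \<union> ({tf t} \<union> tD t)) (tx t) (tu t)" and dn': "walk pr (tC t \<union> ({tf t} \<union> tD' t)) (tx t) (tu' t)"
    and up: "walk pr (tDm t \<union> {tj t} \<union> tCm t) (tu t) (tx t)" and up': "walk pr (tDm' t \<union> {tj t} \<union> tCm t) (tu' t) (tx t)"
    and W3: "walk pr ({tj t} \<union> tCm t) b (tx t)" "walk pr (tC t \<union> {tf t}) (tx t) a"
    by (rule tripod_walks[OF ok])
  note K = tripod_coloring[OF ok]
  have ne: "tf t \<noteq> tj t" "tj t \<noteq> tf t" using tripod_disjoint(28)[OF ok] by auto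
  obtain A B c d where S: "walk pr A a c" "pr r c d" "walk pr B d (tu t)" "tD t = insert r (A \<union> B)"
    "r \<notin> A" "r \<notin> B" "A \<inter> B = {}" by (rule walk_split[OF W(4) assms])
  define \<kappa> where "\<kappa> l = (if tcol t l = 1 then (if l \<in> B then 8 else if l = r then 9 else 1) else tcol t l)" for l
  have KA: "\<And>l. l \<in> A \<Longrightarrow> \<kappa> l = 1" "\<And>l. l \<in> B \<Longrightarrow> \<kappa> l = 8" "\<kappa> r = 9" "\<kappa> (tf t) = 6" "\<kappa> (tj t) = 7"
    "\<And>l. l \<in> tC t \<Longrightarrow> \<kappa> l = 0" "\<And>l. l \<in> tD' t \<Longrightarrow> \<kappa> l = 2" "\<And>l. l \<in> tCm t \<Longrightarrow> \<kappa> l = 3"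
    "\<And>l. l \<in> tDm t \<Longrightarrow> \<kappa> l = 4" "\<And>l. l \<in> tDm' t \<Longrightarrow> \<kappa> l = 5"
    using K S(4-7) by (auto simp: \<kappa>_def)
  have rn: "r \<noteq> tf t" "r \<noteq> tj t" using KA(3-5) by auto
  have sub: "A \<subseteq> tlab t" "B \<subseteq> tlab t" using S(4) by (auto simp: tlab_def tcore_def)
  have 1: "walk pr (tDm t \<union> {tj t} \<union> tCm t \<union> (tC t \<union> {tf t})) (tu t) a"
    by (rule walk_trans[OF W3(2) up]) (auto dest!: K(1-6) simp: K(7,8) ne)
  have 2: "walk pr (tDm' t \<union> {tj t} \<union> tCm t \<union> (tC t \<union> {tf t})) (tu' t) a"
    by (rule walk_trans[OF W3(2) up']) (auto dest!: K(1-6) simp: K(7,8) ne)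
  have 3: "walk pr (tDm t \<union> {tj t} \<union> tCm t \<union> (tC t \<union> ({tf t} \<union> tD' t))) (tu t) (tu' t)"
    by (rule walk_trans[OF dn' up]) (auto dest!: K(1-6) simp: K(7,8) ne)
  have X: "(tDm' t \<union> A) \<inter> (B \<union> (tDm t \<union> tD' t)) = {}"
    by (auto dest!: KA(1,2,6-10) simp: KA(3-5) ne rn)
  show ?thesis
  proof (rule crossdataI[OF ok m, of r c d c d])
    show "walk pr (tDm t \<union> {tj t} \<union> tCm t \<union> (tC t \<union> {tf t}) \<union> A) (tu t) c"
      by (rule walk_trans[OF S(1) 1]) (auto dest!: KA(1,2,6-10) simp: KA(3-5) ne rn)
    show "walk pr (B) d (tu t)"
      by (rule S(3))
    show "walk pr (tDm' t \<union> {tj t} \<union> tCm t \<union> (tC t \<union> {tf t}) \<union> A) (tu' t) c"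
      by (rule walk_trans[OF S(1) 2]) (auto dest!: KA(1,2,6-10) simp: KA(3-5) ne rn)
    show "walk pr (B \<union> (tDm t \<union> {tj t} \<union> tCm t \<union> (tC t \<union> ({tf t} \<union> tD' t)))) d (tu' t)"
      by (rule walk_trans[OF 3 S(3)]) (auto dest!: KA(1,2,6-10) simp: KA(3-5) ne rn)
    show "r \<notin> (tDm t \<union> {tj t} \<union> tCm t \<union> (tC t \<union> {tf t}) \<union> A) \<union> (B) \<union> (tDm' t \<union> {tj t} \<union> tCm t \<union> (tC t \<union> {tf t}) \<union> A) \<union> (B \<union> (tDm t \<union> {tj t} \<union> tCm t \<union> (tC t \<union> ({tf t} \<union> tD' t))))"
      by (auto dest!: KA(1,2,6-10) simp: KA(3-5) ne rn)
    show "(tDm t \<union> {tj t} \<union> tCm t \<union> (tC t \<union> {tf t}) \<union> A) \<union> (B) \<union> (tDm' t \<union> {tj t} \<union> tCm t \<union> (tC t \<union> {tf t}) \<union> A) \<union> (B \<union> (tDm t \<union> {tj t} \<union> tCm t \<union> (tC t \<union> ({tf t} \<union> tD' t)))) \<subseteq> tlab t"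
      using sub by (auto simp: tlab_def tcore_def)
    show "(tDm t \<union> {tj t} \<union> tCm t \<union> (tC t \<union> {tf t}) \<union> A) \<inter> (B) = {}"
      by (auto dest!: KA(1,2,6-10) simp: KA(3-5) ne rn)
    show "(tDm' t \<union> {tj t} \<union> tCm t \<union> (tC t \<union> {tf t}) \<union> A) \<inter> (B \<union> (tDm t \<union> {tj t} \<union> tCm t \<union> (tC t \<union> ({tf t} \<union> tD' t)))) \<subseteq> tcore t"
      using X unfolding tcore_def by blast
  qed (use S(2) in simp_all)
qed

text \<open>Now the label lies on the branch up from \<open>tu t\<close>, so the other foot first
  has to walk over the tip to \<open>tu t\<close>, and its way back from \<open>r\<close> uses the
  core a second time.\<close>

lemma crossdata_Dm:
  assumes "r \<in> tDm t"
  shows "crosses r m m' w True (tcore t) t"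
proof -
  obtain s a a' q b b' where W: "walk pr (tC t) (tx t) s" "pr (tf t) s a" "pr (tf t) s a'" "walk pr (tD t) a (tu t)" "walk pr (tD' t) a' (tu' t)"
    "walk pr (tDm t) (tu t) b" "walk pr (tDm' t) (tu' t) b'" "pr (tj t) b q" "pr (tj t) b' q" "walk pr (tCm t) q (tx t)"
    and W2: "walk pr ({tf t} \<union> tD t) s (tu t)" "walk pr ({tf t} \<union> tD' t) s (tu' t)"
    "walk pr (tDm t \<union> {tj t}) (tu t) q" "walk pr (tDm' t \<union> {tj t}) (tu' t) q"
    and dn: "walk pr (tC t \<union> ({tf t} \<union> tD t)) (tx t) (tu t)" and dn': "walk pr (tC t \<union> ({tf t} \<union> tD' t)) (tx t) (tu' t)"
    and up: "walk pr (tDm t \<union> {tj t} \<union> tCm t) (tu t) (tx t)" and up': "walk pr (tDm' t \<union> {tj t} \<union> tCm t) (tu' t) (tx t)"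
    and W3: "walk pr ({tj t} \<union> tCm t) b (tx t)" "walk pr (tC t \<union> {tf t}) (tx t) a"
    by (rule tripod_walks[OF ok])
  note K = tripod_coloring[OF ok]
  have ne: "tf t \<noteq> tj t" "tj t \<noteq> tf t" using tripod_disjoint(28)[OF ok] by auto
  obtain A B c d where S: "walk pr A (tu t) c" "pr r c d" "walk pr B d b" "tDm t = insert r (A \<union> B)"
    "r \<notin> A" "r \<notin> B" "A \<inter> B = {}" by (rule walk_split[OF W(6) assms])
  define \<kappa> where "\<kappa> l = (if tcol t l = 4 then (if l \<in> B then 8 else if l = r then 9 else 4) else tcol t l)" for l
  have KA: "\<And>l. l \<in> A \<Longrightarrow> \<kappa> l = 4" "\<And>l. l \<in> B \<Longrightarrow> \<kappa> l = 8" "\<kappa> r = 9" "\<kappa> (tf t) = 6" "\<kappa> (tj t) = 7"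
    "\<And>l. l \<in> tC t \<Longrightarrow> \<kappa> l = 0" "\<And>l. l \<in> tD t \<Longrightarrow> \<kappa> l = 1" "\<And>l. l \<in> tD' t \<Longrightarrow> \<kappa> l = 2"
    "\<And>l. l \<in> tCm t \<Longrightarrow> \<kappa> l = 3" "\<And>l. l \<in> tDm' t \<Longrightarrow> \<kappa> l = 5"
    using K S(4-7) by (auto simp: \<kappa>_def)
  have rn: "r \<noteq> tf t" "r \<noteq> tj t" using KA(3-5) by auto
  have sub: "A \<subseteq> tlab t" "B \<subseteq> tlab t" using S(4) by (auto simp: tlab_def tcore_def)
  have 1: "walk pr ({tj t} \<union> tCm t \<union> (tC t \<union> ({tf t} \<union> tD t))) b (tu t)"
    by (rule walk_trans[OF dn W3(1)]) (auto dest!: K(1-6) simp: K(7,8) ne)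
  have 2: "walk pr ({tj t} \<union> tCm t \<union> (tC t \<union> ({tf t} \<union> tD' t))) b (tu' t)"
    by (rule walk_trans[OF dn' W3(1)]) (auto dest!: K(1-6) simp: K(7,8) ne)
  have 3: "walk pr (tDm' t \<union> {tj t} \<union> tCm t \<union> (tC t \<union> ({tf t} \<union> tD t))) (tu' t) (tu t)"
    by (rule walk_trans[OF dn up']) (auto dest!: K(1-6) simp: K(7,8) ne)
  have X: "(tDm' t \<union> tD t \<union> A) \<inter> (B \<union> tD' t) = {}"
    by (auto dest!: KA(1,2,6-10) simp: KA(3-5) ne rn)
  show ?thesis
  proof (rule crossdataI[OF ok m, of r c d c d])
    show "walk pr (A) (tu t) c"
      by (rule S(1))
    show "walk pr (B \<union> ({tj t} \<union> tCm t \<union> (tC t \<union> ({tf t} \<union> tD t)))) d (tu t)"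
      by (rule walk_trans[OF 1 S(3)]) (auto dest!: KA(1,2,6-10) simp: KA(3-5) ne rn)
    show "walk pr (tDm' t \<union> {tj t} \<union> tCm t \<union> (tC t \<union> ({tf t} \<union> tD t)) \<union> A) (tu' t) c"
      by (rule walk_trans[OF S(1) 3]) (auto dest!: KA(1,2,6-10) simp: KA(3-5) ne rn)
    show "walk pr (B \<union> ({tj t} \<union> tCm t \<union> (tC t \<union> ({tf t} \<union> tD' t)))) d (tu' t)"
      by (rule walk_trans[OF 2 S(3)]) (auto dest!: KA(1,2,6-10) simp: KA(3-5) ne rn)
    show "r \<notin> (A) \<union> (B \<union> ({tj t} \<union> tCm t \<union> (tC t \<union> ({tf t} \<union> tD t)))) \<union> (tDm' t \<union> {tj t} \<union> tCm t \<union> (tC t \<union> ({tf t} \<union> tD t)) \<union> A) \<union> (B \<union> ({tj t} \<union> tCm t \<union> (tC t \<union> ({tf t} \<union> tD' t))))"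
      by (auto dest!: KA(1,2,6-10) simp: KA(3-5) ne rn)
    show "(A) \<union> (B \<union> ({tj t} \<union> tCm t \<union> (tC t \<union> ({tf t} \<union> tD t)))) \<union> (tDm' t \<union> {tj t} \<union> tCm t \<union> (tC t \<union> ({tf t} \<union> tD t)) \<union> A) \<union> (B \<union> ({tj t} \<union> tCm t \<union> (tC t \<union> ({tf t} \<union> tD' t)))) \<subseteq> tlab t"
      using sub by (auto simp: tlab_def tcore_def)
    show "(A) \<inter> (B \<union> ({tj t} \<union> tCm t \<union> (tC t \<union> ({tf t} \<union> tD t)))) = {}"
      by (auto dest!: KA(1,2,6-10) simp: KA(3-5) ne rn)
    show "(tDm' t \<union> {tj t} \<union> tCm t \<union> (tC t \<union> ({tf t} \<union> tD t)) \<union> A) \<inter> (B \<union> ({tj t} \<union> tCm t \<union> (tC t \<union> ({tf t} \<union> tD' t)))) \<subseteq> tcore t"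
      using X unfolding tcore_def by blast
  qed (use S(2) in simp_all)
qed

end

end

subsection \<open>No label occurs in many tripods of one pair of paths\<close>

text \<open>The exponent is \<open>54 + 54\<close> for two uses of the crossing bound, 1 for the
  factor \<open>a\<close>, and 6 for the constant \<open>64 \<le> Z ^ 6\<close>.\<close>

lemma heavy_numeric:
  fixes Z a :: nat
  assumes "a \<le> Z" "2 \<le> a"
  shows "4 * Z ^ 54 + 2 * ((a * (4 * Z ^ 54) + 1) * Z ^ 54) + 2 * ((a * (4 * Z ^ 54) + 1) * Z ^ 54) \<le> Z ^ 115"
proof -
  define M where "M = Z ^ 54"
  have Z: "2 \<le> Z" "1 \<le> Z" using assms by auto
  then have M: "1 \<le> M" unfolding M_def by simp
  have "1 \<le> Z * (4 * M)" using Z M by (simp add: Suc_le_eq)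
  then have "a * (4 * M) + 1 \<le> Z * (4 * M) + Z * (4 * M)" using assms by (intro add_mono mult_right_mono) auto
  then have "(a * (4 * M) + 1) * M \<le> (Z * (4 * M) + Z * (4 * M)) * M" by (rule mult_right_mono) simp
  also have "\<dots> = 8 * (Z * M * M)" by (simp add: algebra_simps)
  finally have 1: "(a * (4 * M) + 1) * M \<le> 8 * (Z * M * M)" .
  have "1 * M \<le> (Z * M) * M" using Z M by (intro mult_right_mono) (auto simp: Suc_le_eq)
  then have 2: "M \<le> Z * M * M" by simp
  have "4 * M + 2 * ((a * (4 * M) + 1) * M) + 2 * ((a * (4 * M) + 1) * M) \<le> 64 * (Z * M * M)"
    using 1 2 by linarith
  also have "\<dots> \<le> Z ^ 6 * (Z * M * M)" using power_mono[OF Z(1), of 6] by (intro mult_right_mono) auto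
  also have "Z ^ 6 * (Z * M * M) = Z ^ (6 + (1 + 54 + 54))" unfolding M_def by (simp only: power_add power_one_right)
  also have "6 + (1 + 54 + 54) = (115::nat)" by simp
  finally show ?thesis unfolding M_def .
qed

context bridge_free
begin

lemma heavy_label_split:
  assumes finK: "finite K"
    and ok: "\<And>t. t \<in> K \<Longrightarrow> tripod_ok w t"
    and m: "\<And>t. t \<in> K \<Longrightarrow> lam (tu t) = m" "\<And>t. t \<in> K \<Longrightarrow> lam (tu' t) = m'"
    and inj: "inj_on tu K" "inj_on tu' K"
    and r: "\<And>t. t \<in> K \<Longrightarrow> r \<in> tlab t"
    and data: "\<And>t. t \<in> K \<Longrightarrow> crosses r m m' w b (E t) t"
    and E: "\<And>t t'. t \<in> K \<Longrightarrow> t' \<in> K \<Longrightarrow> t \<noteq> t' \<Longrightarrow> E t \<inter> E t' = {}" "\<And>t. t \<in> K \<Longrightarrow> E t \<subseteq> tcore t"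
  shows "card K \<le> 2 ^ (54 * (w + 1))"
proof (cases "K = {}")
  case True
  then show ?thesis by simp
next
  case False
  then obtain t where t: "t \<in> K" by auto
  then have rm: "r < m" "r < m'" using tripod_lab(5)[OF ok[OF t]] r[OF t] m[OF t] by auto
  show ?thesis
  proof (rule crossing_tripods[OF finK ok m inj rm, where b = b and E = E])
    show "finite (E t)" if "t \<in> K" for t using E(2)[OF that] tripod_lab(3)[OF ok[OF that]] finite_subset by blast
    show "card (E t) \<le> 6 * (w + 1)" if "t \<in> K" for t
      using card_mono[OF tripod_lab(3)[OF ok[OF that]] E(2)[OF that]] tripod_lab(4)[OF ok[OF that]] by simp
    show "\<forall>t\<in>K. crosses r m m' w b (E t) t"
      by (rule ballI) (rule data)
  qed (fact E(1) | assumption)+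
qed

lemma heavy_label_core:
  assumes finK: "finite K"
    and ok: "\<And>t. t \<in> K \<Longrightarrow> tripod_ok w t"
    and m: "\<And>t. t \<in> K \<Longrightarrow> lam (tu t) = m" "\<And>t. t \<in> K \<Longrightarrow> lam (tu' t) = m'"
    and inj: "inj_on tu K" "inj_on tu' K"
    and r: "\<And>t. t \<in> K \<Longrightarrow> r \<in> tcore t"
  shows "card K \<le> 4 * 2 ^ (54 * (w + 1))"
proof -
  have sub: "card J \<le> 2 ^ (54 * (w + 1))"
    if J: "J \<subseteq> K" and data: "\<And>t. t \<in> J \<Longrightarrow> crosses r m m' w b {} t"
    for J b
  proof (rule heavy_label_split[where E = "\<lambda>_. {}" and b = b])
    show "finite J" using J finK finite_subset by blast
    show "inj_on tu J" "inj_on tu' J" using inj J inj_on_subset by blast+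
    show "\<And>t. t \<in> J \<Longrightarrow> r \<in> tlab t" using J r by (auto simp: tlab_def)
    show "crosses r m m' w b {} t" if "t \<in> J" for t
      by (rule data[OF that])
  qed (use J ok m in auto)
  let ?A = "{t \<in> K. r \<in> tC t}" and ?B = "{t \<in> K. r \<in> tCm t}" and ?C = "{t \<in> K. r = tf t}" and ?D = "{t \<in> K. r = tj t}"
  have 1: "card ?A \<le> 2 ^ (54 * (w + 1))" by (rule sub[of _ True]) (auto intro!: crossdata_C[OF ok m])
  have 2: "card ?B \<le> 2 ^ (54 * (w + 1))" by (rule sub[of _ True]) (auto intro!: crossdata_Cm[OF ok m])
  have 3: "card ?C \<le> 2 ^ (54 * (w + 1))" by (rule sub[of _ True]) (auto intro!: crossdata_f[OF ok m])
  have 4: "card ?D \<le> 2 ^ (54 * (w + 1))" by (rule sub[of _ False]) (auto intro!: crossdata_j[OF ok m])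
  have "K = ?A \<union> ?B \<union> ?C \<union> ?D" using r by (auto simp: tcore_def)
  then have "card K = card (?A \<union> ?B \<union> ?C \<union> ?D)" by simp
  also have "\<dots> \<le> 2 ^ (54 * (w + 1)) + 2 ^ (54 * (w + 1)) + 2 ^ (54 * (w + 1)) + 2 ^ (54 * (w + 1))"
    by (intro card_Un_bound 1 2 3 4)
  also have "\<dots> = 4 * 2 ^ (54 * (w + 1))" by algebra
  finally show ?thesis .
qed

text \<open>A label on a branch: the walks to and from the opposite foot both use the core. Since core labels
  are already known not to be heavy, one may pass to tripods with disjoint cores.\<close>

lemma heavy_label_branch:
  assumes finK: "finite K"
    and ok: "\<And>t. t \<in> K \<Longrightarrow> tripod_ok w t"
    and m: "\<And>t. t \<in> K \<Longrightarrow> lam (tu t) = m" "\<And>t. t \<in> K \<Longrightarrow> lam (tu' t) = m'"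
    and inj: "inj_on tu K" "inj_on tu' K"
    and r: "\<And>t. t \<in> K \<Longrightarrow> r \<in> tlab t"
    and data: "\<And>t. t \<in> K \<Longrightarrow> crosses r m m' w True (tcore t) t"
  shows "card K \<le> ((2 * w + 2) * (4 * 2 ^ (54 * (w + 1))) + 1) * 2 ^ (54 * (w + 1))"
proof -
  define N where "N = (4::nat) * 2 ^ (54 * (w + 1))"
  have deg: "card {b \<in> K. tcore a \<inter> tcore b \<noteq> {}} \<le> (2 * w + 2) * N" if a: "a \<in> K" for a
  proof -
    have "{b \<in> K. tcore a \<inter> tcore b \<noteq> {}} \<subseteq> (\<Union>l\<in>tcore a. {b \<in> K. l \<in> tcore b})" by auto
    then have "card {b \<in> K. tcore a \<inter> tcore b \<noteq> {}} \<le> card (\<Union>l\<in>tcore a. {b \<in> K. l \<in> tcore b})"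
      using finK tripod_lab(3)[OF ok[OF a]] by (intro card_mono) auto
    also have "\<dots> \<le> (\<Sum>l\<in>tcore a. card {b \<in> K. l \<in> tcore b})"
      by (rule card_UN_le) (rule tripod_lab(3)[OF ok[OF a]])
    also have "\<dots> \<le> (\<Sum>l\<in>tcore a. N)"
    proof (rule sum_mono)
      fix l assume "l \<in> tcore a"
      show "card {b \<in> K. l \<in> tcore b} \<le> N" unfolding N_def
        by (rule heavy_label_core[where r = l and m = m and m' = m'])
          (use finK ok m inj in \<open>auto intro: inj_on_subset\<close>)
    qed
    also have "\<dots> \<le> (2 * w + 2) * N" using mult_right_mono[OF tripod_lab(4)[OF ok[OF a]], of N] by simp
    finally show ?thesis .
  qed
  obtain I where I: "I \<subseteq> K" "card K \<le> ((2 * w + 2) * N + 1) * card I"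
    "\<And>a b. a \<in> I \<Longrightarrow> b \<in> I \<Longrightarrow> a \<noteq> b \<Longrightarrow> \<not> tcore a \<inter> tcore b \<noteq> {}"
    by (rule independent_subset[of K "\<lambda>a b. tcore a \<inter> tcore b \<noteq> {}"]) (use finK deg in \<open>auto simp: Int_commute\<close>)
  have "card I \<le> 2 ^ (54 * (w + 1))"
  proof (rule heavy_label_split[where E = tcore and b = True and r = r])
    show "finite I" using I finK finite_subset by blast
    show "inj_on tu I" "inj_on tu' I" using inj I inj_on_subset by blast+
    show "crosses r m m' w True (tcore t) t" if "t \<in> I" for t
      using data[of t] I(1) that by blast
  qed (use I ok m r in auto)
  then have "((2 * w + 2) * N + 1) * card I \<le> ((2 * w + 2) * N + 1) * 2 ^ (54 * (w + 1))"
    by (rule mult_le_mono2)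
  with I(2) have "card K \<le> ((2 * w + 2) * N + 1) * 2 ^ (54 * (w + 1))" by (rule order_trans)
  then show ?thesis unfolding N_def .
qed

lemma heavy_label_half:
  assumes finK: "finite K"
    and ok: "\<And>t. t \<in> K \<Longrightarrow> tripod_ok w t"
    and m: "\<And>t. t \<in> K \<Longrightarrow> lam (tu t) = m" "\<And>t. t \<in> K \<Longrightarrow> lam (tu' t) = m'"
    and inj: "inj_on tu K" "inj_on tu' K"
    and r: "\<And>t. t \<in> K \<Longrightarrow> r \<in> tD t \<union> tDm t"
  shows "card K \<le> 2 * (((2 * w + 2) * (4 * 2 ^ (54 * (w + 1))) + 1) * 2 ^ (54 * (w + 1)))"
proof -
  define N where "N = (((2 * w + 2) * (4 * 2 ^ (54 * (w + 1))) + 1) * 2 ^ (54 * (w + 1)) :: nat)"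
  let ?A = "{t \<in> K. r \<in> tD t}" and ?B = "{t \<in> K. r \<in> tDm t}"
  have 1: "card ?A \<le> N" unfolding N_def
  proof (rule heavy_label_branch[where r = r and m = m and m' = m'])
    show "crosses r m m' w True (tcore t) t" if "t \<in> ?A" for t
      by (rule crossdata_D[OF ok m]) (use that in auto)
  qed (use finK ok m inj in \<open>auto intro: inj_on_subset simp: tlab_def\<close>)
  have 2: "card ?B \<le> N" unfolding N_def
  proof (rule heavy_label_branch[where r = r and m = m and m' = m'])
    show "crosses r m m' w True (tcore t) t" if "t \<in> ?B" for t
      by (rule crossdata_Dm[OF ok m]) (use that in auto)
  qed (use finK ok m inj in \<open>auto intro: inj_on_subset simp: tlab_def\<close>)
  have "K = ?A \<union> ?B" using r by auto
  then have "card K = card (?A \<union> ?B)" by simp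
  also have "\<dots> \<le> N + N" by (intro card_Un_bound 1 2)
  also have "N + N = 2 * N" by simp
  finally show ?thesis unfolding N_def .
qed

text \<open>This limits how many pairs of feet of one class can conflict with a given tripod over a
  label; most legs of the next round are therefore label-disjoint.\<close>

lemma heavy_label:
  assumes finK: "finite K"
    and ok: "\<And>t. t \<in> K \<Longrightarrow> tripod_ok w t"
    and m: "\<And>t. t \<in> K \<Longrightarrow> lam (tu t) = m" "\<And>t. t \<in> K \<Longrightarrow> lam (tu' t) = m'"
    and inj: "inj_on tu K" "inj_on tu' K"
    and r: "\<And>t. t \<in> K \<Longrightarrow> r \<in> tlab t"
  shows "card K \<le> (2 ^ (w + 1)) ^ 115"
proof -
  define Z where "Z = (2::nat) ^ (w + 1)"
  define N where "N = (((2 * w + 2) * (4 * 2 ^ (54 * (w + 1))) + 1) * 2 ^ (54 * (w + 1)) :: nat)"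
  let ?A = "{t \<in> K. r \<in> tcore t}" and ?B = "{t \<in> K. r \<in> tD t \<union> tDm t}" and ?C = "{t \<in> K. r \<in> tD' t \<union> tDm' t}"
  have 1: "card ?A \<le> 4 * 2 ^ (54 * (w + 1))"
    by (rule heavy_label_core[where r = r and m = m and m' = m']) (use finK ok m inj in \<open>auto intro: inj_on_subset\<close>)
  have 2: "card ?B \<le> 2 * N" unfolding N_def
    by (rule heavy_label_half[where r = r and m = m and m' = m']) (use finK ok m inj in \<open>auto intro: inj_on_subset\<close>)
  \<comment> \<open>The branches at the second foot become those at the first foot after
    \<open>tswap\<close>, with \<open>m\<close> and \<open>m'\<close> exchanged.\<close>
  have sw: "tu (tswap t) = tu' t" "tu' (tswap t) = tu t" "tD (tswap t) = tD' t" "tDm (tswap t) = tDm' t" for t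
    by (simp_all add: tswap_def)
  have injs: "inj_on tswap ?C" by (rule inj_on_inverseI[of _ tswap]) (rule tswap_tswap)
  have "card (tswap ` ?C) \<le> 2 * N" unfolding N_def
  proof (rule heavy_label_half[where r = r and m = m' and m' = m])
    show "inj_on tu (tswap ` ?C)" "inj_on tu' (tswap ` ?C)"
      using inj by (auto intro!: inj_on_imageI simp: comp_def sw intro: inj_on_subset)
    show "tripod_ok w t" if "t \<in> tswap ` ?C" for t
    proof -
      obtain s where "t = tswap s" "s \<in> K" using \<open>t \<in> tswap ` ?C\<close> by blast
      then show ?thesis using tripod_ok_swap[OF ok] by blast
    qed
    show "lam (tu t) = m'" "lam (tu' t) = m" "r \<in> tD t \<union> tDm t" if "t \<in> tswap ` ?C" for t
      using that m by (auto simp: sw)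
  qed (use finK in simp)
  then have 3: "card ?C \<le> 2 * N" unfolding card_image[OF injs] .
  have "K = ?A \<union> ?B \<union> ?C" using r by (auto simp: tlab_def)
  then have "card K = card (?A \<union> ?B \<union> ?C)" by simp
  also have "\<dots> \<le> 4 * 2 ^ (54 * (w + 1)) + 2 * N + 2 * N" by (intro card_Un_bound 1 2 3)
  also have "\<dots> \<le> Z ^ 115"
  proof -
    have p: "2 ^ (54 * (w + 1)) = Z ^ 54" unfolding Z_def by (simp only: power_mult[symmetric] mult.commute)
    have "w + 1 \<le> 2 ^ w" by (induction w) auto
    then have "2 * w + 2 \<le> Z" unfolding Z_def by simp
    then show ?thesis unfolding N_def p by (rule heavy_numeric) simp
  qed
  finally show ?thesis unfolding Z_def .
qed

end

subsection \<open>Counting triples\<close>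

lemma card_le_fibers:
  assumes "finite W" "\<And>y. y \<in> f ` W \<Longrightarrow> card {x \<in> W. f x = y} \<le> F"
  shows "card W \<le> card (f ` W) * F"
proof -
  have "card W = card (\<Union>y\<in>f ` W. {x \<in> W. f x = y})" by (rule arg_cong[of _ _ card]) auto
  also have "\<dots> \<le> (\<Sum>y\<in>f ` W. card {x \<in> W. f x = y})" using assms(1) by (intro card_UN_le) auto
  also have "\<dots> \<le> (\<Sum>y\<in>f ` W. F)" by (rule sum_mono) (rule assms(2))
  finally show ?thesis by simp
qed

text \<open>For a fixed \<open>a\<close>, split the good elements of time at most
  \<open>tm a\<close> into those after \<open>a\<close> and those before it: two elements of one
  side that are good to each other form a triple with \<open>a\<close>. With
  \<open>m = card L\<close>, an \<open>a\<close> has on average about \<open>m / 2\<close> such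
  elements, which gives at least \<open>m^3 / 10\<close> triples; pairs with fewer than
  \<open>m / 20\<close> completions account for at most \<open>m^3 / 20\<close> of them.\<close>

lemma many_triples:
  fixes L :: "'a set" and tm :: "'a \<Rightarrow> nat" and bf gd :: "'a \<Rightarrow> 'a \<Rightarrow> bool"
  assumes fin: "finite L"
    and deg: "\<And>a. a \<in> L \<Longrightarrow> 100 * card {b \<in> L. \<not> gd a b} \<le> card L"
    and tot: "\<And>a b. a \<in> L \<Longrightarrow> b \<in> L \<Longrightarrow> gd a b \<Longrightarrow> bf a b \<or> bf b a"
  defines "G \<equiv> \<lambda>a b c. gd a b \<and> gd a c \<and> gd b c \<and> tm b \<le> tm a \<and> tm c \<le> tm a \<and> (bf a b \<and> bf a c \<or> bf b a \<and> bf c a)"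
  shows "card L ^ 2 \<le> 20 * card {(b, c) \<in> L \<times> L. card L \<le> 20 * card {a \<in> L. G a b c}}"
proof (cases "L = {}")
  case True
  then show ?thesis by simp
next
  case False
  define m where "m = real (card L)"
  have m: "m > 0" unfolding m_def using False fin by (simp add: card_gt_0_iff)
  define e where "e a = real (card {b \<in> L. tm b \<le> tm a})" for a
  define T where "T a = {(b, c) \<in> L \<times> L. G a b c}" for a
  define R where "R = {(b, c) \<in> L \<times> L. card L \<le> 20 * card {a \<in> L. G a b c}}"
  define NG where "NG = {(b, c) \<in> L \<times> L. \<not> gd b c}"
  have finT: "finite (T a)" for a unfolding T_def by (rule finite_subset[of _ "L \<times> L"]) (use fin in auto)
  have NG: "real (card NG) \<le> m * m / 100"
  proof -
    have "NG = Sigma L (\<lambda>b. {c \<in> L. \<not> gd b c})" unfolding NG_def by auto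
    then have "card NG = (\<Sum>b\<in>L. card {c \<in> L. \<not> gd b c})" using fin by simp
    then have "real (card NG) = (\<Sum>b\<in>L. real (card {c \<in> L. \<not> gd b c}))" by simp
    also have "\<dots> \<le> (\<Sum>b\<in>L. m / 100)"
    proof (rule sum_mono)
      fix b assume "b \<in> L"
      then have "real (100 * card {c \<in> L. \<not> gd b c}) \<le> real (card L)" using deg by (subst of_nat_le_iff)
      then show "real (card {c \<in> L. \<not> gd b c}) \<le> m / 100" unfolding m_def by simp
    qed
    finally show ?thesis by (simp add: m_def)
  qed
  have se: "(\<Sum>a\<in>L. e a) \<ge> m * m / 2"
  proof -
    define D where "D = Sigma L (\<lambda>a. {b \<in> L. tm b \<le> tm a})"
    have "L \<times> L = D \<union> prod.swap ` D"
    proof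
      show "L \<times> L \<subseteq> D \<union> prod.swap ` D"
      proof
        fix x assume "x \<in> L \<times> L"
        then obtain a b where x: "x = (a, b)" "a \<in> L" "b \<in> L" by auto
        show "x \<in> D \<union> prod.swap ` D"
        proof (cases "tm b \<le> tm a")
          case True then show ?thesis using x by (auto simp: D_def)
        next
          case False
          then have "(b, a) \<in> D" using x by (auto simp: D_def)
          then have "prod.swap (b, a) \<in> prod.swap ` D" by (rule imageI)
          then show ?thesis using x by simp
        qed
      qed
    qed (auto simp: D_def)
    then have "card (L \<times> L) \<le> card D + card (prod.swap ` D)" by (metis card_Un_le)
    also have "card (prod.swap ` D) = card D" by (intro card_image) auto
    finally have "real (card L * card L) \<le> real (2 * card D)" unfolding card_cartesian_product by (subst of_nat_le_iff) simp
    moreover have "card D = (\<Sum>a\<in>L. card {b \<in> L. tm b \<le> tm a})" unfolding D_def using fin by simp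
    ultimately show ?thesis unfolding e_def m_def by simp
  qed
  have Ta: "49 / 100 * m * e a - 14 / 100 * (m * m) \<le> real (card (T a))" if a: "a \<in> L" for a
  proof -
    define S where "S = {b \<in> L. gd a b \<and> tm b \<le> tm a}"
    define B where "B = {b \<in> S. bf a b}"
    define C where "C = S - B"
    have fS: "finite S" "finite B" "finite C" using fin by (auto simp: S_def B_def C_def)
    have "{b \<in> L. tm b \<le> tm a} \<subseteq> S \<union> {b \<in> L. \<not> gd a b}" unfolding S_def by auto
    then have "card {b \<in> L. tm b \<le> tm a} \<le> card (S \<union> {b \<in> L. \<not> gd a b})" using fin fS by (intro card_mono) auto
    also have "\<dots> \<le> card S + card {b \<in> L. \<not> gd a b}" by (rule card_Un_le)
    finally have 1: "e a \<le> real (card S) + real (card {b \<in> L. \<not> gd a b})" unfolding e_def by linarith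
    have "real (100 * card {b \<in> L. \<not> gd a b}) \<le> real (card L)" using deg[OF a] by (subst of_nat_le_iff)
    then have s: "real (card S) \<ge> e a - m / 100" using 1 unfolding m_def by simp
    have bc: "real (card S) = real (card B) + real (card C)"
    proof -
      have "S = B \<union> C" "B \<inter> C = {}" unfolding B_def C_def by auto
      then show ?thesis using fS card_Un_disjoint[of B C] by simp
    qed
    have "(B \<times> B \<union> C \<times> C) - NG \<subseteq> T a"
    proof
      fix z assume z: "z \<in> (B \<times> B \<union> C \<times> C) - NG"
      obtain b c where bc: "z = (b, c)" by (cases z)
      have bS: "b \<in> S" "c \<in> S" using z bc unfolding B_def C_def by auto
      then have L: "b \<in> L" "c \<in> L" "gd a b" "gd a c" "tm b \<le> tm a" "tm c \<le> tm a" unfolding S_def by auto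
      then have "gd b c" using z bc unfolding NG_def by auto
      moreover have "bf a b \<and> bf a c \<or> bf b a \<and> bf c a"
      proof (cases "b \<in> B")
        case True
        then have "c \<in> B" using z bc unfolding C_def by auto
        then show ?thesis using True unfolding B_def by simp
      next
        case False
        then have "c \<notin> B" using z bc unfolding C_def by auto
        then have "\<not> bf a b" "\<not> bf a c" using False bS unfolding B_def by auto
        then show ?thesis using tot[OF a L(1) L(3)] tot[OF a L(2) L(4)] by simp
      qed
      ultimately show "z \<in> T a" using L bc unfolding T_def G_def by simp
    qed
    moreover note finT
    ultimately have "card ((B \<times> B \<union> C \<times> C) - NG) \<le> card (T a)" by (intro card_mono)
    moreover have "card (B \<times> B \<union> C \<times> C) - card NG \<le> card ((B \<times> B \<union> C \<times> C) - NG)"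
      by (rule diff_card_le_card_Diff) (rule finite_subset[of _ "L \<times> L"], use fin in \<open>auto simp: NG_def\<close>)
    moreover have "card (B \<times> B \<union> C \<times> C) = card B * card B + card C * card C"
      using fS by (subst card_Un_disjoint) (auto simp: C_def)
    ultimately have "card B * card B + card C * card C \<le> card (T a) + card NG" by linarith
    then have "real (card B * card B + card C * card C) \<le> real (card (T a) + card NG)" by (subst of_nat_le_iff)
    then have t: "real (card (T a)) \<ge> real (card B) * real (card B) + real (card C) * real (card C) - m * m / 100"
      using NG by simp
    define x where "x = real (card B)"
    define y where "y = real (card C)"
    \<comment> \<open>Besides \<open>x^2 + y^2 \<ge> (x + y)^2 / 2\<close>, the square of
      \<open>x + y\<close> is bounded from below by its tangent at \<open>49/100 * m\<close>, close
      to the average. The bound becomes linear in \<open>e a\<close>, so the sum of the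
      \<open>e a\<close> suffices to add it up over all \<open>a\<close>.\<close>
    have "0 \<le> (x - y) * (x - y)" "0 \<le> (x + y - 49 / 100 * m) * (x + y - 49 / 100 * m)" by simp_all
    moreover have "(x - y) * (x - y) = x * x + y * y - 2 * (x * y)" by (simp add: algebra_simps)
    moreover have "(x + y - 49 / 100 * m) * (x + y - 49 / 100 * m)
      = x * x + y * y + 2 * (x * y) - 98 / 100 * (m * (x + y)) + 2401 / 10000 * (m * m)" by (simp add: algebra_simps)
    ultimately have "x * x + y * y \<ge> 49 / 100 * (m * (x + y)) - 2401 / 20000 * (m * m)" by linarith
    moreover have "m * (x + y) \<ge> m * (e a - m / 100)"
      using s bc m unfolding x_def y_def by (intro mult_left_mono) auto
    moreover have "m * (e a - m / 100) = m * e a - m * m / 100" by (simp add: algebra_simps)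
    moreover have "49 / 100 * m * e a = 49 / 100 * (m * e a)" by simp
    moreover have "0 \<le> m * m" by simp
    ultimately show ?thesis using t unfolding x_def y_def by linarith
  qed
  have "(\<Sum>a\<in>L. real (card (T a))) \<ge> (\<Sum>a\<in>L. 49 / 100 * m * e a - 14 / 100 * (m * m))"
    by (rule sum_mono) (rule Ta)
  moreover have "(\<Sum>a\<in>L. 49 / 100 * m * e a - 14 / 100 * (m * m)) = 49 / 100 * m * (\<Sum>a\<in>L. e a) - m * (14 / 100 * (m * m))"
    unfolding sum_subtractf sum_distrib_left[symmetric] by (simp add: m_def)
  moreover have "49 / 100 * m * (\<Sum>a\<in>L. e a) \<ge> 49 / 100 * m * (m * m / 2)" using se m by (intro mult_left_mono) auto
  moreover have "49 / 100 * m * (m * m / 2) = 49 / 200 * (m * m * m)" "m * (14 / 100 * (m * m)) = 14 / 100 * (m * m * m)" by simp_all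
  moreover have "0 \<le> m * m * m" using m by simp
  ultimately have low: "(\<Sum>a\<in>L. real (card (T a))) \<ge> 1 / 10 * (m * m * m)" by linarith
  have fR: "finite R" unfolding R_def by (rule finite_subset[of _ "L \<times> L"]) (use fin in auto)
  have "(\<Sum>a\<in>L. real (card (T a))) = real (card (Sigma L T))"
    using fin finT by (subst card_SigmaI) auto
  also have "card (Sigma L T) = card (Sigma (L \<times> L) (\<lambda>(b, c). {a \<in> L. G a b c}))"
    by (rule bij_betw_same_card[of "\<lambda>(a, (b, c)). ((b, c), a)"], rule bij_betw_byWitness[where f' = "\<lambda>((b, c), a). (a, (b, c))"])
      (auto simp: T_def)
  also have "real \<dots> = (\<Sum>x\<in>L \<times> L. real (card (case x of (b, c) \<Rightarrow> {a \<in> L. G a b c})))"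
    using fin by (subst card_SigmaI) auto
  \<comment> \<open>A pair in \<open>R\<close> has at most \<open>m\<close> completions, any other
    pair fewer than \<open>m / 20\<close>.\<close>
  also have "\<dots> \<le> (\<Sum>x\<in>L \<times> L. (if x \<in> R then m else 0) + m / 20)"
  proof (rule sum_mono)
    fix x assume x: "x \<in> L \<times> L"
    obtain b c where bc: "x = (b, c)" by (cases x)
    show "real (card (case x of (b, c) \<Rightarrow> {a \<in> L. G a b c})) \<le> (if x \<in> R then m else 0) + m / 20"
    proof (cases "x \<in> R")
      case True
      have "card {a \<in> L. G a b c} \<le> card L" using fin by (intro card_mono) auto
      then show ?thesis using True m bc unfolding m_def by simp
    next
      case False
      then have "20 * card {a \<in> L. G a b c} < card L" using x bc by (auto simp: R_def)
      then show ?thesis using False bc unfolding m_def by simp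
    qed
  qed
  also have "\<dots> = real (card R) * m + m * m * (m / 20)"
  proof -
    have "R \<subseteq> L \<times> L" unfolding R_def by auto
    then have "(\<Sum>x\<in>L \<times> L. (if x \<in> R then m else 0)) = real (card R) * m"
      using fin by (simp add: sum.If_cases Int_absorb1)
    then show ?thesis unfolding sum.distrib by (simp add: m_def card_cartesian_product)
  qed
  finally have "1 / 10 * (m * m * m) \<le> real (card R) * m + m * m * (m / 20)" using low by linarith
  moreover have "m * m * (m / 20) = 1 / 20 * (m * m * m)" by simp
  ultimately have "1 / 20 * (m * m * m) \<le> real (card R) * m" by linarith
  then have "(1 / 20 * (m * m)) * m \<le> real (card R) * m" by simp
  then have "1 / 20 * (m * m) \<le> real (card R)" using m by (rule mult_right_le_imp_le)
  then have "m * m \<le> 20 * real (card R)" by linarith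
  then have "real (card L ^ 2) \<le> real (20 * card R)" unfolding m_def by (simp add: power2_eq_square)
  then show ?thesis unfolding R_def by (subst (asm) of_nat_le_iff)
qed

subsection \<open>Legs\<close>

record leg =
  ltip :: nat
  lfoot :: nat
  lfoot' :: nat
  ldown :: "nat set"
  lup :: "nat set"
  ldown' :: "nat set"
  lup' :: "nat set"

definition llab :: "leg \<Rightarrow> nat set" where
  "llab a = ldown a \<union> lup a \<union> ldown' a \<union> lup' a"

definition lgood :: "leg \<Rightarrow> leg \<Rightarrow> bool" where
  "lgood a b \<longleftrightarrow> lfoot a \<noteq> lfoot b \<and> lfoot' a \<noteq> lfoot' b \<and> llab a \<inter> llab b = {}"

definition lswap :: "leg \<Rightarrow> leg" where
  "lswap a = a\<lparr>lfoot := lfoot' a, lfoot' := lfoot a, ldown := ldown' a, ldown' := ldown a, lup := lup' a, lup' := lup a\<rparr>"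

lemma lgood_sym: "lgood a b \<Longrightarrow> lgood b a"
  unfolding lgood_def by (metis Int_commute)

lemma lswap_simps:
  "ltip (lswap a) = ltip a" "lfoot (lswap a) = lfoot' a" "lfoot' (lswap a) = lfoot a" "ldown (lswap a) = ldown' a"
  "ldown' (lswap a) = ldown a" "lup (lswap a) = lup' a" "lup' (lswap a) = lup a" "llab (lswap a) = llab a"
  by (auto simp: lswap_def llab_def)

lemma lgood_lswap: "lgood (lswap a) (lswap b) \<longleftrightarrow> lgood a b"
  by (auto simp: lgood_def lswap_simps)

context bridge_free
begin

text \<open>The two descents may share labels, and so may the two ascents: legs made from tripods
  share the core. Only descents and ascents have to be disjoint from each other.\<close>

definition leg_ok :: "nat \<Rightarrow> nat \<Rightarrow> nat \<Rightarrow> leg \<Rightarrow> bool" where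
  "leg_ok w m m' a \<longleftrightarrow> lfoot a \<in> on m \<and> lfoot' a \<in> on m'
   \<and> walk pr (ldown a) (ltip a) (lfoot a) \<and> walk pr (lup a) (lfoot a) (ltip a)
   \<and> walk pr (ldown' a) (ltip a) (lfoot' a) \<and> walk pr (lup' a) (lfoot' a) (ltip a)
   \<and> (ldown a \<union> ldown' a) \<inter> (lup a \<union> lup' a) = {}
   \<and> (\<forall>l\<in>llab a. l < m \<and> l < m') \<and> m < lam (ltip a) \<and> m' < lam (ltip a) \<and> ltip a \<in> on (lam (ltip a))
   \<and> card (ldown a) \<le> w \<and> card (lup a) \<le> w \<and> card (ldown' a) \<le> w \<and> card (lup' a) \<le> w"

lemma leg_ok_swap: "leg_ok w m m' a \<Longrightarrow> leg_ok w m' m (lswap a)"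
  unfolding leg_ok_def lswap_simps by (simp add: Un_commute)

lemma leg_ok_D:
  assumes "leg_ok w m m' a"
  shows "lfoot a \<in> on m" "lfoot' a \<in> on m'" "walk pr (ldown a) (ltip a) (lfoot a)" "walk pr (lup a) (lfoot a) (ltip a)"
    "walk pr (ldown' a) (ltip a) (lfoot' a)" "walk pr (lup' a) (lfoot' a) (ltip a)"
    "(ldown a \<union> ldown' a) \<inter> (lup a \<union> lup' a) = {}" "\<forall>l\<in>llab a. l < m \<and> l < m'"
    "m < lam (ltip a)" "m' < lam (ltip a)" "ltip a \<in> on (lam (ltip a))"
    "card (ldown a) \<le> w" "card (lup a) \<le> w" "card (ldown' a) \<le> w" "card (lup' a) \<le> w"
  using assms unfolding leg_ok_def by - (elim conjE, assumption)+

lemma leg_ok_not_in: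
  assumes "leg_ok w m m' a"
  shows "m \<notin> llab a" "m' \<notin> llab a"
  using leg_ok_D(8)[OF assms] by auto

section \<open>Two label-disjoint legs of the same pair of paths\<close>

context
  fixes w m m' a b
  assumes ne: "m \<noteq> m'" and a: "leg_ok w m m' a" and b: "leg_ok w m m' b" and g: "lgood a b"
begin

text \<open>A leg connects its two feet in both directions through its tip, so
  \<open>reversed_crossings\<close> applies.\<close>

lemma lgood_reversed:
  assumes "pr m (lfoot a) (lfoot b)"
  shows "pr m' (lfoot' b) (lfoot' a)"
proof -
  note A = leg_ok_D[OF a] and B = leg_ok_D[OF b]
  have dis: "llab a \<inter> llab b = {}" using g unfolding lgood_def by simp
  have 1: "walk pr (lup a \<union> ldown' a) (lfoot a) (lfoot' a)" by (rule walk_trans[OF A(5) A(4)]) (use A(7) in blast)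
  have 2: "walk pr (lup' a \<union> ldown a) (lfoot' a) (lfoot a)" by (rule walk_trans[OF A(3) A(6)]) (use A(7) in blast)
  have 3: "walk pr (lup b \<union> ldown' b) (lfoot b) (lfoot' b)" by (rule walk_trans[OF B(5) B(4)]) (use B(7) in blast)
  have 4: "walk pr (lup' b \<union> ldown b) (lfoot' b) (lfoot b)" by (rule walk_trans[OF B(3) B(6)]) (use B(7) in blast)
  have "\<not> pr m' (lfoot' a) (lfoot' b)"
  proof (rule reversed_crossings[OF ne assms 1 2 3 4])
    show "(lup a \<union> ldown' a) \<inter> (lup' b \<union> ldown b) = {}" "(lup' a \<union> ldown a) \<inter> (lup b \<union> ldown' b) = {}"
      using dis unfolding llab_def by blast+
    show "l < m \<and> l < m'" if "l \<in> (lup a \<union> ldown' a) \<union> (lup' a \<union> ldown a) \<union> (lup b \<union> ldown' b) \<union> (lup' b \<union> ldown b)" for l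
      using that A(8) B(8) unfolding llab_def by blast
  qed
  moreover have "lfoot' a \<noteq> lfoot' b" using g unfolding lgood_def by simp
  ultimately show ?thesis using pr_total[OF A(2) B(2)] by blast
qed

text \<open>The way forth descends to \<open>m\<close>, follows it and climbs to the other tip;
  since the order on \<open>m'\<close> is opposite, the way back can use \<open>m'\<close>.\<close>

lemma lgood_link:
  assumes "pr m (lfoot a) (lfoot b)"
  shows "walk pr (ldown a \<union> {m} \<union> lup b) (ltip a) (ltip b)"
    "walk pr (ldown' b \<union> {m'} \<union> lup' a) (ltip b) (ltip a)"
proof -
  note A = leg_ok_D[OF a] and B = leg_ok_D[OF b]
  have dis: "llab a \<inter> llab b = {}" using g unfolding lgood_def by simp
  note n = leg_ok_not_in[OF a] leg_ok_not_in[OF b]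
  have 1: "walk pr (ldown a \<union> {m}) (ltip a) (lfoot b)"
    by (rule walk_trans[OF walk_arc[of pr, OF assms] A(3)]) (use n in \<open>auto simp: llab_def\<close>)
  show "walk pr (ldown a \<union> {m} \<union> lup b) (ltip a) (ltip b)"
    by (rule walk_trans[OF B(4) 1]) (use n dis in \<open>auto simp: llab_def\<close>)
  have 2: "walk pr (ldown' b \<union> {m'}) (ltip b) (lfoot' a)"
    by (rule walk_trans[OF walk_arc[of pr, OF lgood_reversed[OF assms]] B(5)]) (use n in \<open>auto simp: llab_def\<close>)
  show "walk pr (ldown' b \<union> {m'} \<union> lup' a) (ltip b) (ltip a)"
    by (rule walk_trans[OF A(6) 2]) (use n dis in \<open>auto simp: llab_def\<close>)
qed

text \<open>Equal tips would give a detour from \<open>lfoot a\<close> over the tip to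
  \<open>lfoot b\<close>, with river \<open>m\<close>. If the tips had a common last path, it would
  order them in one of the two ways and be the river over the corresponding link. Distinct last
  paths make the time comparisons strict and provide two different paths for the next round.\<close>

lemma lgood_tips_aux:
  assumes p: "pr m (lfoot a) (lfoot b)"
  shows "ltip a \<noteq> ltip b" "lam (ltip a) \<noteq> lam (ltip b)"
proof -
  note A = leg_ok_D[OF a] and B = leg_ok_D[OF b]
  have dis: "llab a \<inter> llab b = {}" using g unfolding lgood_def by simp
  show ne': "ltip a \<noteq> ltip b"
  proof
    assume eq: "ltip a = ltip b"
    have "walk pr (lup a \<union> ldown b) (lfoot a) (lfoot b)"
      by (rule walk_trans[OF B(3)[folded eq] A(4)]) (use dis in \<open>auto simp: llab_def\<close>)
    then show False by (rule no_bridge[THEN notE, OF _ _ p]) (use A(8) B(8) in \<open>auto simp: llab_def\<close>)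
  qed
  show "lam (ltip a) \<noteq> lam (ltip b)"
  proof
    assume eq: "lam (ltip a) = lam (ltip b)"
    have 1: "l < lam (ltip a)" if "l \<in> ldown a \<union> {m} \<union> lup b \<union> (ldown' b \<union> {m'} \<union> lup' a)" for l
    proof -
      have "l = m \<or> l = m' \<or> l < m" using that A(8) B(8) unfolding llab_def by blast
      then show ?thesis using A(9,10) by auto
    qed
    have "\<not> pr (lam (ltip a)) (ltip a) (ltip b)" "\<not> pr (lam (ltip a)) (ltip b) (ltip a)"
      using no_bridge[OF lgood_link(1)[OF p]] no_bridge[OF lgood_link(2)[OF p]] 1 by blast+
    then show False using pr_total[of "ltip a" "lam (ltip a)" "ltip b"] ne' A(11) B(11) eq by simp
  qed
qed

lemma lfoot_order: "pr m (lfoot a) (lfoot b) \<or> pr m (lfoot b) (lfoot a)"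
  using pr_total[OF leg_ok_D(1)[OF a] leg_ok_D(1)[OF b]] g unfolding lgood_def by blast

end

lemma lgood_tips:
  assumes "m \<noteq> m'" "leg_ok w m m' a" "leg_ok w m m' b" "lgood a b"
  shows "ltip a \<noteq> ltip b" "lam (ltip a) \<noteq> lam (ltip b)"
  using lfoot_order[OF assms] lgood_tips_aux[OF assms] lgood_tips_aux[OF assms(1,3,2) lgood_sym[OF assms(4)]] by metis+

definition lmutual :: "nat \<Rightarrow> nat \<Rightarrow> nat \<Rightarrow> leg \<Rightarrow> leg \<Rightarrow> nat set \<Rightarrow> nat set \<Rightarrow> bool" where
  "lmutual w m m' b c V V' \<longleftrightarrow> walk pr V (ltip b) (ltip c) \<and> walk pr V' (ltip c) (ltip b) \<and> V \<inter> V' = {}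
     \<and> card V \<le> 2 * w + 1 \<and> card V' \<le> 2 * w + 1 \<and> V \<union> V' \<subseteq> llab b \<union> llab c \<union> {m, m'}"

lemma lmutual_aux:
  assumes ne: "m \<noteq> m'" and b: "leg_ok w m m' b" and c: "leg_ok w m m' c" and g: "lgood b c"
    and p: "pr m (lfoot b) (lfoot c)"
  shows "lmutual w m m' b c (ldown b \<union> {m} \<union> lup c) (ldown' c \<union> {m'} \<union> lup' b)"
  unfolding lmutual_def
proof (intro conjI)
  note B = leg_ok_D[OF b] and C = leg_ok_D[OF c]
  note n = leg_ok_not_in[OF b] leg_ok_not_in[OF c]
  have dis: "llab b \<inter> llab c = {}" using g unfolding lgood_def by simp
  show "walk pr (ldown b \<union> {m} \<union> lup c) (ltip b) (ltip c)" "walk pr (ldown' c \<union> {m'} \<union> lup' b) (ltip c) (ltip b)"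
    by (rule lgood_link[OF ne b c g p])+
  have "ldown b \<inter> lup' b = {}" "lup c \<inter> ldown' c = {}" using B(7) C(7) by blast+
  then show "(ldown b \<union> {m} \<union> lup c) \<inter> (ldown' c \<union> {m'} \<union> lup' b) = {}"
    using dis n ne unfolding llab_def by blast
  show "card (ldown b \<union> {m} \<union> lup c) \<le> 2 * w + 1"
    using card_Un_bound[OF card_Un_bound[OF B(12), of "{m}" 1] C(13)] by simp
  show "card (ldown' c \<union> {m'} \<union> lup' b) \<le> 2 * w + 1"
    using card_Un_bound[OF card_Un_bound[OF C(14), of "{m'}" 1] B(15)] by simp
  show "ldown b \<union> {m} \<union> lup c \<union> (ldown' c \<union> {m'} \<union> lup' b) \<subseteq> llab b \<union> llab c \<union> {m, m'}"
    unfolding llab_def by blast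
qed

lemma lmutual_ex:
  assumes ne: "m \<noteq> m'" and b: "leg_ok w m m' b" and c: "leg_ok w m m' c" and g: "lgood b c"
  obtains V V' where "lmutual w m m' b c V V'"
proof (cases "pr m (lfoot b) (lfoot c)")
  case True
  then show ?thesis using lmutual_aux[OF assms] that by blast
next
  case False
  then have "pr m (lfoot c) (lfoot b)" using lfoot_order[OF assms] by blast
  then have "lmutual w m m' c b (ldown c \<union> {m} \<union> lup b) (ldown' b \<union> {m'} \<union> lup' c)"
    by (rule lmutual_aux[OF ne c b lgood_sym[OF g]])
  then have "lmutual w m m' b c (ldown' b \<union> {m'} \<union> lup' c) (ldown c \<union> {m} \<union> lup b)"
    unfolding lmutual_def by blast
  then show ?thesis by (rule that)
qed

text \<open>On \<open>m\<close> the leg \<open>a\<close> comes first, so the way down from its tip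
  forks there towards \<open>b\<close> and \<open>c\<close>. On \<open>m'\<close> the orders are
  reversed, so the ways from \<open>b\<close> and \<open>c\<close> join at the foot of
  \<open>a\<close>.\<close>

lemma legs_tripod_first:
  assumes ne: "m \<noteq> m'" and ok: "leg_ok w m m' a" "leg_ok w m m' b" "leg_ok w m m' c"
    and g: "lgood a b" "lgood a c" "lgood b c"
    and p: "pr m (lfoot a) (lfoot b)" "pr m (lfoot a) (lfoot c)"
    and time: "lam (ltip b) \<le> lam (ltip a)" "lam (ltip c) \<le> lam (ltip a)"
  shows "\<exists>t. tripod_ok w t \<and> tx t = ltip a \<and> tu t = ltip b \<and> tu' t = ltip c"
proof -
  note A = leg_ok_D[OF ok(1)] and B = leg_ok_D[OF ok(2)] and C = leg_ok_D[OF ok(3)]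
  note n = leg_ok_not_in[OF ok(1)] leg_ok_not_in[OF ok(2)] leg_ok_not_in[OF ok(3)]
  obtain V V' where V: "lmutual w m m' b c V V'" by (rule lmutual_ex[OF ne ok(2,3) g(3)])
  define t where "t = \<lparr>tx = ltip a, tu = ltip b, tu' = ltip c, tC = ldown a, tD = lup b, tD' = lup c,
     tCm = lup' a, tDm = ldown' b, tDm' = ldown' c, tV = V, tV' = V', tf = m, tj = m'\<rparr>"
  have sel: "tx t = ltip a" "tu t = ltip b" "tu' t = ltip c" "tC t = ldown a" "tD t = lup b" "tD' t = lup c"
     "tCm t = lup' a" "tDm t = ldown' b" "tDm' t = ldown' c" "tV t = V" "tV' t = V'" "tf t = m" "tj t = m'"
    by (simp_all add: t_def)
  have dis: "llab a \<inter> llab b = {}" "llab a \<inter> llab c = {}" "llab b \<inter> llab c = {}"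
    using g unfolding lgood_def by simp_all
  have "tdisj t" unfolding tdisj_def sel
  proof (intro conjI)
    show "ldown a \<inter> lup' a = {}" using A(7) by blast
    show "lup b \<inter> ldown' b = {}" using B(7) by blast
    show "lup c \<inter> ldown' c = {}" using C(7) by blast
    show "m \<noteq> m'" by (rule ne)
    show "V \<inter> V' = {}" using V unfolding lmutual_def by simp
  qed (use dis n in \<open>simp add: llab_def Int_Un_distrib Int_Un_distrib2 Int_commute\<close>)+
  moreover have "tsize w t" unfolding tsize_def sel using A B C V unfolding lmutual_def by simp
  moreover have "twalks t" unfolding twalks_def sel
  proof (intro conjI exI)
    show "walk pr V (ltip b) (ltip c)" "walk pr V' (ltip c) (ltip b)" using V unfolding lmutual_def by simp_all
    show "walk pr (ldown a) (ltip a) (lfoot a)" "walk pr (lup b) (lfoot b) (ltip b)" "walk pr (lup c) (lfoot c) (ltip c)"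
      "walk pr (ldown' b) (ltip b) (lfoot' b)" "walk pr (ldown' c) (ltip c) (lfoot' c)" "walk pr (lup' a) (lfoot' a) (ltip a)"
      by (fact A B C)+
    show "pr m (lfoot a) (lfoot b)" "pr m (lfoot a) (lfoot c)" by (fact p)+
    show "pr m' (lfoot' b) (lfoot' a)" by (rule lgood_reversed[OF ne ok(1,2) g(1) p(1)])
    show "pr m' (lfoot' c) (lfoot' a)" by (rule lgood_reversed[OF ne ok(1,3) g(2) p(2)])
  qed
  moreover have "ttimes t"
  proof -
    have 1: "tlab t \<union> V \<union> V' \<subseteq> llab a \<union> llab b \<union> llab c \<union> {m, m'}"
      using V unfolding lmutual_def tlab_def tcore_def sel llab_def by blast
    have 2: "l < lam (ltip b) \<and> l < lam (ltip c)" if "l \<in> llab a \<union> llab b \<union> llab c \<union> {m, m'}" for l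
    proof -
      have "l = m \<or> l = m' \<or> l < m" using that A(8) B(8) C(8) by blast
      then show ?thesis using B(9,10) C(9,10) by auto
    qed
    have "lam (ltip b) < lam (ltip a)" "lam (ltip c) < lam (ltip a)"
      using time lgood_tips(2)[OF ne ok(1,2) g(1)] lgood_tips(2)[OF ne ok(1,3) g(2)] by simp_all
    then show ?thesis unfolding ttimes_def sel using 1 2 lgood_tips(2)[OF ne ok(2,3) g(3)] A(11) B(11) C(11) by blast
  qed
  ultimately have "tripod_ok w t" unfolding tripod_ok_def by simp
  then show ?thesis using sel by blast
qed

text \<open>If \<open>b\<close> and \<open>c\<close> come before \<open>a\<close> on
  \<open>m\<close>, they come after it on \<open>m'\<close>, and exchanging the two paths reduces
  this to the first case.\<close>

lemma legs_tripod:
  assumes ne: "m \<noteq> m'" and ok: "leg_ok w m m' a" "leg_ok w m m' b" "leg_ok w m m' c"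
    and g: "lgood a b" "lgood a c" "lgood b c"
    and p: "pr m (lfoot a) (lfoot b) \<and> pr m (lfoot a) (lfoot c) \<or> pr m (lfoot b) (lfoot a) \<and> pr m (lfoot c) (lfoot a)"
    and time: "lam (ltip b) \<le> lam (ltip a)" "lam (ltip c) \<le> lam (ltip a)"
  shows "\<exists>t. tripod_ok w t \<and> tx t = ltip a \<and> tu t = ltip b \<and> tu' t = ltip c"
  using p
proof
  assume "pr m (lfoot a) (lfoot b) \<and> pr m (lfoot a) (lfoot c)"
  then show ?thesis using legs_tripod_first[OF ne ok g _ _ time] by blast
next
  assume q: "pr m (lfoot b) (lfoot a) \<and> pr m (lfoot c) (lfoot a)"
  have "pr m' (lfoot' a) (lfoot' b)" "pr m' (lfoot' a) (lfoot' c)"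
    using lgood_reversed[OF ne ok(2,1) lgood_sym[OF g(1)]] lgood_reversed[OF ne ok(3,1) lgood_sym[OF g(2)]] q by blast+
  then show ?thesis
    using legs_tripod_first[OF ne[symmetric] ok[THEN leg_ok_swap]] g time by (simp add: lgood_lswap lswap_simps)
qed

end

subsection \<open>From legs to tripods\<close>

context bridge_free
begin

text \<open>Each leg may conflict with at most one percent of its group, itself included.
  Injectivity counts legs by tip and foot: equal tips are allowed, but then the feet on
  \<open>m\<close> differ.\<close>

definition leg_group :: "nat \<Rightarrow> nat \<Rightarrow> nat \<Rightarrow> leg set \<Rightarrow> bool" where
  "leg_group w m m' L \<longleftrightarrow> m \<noteq> m' \<and> finite L \<and> inj_on (\<lambda>a. (ltip a, lfoot a)) L
     \<and> (\<forall>a\<in>L. leg_ok w m m' a \<and> 100 * card {b \<in> L. \<not> lgood a b} \<le> card L)"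

text \<open>Squares are summed because a round turns pairs of legs of one group into pairs of feet.
  The lower bound reads as if there were \<open>R\<close> groups of size
  \<open>\<mu>\<close>.\<close>

definition leg_state :: "nat \<Rightarrow> nat \<Rightarrow> nat \<Rightarrow> bool" where
  "leg_state R w \<mu> \<longleftrightarrow> (\<exists>\<Gamma> \<Lambda>. finite \<Gamma> \<and> (\<forall>g\<in>\<Gamma>. leg_group w (fst g) (snd g) (\<Lambda> g) \<and> \<mu> \<le> card (\<Lambda> g))
     \<and> R * \<mu>\<^sup>2 \<le> (\<Sum>g\<in>\<Gamma>. (card (\<Lambda> g))\<^sup>2))"

text \<open>All blocks of tips have exactly the size \<open>f\<close>, so that proportions of legs
  can later be computed as proportions of pairs of feet.\<close>

definition tri_state :: "nat \<Rightarrow> nat \<Rightarrow> nat \<Rightarrow> bool" where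
  "tri_state w f Q \<longleftrightarrow> (\<exists>(\<P> :: (nat \<times> nat) set) Bl. finite \<P> \<and> Q \<le> card \<P>
     \<and> (\<forall>q\<in>\<P>. finite (Bl q) \<and> card (Bl q) = f
         \<and> (\<forall>x\<in>Bl q. \<exists>t. tripod_ok w t \<and> tx t = x \<and> tu t = fst q \<and> tu' t = snd q)))"

text \<open>Legs with a common tip have different feet on \<open>m\<close>. If two of them were
  cross-disjoint, the walk from one foot over the tip to the other would be a detour for
  \<open>m\<close>, whichever foot comes first.\<close>

lemma same_tip_bound:
  assumes "leg_group w m m' L"
  shows "card {a \<in> L. ltip a = x} \<le> 2 ^ (2 * w)"
proof (rule set_pair_inequality[where A = ldown and B = lup])
  have L: "finite L" "inj_on (\<lambda>a. (ltip a, lfoot a)) L" "\<And>a. a \<in> L \<Longrightarrow> leg_ok w m m' a"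
    using assms unfolding leg_group_def by auto
  show "finite {a \<in> L. ltip a = x}" using L by simp
  fix a assume "a \<in> {a \<in> L. ltip a = x}"
  then have a: "a \<in> L" "ltip a = x" by auto
  note A = leg_ok_D[OF L(3)[OF a(1)]]
  show "finite (ldown a) \<and> finite (lup a)" using A(3,4) walk_finite by blast
  show "ldown a \<inter> lup a = {}" using A(7) by blast
  show "card (ldown a) + card (lup a) \<le> 2 * w" using A(12,13) by linarith
  fix b assume "b \<in> {a \<in> L. ltip a = x}" and ab: "a \<noteq> b"
  then have b: "b \<in> L" "ltip b = x" by auto
  note B = leg_ok_D[OF L(3)[OF b(1)]]
  have "lfoot a \<noteq> lfoot b" using inj_onD[OF L(2), of a b] a b ab by auto
  then have p: "pr m (lfoot a) (lfoot b) \<or> pr m (lfoot b) (lfoot a)" using pr_total[OF A(1) B(1)] by blast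
  show "ldown a \<inter> lup b \<noteq> {} \<or> ldown b \<inter> lup a \<noteq> {}"
  proof (rule ccontr)
    assume "\<not> ?thesis"
    then have d: "lup b \<inter> ldown a = {}" "lup a \<inter> ldown b = {}" by auto
    have "walk pr (lup a \<union> ldown b) (lfoot a) (lfoot b)"
      by (rule walk_trans[OF B(3)[unfolded b(2)] A(4)[unfolded a(2)] d(2)])
    then have 1: "\<not> pr m (lfoot a) (lfoot b)"
      by (rule no_bridge) (use A(8) B(8) in \<open>auto simp: llab_def\<close>)
    have "walk pr (lup b \<union> ldown a) (lfoot b) (lfoot a)"
      by (rule walk_trans[OF A(3)[unfolded a(2)] B(4)[unfolded b(2)] d(1)])
    then have "\<not> pr m (lfoot b) (lfoot a)"
      by (rule no_bridge) (use A(8) B(8) in \<open>auto simp: llab_def\<close>)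
    then show False using p 1 by blast
  qed
qed

section \<open>How often the same pair of tips can arise from different groups\<close>

definition link_data :: "nat \<Rightarrow> nat \<Rightarrow> nat \<Rightarrow> nat \<Rightarrow> nat set \<Rightarrow> nat set \<Rightarrow> nat set \<Rightarrow> nat set \<Rightarrow> nat \<Rightarrow> nat \<Rightarrow> bool" where
  "link_data w m y z Y Y' Z Z' g h \<longleftrightarrow> pr m g h \<and> walk pr Y y g \<and> walk pr Y' g y \<and> walk pr Z z h \<and> walk pr Z' h z
     \<and> (\<forall>l\<in>Y \<union> Y' \<union> Z \<union> Z'. l < m) \<and> Y \<inter> Y' = {} \<and> Y \<inter> Z = {} \<and> Y \<inter> Z' = {} \<and> Y' \<inter> Z = {} \<and> Y' \<inter> Z' = {} \<and> Z \<inter> Z' = {}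
     \<and> card Y \<le> w \<and> card Y' \<le> w \<and> card Z \<le> w \<and> card Z' \<le> w"

text \<open>This keeps only one path of a pair of legs: \<open>y\<close> reaches \<open>m\<close>,
  moves forward along it, and reaches \<open>z\<close> from there. The reverse walks at both ends
  are what allows two such paths to be compared.\<close>

definition linked :: "nat \<Rightarrow> nat \<Rightarrow> nat \<Rightarrow> nat \<Rightarrow> bool" where
  "linked w m y z \<longleftrightarrow> (\<exists>Y Y' Z Z' g h. link_data w m y z Y Y' Z Z' g h)"

lemma link_data_D:
  assumes "link_data w m y z Y Y' Z Z' g h"
  shows "pr m g h" "walk pr Y y g" "walk pr Y' g y" "walk pr Z z h" "walk pr Z' h z"
    "\<forall>l\<in>Y \<union> Y' \<union> Z \<union> Z'. l < m" "Y \<inter> Y' = {}" "Y \<inter> Z = {}" "Y \<inter> Z' = {}" "Y' \<inter> Z = {}" "Y' \<inter> Z' = {}" "Z \<inter> Z' = {}"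
    "card Y \<le> w" "card Y' \<le> w" "card Z \<le> w" "card Z' \<le> w"
  using assms unfolding link_data_def by - (elim conjE, assumption)+

text \<open>For \<open>m < l\<close> there is a detour around the river \<open>l\<close>: from
  \<open>g l\<close> back to \<open>y\<close>, down to \<open>g m\<close>, along \<open>m\<close> to
  \<open>h m\<close>, up to \<open>z\<close> and down to \<open>h l\<close>. It needs only that
  \<open>Y m\<close>, \<open>Z' m\<close> and the label \<open>m\<close> avoid \<open>Y' l\<close>
  and \<open>Z l\<close>, so the set pairs have total size at most \<open>4 * w + 1\<close>.\<close>

lemma linked_bound:
  assumes fin: "finite \<Theta>" and lk: "\<And>m. m \<in> \<Theta> \<Longrightarrow> linked w m y z"
  shows "card \<Theta> \<le> 2 ^ (4 * w + 1)"
proof -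
  obtain Y Y' Z Z' g h where D0: "\<And>m. m \<in> \<Theta> \<Longrightarrow> link_data w m y z (Y m) (Y' m) (Z m) (Z' m) (g m) (h m)"
    using lk unfolding linked_def by metis
  have key: False
    if ml: "m \<in> \<Theta>" "l \<in> \<Theta>" "m < l" and d: "(Y m \<union> Z' m \<union> {m}) \<inter> (Y' l \<union> Z l) = {}" for m l
  proof -
    note M = link_data_D[OF D0[OF ml(1)]] and L = link_data_D[OF D0[OF ml(2)]]
    have m: "m \<notin> Y m" "m \<notin> Z' m" using M(6) by auto
    have 1: "walk pr (Y' l \<union> Y m) (g l) (g m)" by (rule walk_trans[OF M(2) L(3)]) (use d in blast)
    have 2: "walk pr (Y' l \<union> Y m \<union> {m}) (g l) (h m)"
      by (rule walk_trans[OF walk_arc[of pr, OF M(1)] 1]) (use d m in blast)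
    have 3: "walk pr (Y' l \<union> Y m \<union> {m} \<union> Z' m) (g l) z"
      by (rule walk_trans[OF M(5) 2]) (use d m M(9) in blast)
    have "walk pr (Y' l \<union> Y m \<union> {m} \<union> Z' m \<union> Z l) (g l) (h l)"
      by (rule walk_trans[OF L(4) 3]) (use d L(10) in blast)
    then have "\<not> pr l (g l) (h l)"
      by (rule no_bridge) (use M(6) L(6) ml(3) in \<open>auto dest: less_trans\<close>)
    then show False using L(1) by blast
  qed
  show ?thesis
  proof (rule set_pair_inequality[where A = "\<lambda>m. Y m \<union> Z' m \<union> {m}" and B = "\<lambda>m. Y' m \<union> Z m"])
    fix m assume m: "m \<in> \<Theta>"
    note M = link_data_D[OF D0[OF m]]
    show "finite (Y m \<union> Z' m \<union> {m}) \<and> finite (Y' m \<union> Z m)" using M(2-5) walk_finite by blast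
    show "(Y m \<union> Z' m \<union> {m}) \<inter> (Y' m \<union> Z m) = {}" using M(6-12) by blast
    show "card (Y m \<union> Z' m \<union> {m}) + card (Y' m \<union> Z m) \<le> 4 * w + 1"
      using card_Un_bound[OF card_Un_bound[OF M(13,16)], of "{m}" 1] card_Un_bound[OF M(14,15)] by simp
    fix l assume l: "l \<in> \<Theta>" and ne: "m \<noteq> l"
    show "(Y m \<union> Z' m \<union> {m}) \<inter> (Y' l \<union> Z l) \<noteq> {} \<or> (Y l \<union> Z' l \<union> {l}) \<inter> (Y' m \<union> Z m) \<noteq> {}"
      using key[OF m l] key[OF l m] ne by (meson linorder_neqE_nat)
  qed (rule fin)
qed

lemma legs_linked_aux:
  assumes ne: "m \<noteq> m'" and b: "leg_ok w m m' b" and c: "leg_ok w m m' c" and g: "lgood b c"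
    and p: "pr m (lfoot b) (lfoot c)"
  shows "linked w m (ltip b) (ltip c)" "linked w m' (ltip c) (ltip b)"
proof -
  note B = leg_ok_D[OF b] and C = leg_ok_D[OF c]
  have dis: "llab b \<inter> llab c = {}" using g unfolding lgood_def by simp
  have d1: "ldown b \<inter> lup b = {}" "ldown c \<inter> lup c = {}" "ldown' b \<inter> lup' b = {}" "ldown' c \<inter> lup' c = {}"
    using B(7) C(7) by blast+
  have "link_data w m (ltip b) (ltip c) (ldown b) (lup b) (ldown c) (lup c) (lfoot b) (lfoot c)"
    unfolding link_data_def
  proof (intro conjI)
    show "\<forall>l\<in>ldown b \<union> lup b \<union> ldown c \<union> lup c. l < m" using B(8) C(8) unfolding llab_def by blast
  qed (fact p B C d1 | use dis in \<open>simp add: llab_def Int_Un_distrib Int_Un_distrib2\<close>)+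
  then show "linked w m (ltip b) (ltip c)" unfolding linked_def by blast
  have "link_data w m' (ltip c) (ltip b) (ldown' c) (lup' c) (ldown' b) (lup' b) (lfoot' c) (lfoot' b)"
    unfolding link_data_def
  proof (intro conjI)
    show "\<forall>l\<in>ldown' c \<union> lup' c \<union> ldown' b \<union> lup' b. l < m'" using B(8) C(8) unfolding llab_def by blast
    show "pr m' (lfoot' c) (lfoot' b)" by (rule lgood_reversed[OF ne b c g p])
  qed (fact B C d1 | use dis in \<open>simp add: llab_def Int_Un_distrib Int_Un_distrib2 Int_commute\<close>)+
  then show "linked w m' (ltip c) (ltip b)" unfolding linked_def by blast
qed

lemma legs_linked:
  assumes "m \<noteq> m'" "leg_ok w m m' b" "leg_ok w m m' c" "lgood b c"
  shows "linked w m (ltip b) (ltip c) \<and> linked w m' (ltip c) (ltip b)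
       \<or> linked w m' (ltip b) (ltip c) \<and> linked w m (ltip c) (ltip b)"
  using lfoot_order[OF assms] legs_linked_aux[OF assms] legs_linked_aux[OF assms(1,3,2) lgood_sym[OF assms(4)]] by blast

text \<open>In each group, one of the two paths links \<open>y\<close> to \<open>z\<close> and the
  other links \<open>z\<close> to \<open>y\<close>. This leaves at most \<open>2^(4w+1)\<close>
  choices for each, and a factor 2 for which is which.\<close>

lemma linked_groups_bound:
  assumes fin: "finite \<Gamma>" and gr: "\<And>g. g \<in> \<Gamma> \<Longrightarrow> leg_group w (fst g) (snd g) (\<Lambda> g)"
    and ex: "\<And>g. g \<in> \<Gamma> \<Longrightarrow> \<exists>b\<in>\<Lambda> g. \<exists>c\<in>\<Lambda> g. lgood b c \<and> ltip b = y \<and> ltip c = z"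
  shows "card \<Gamma> \<le> 2 ^ (8 * w + 3)"
proof -
  define U where "U = fst ` \<Gamma> \<union> snd ` \<Gamma>"
  define \<Theta> where "\<Theta> = {m \<in> U. linked w m y z}"
  define \<Theta>' where "\<Theta>' = {m \<in> U. linked w m z y}"
  have finU: "finite U" unfolding U_def using fin by simp
  have c: "card \<Theta> \<le> 2 ^ (4 * w + 1)" "card \<Theta>' \<le> 2 ^ (4 * w + 1)"
  proof -
    show "card \<Theta> \<le> 2 ^ (4 * w + 1)" by (rule linked_bound[of \<Theta> w y z]) (use finU in \<open>auto simp: \<Theta>_def\<close>)
    show "card \<Theta>' \<le> 2 ^ (4 * w + 1)" by (rule linked_bound[of \<Theta>' w z y]) (use finU in \<open>auto simp: \<Theta>'_def\<close>)
  qed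
  have f: "finite \<Theta>" "finite \<Theta>'" unfolding \<Theta>_def \<Theta>'_def using finU by auto
  have "\<Gamma> \<subseteq> \<Theta> \<times> \<Theta>' \<union> \<Theta>' \<times> \<Theta>"
  proof
    fix g assume g: "g \<in> \<Gamma>"
    obtain b c where bc: "b \<in> \<Lambda> g" "c \<in> \<Lambda> g" "lgood b c" "ltip b = y" "ltip c = z" using ex[OF g] by blast
    have "fst g \<in> U" "snd g \<in> U" using g unfolding U_def by auto
    moreover have "linked w (fst g) y z \<and> linked w (snd g) z y \<or> linked w (snd g) y z \<and> linked w (fst g) z y"
      using legs_linked[of "fst g" "snd g" w b c] gr[OF g] bc unfolding leg_group_def by blast
    ultimately show "g \<in> \<Theta> \<times> \<Theta>' \<union> \<Theta>' \<times> \<Theta>" unfolding \<Theta>_def \<Theta>'_def by (cases g) auto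
  qed
  then have "card \<Gamma> \<le> card (\<Theta> \<times> \<Theta>' \<union> \<Theta>' \<times> \<Theta>)" using f by (intro card_mono) auto
  also have "\<dots> \<le> card (\<Theta> \<times> \<Theta>') + card (\<Theta>' \<times> \<Theta>)" by (rule card_Un_le)
  also have "\<dots> = 2 * (card \<Theta> * card \<Theta>')" by (simp add: card_cartesian_product)
  also have "\<dots> \<le> 2 * (2 ^ (4 * w + 1) * 2 ^ (4 * w + 1))" using c by (intro mult_left_mono mult_mono) auto
  also have "\<dots> = 2 ^ (1 + (4 * w + 1) + (4 * w + 1))" by (simp only: power_add power_one_right mult.assoc)
  also have "1 + (4 * w + 1) + (4 * w + 1) = 8 * w + 3" by simp
  finally show ?thesis .
qed

definition ltriple :: "nat \<Rightarrow> leg \<Rightarrow> leg \<Rightarrow> leg \<Rightarrow> bool" where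
  "ltriple m a b c \<longleftrightarrow> lgood a b \<and> lgood a c \<and> lgood b c \<and> lam (ltip b) \<le> lam (ltip a) \<and> lam (ltip c) \<le> lam (ltip a)
     \<and> (pr m (lfoot a) (lfoot b) \<and> pr m (lfoot a) (lfoot c) \<or> pr m (lfoot b) (lfoot a) \<and> pr m (lfoot c) (lfoot a))"

definition lrich :: "nat \<Rightarrow> leg set \<Rightarrow> (leg \<times> leg) set" where
  "lrich m L = {(b, c) \<in> L \<times> L. card L \<le> 20 * card {a \<in> L. ltriple m a b c}}"

lemma lrich_card:
  assumes "leg_group w m m' L"
  shows "(card L)\<^sup>2 \<le> 20 * card (lrich m L)"
  unfolding lrich_def ltriple_def
proof (rule many_triples)
  fix a b assume "a \<in> L" "b \<in> L" "lgood a b"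
  then show "pr m (lfoot a) (lfoot b) \<or> pr m (lfoot b) (lfoot a)"
    using assms lfoot_order[of m m' w a b] unfolding leg_group_def by blast
qed (use assms in \<open>auto simp: leg_group_def\<close>)

text \<open>A twentieth of the pairs of legs in a group have many completing legs. A pair of tips
  arises at most \<open>2^(12w+3)\<close> times: from \<open>2^(8w+3)\<close> groups and, in each,
  \<open>2^(2w)\<close> legs for either tip. The completing legs, at least
  \<open>\<mu> / 20\<close>, have at least \<open>\<mu> / (20 * 2^(2w))\<close> different
  tips.\<close>

lemma legs_to_tripods:
  assumes st: "leg_state R w \<mu>" and "1 \<le> \<mu>" and f: "20 * 2 ^ (2 * w) * f \<le> \<mu>" and Q: "20 * 2 ^ (12 * w + 3) * Q \<le> R * \<mu>\<^sup>2"
  shows "tri_state w f Q"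
proof -
  obtain \<Gamma> \<Lambda> where fin: "finite \<Gamma>" and gr: "\<And>g. g \<in> \<Gamma> \<Longrightarrow> leg_group w (fst g) (snd g) (\<Lambda> g)"
    and big: "\<And>g. g \<in> \<Gamma> \<Longrightarrow> \<mu> \<le> card (\<Lambda> g)" and sum: "R * \<mu>\<^sup>2 \<le> (\<Sum>g\<in>\<Gamma>. (card (\<Lambda> g))\<^sup>2)"
    using st unfolding leg_state_def by auto
  have finL: "finite (\<Lambda> g)" if "g \<in> \<Gamma>" for g using gr[OF that] unfolding leg_group_def by simp
  define W where "W = Sigma \<Gamma> (\<lambda>g. lrich (fst g) (\<Lambda> g))"
  define F where "F = (\<lambda>(g :: nat \<times> nat, b :: leg, c :: leg). (ltip b, ltip c))"
  have finr: "finite (lrich (fst g) (\<Lambda> g))" if "g \<in> \<Gamma>" for g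
    unfolding lrich_def by (rule finite_subset[of _ "\<Lambda> g \<times> \<Lambda> g"]) (use finL[OF that] in auto)
  have finW: "finite W" unfolding W_def using fin finr by auto
  have good: "b \<in> \<Lambda> g" "c \<in> \<Lambda> g" "lgood b c" if "(g, b, c) \<in> W" for g b c
  proof -
    have "g \<in> \<Gamma>" "b \<in> \<Lambda> g" "c \<in> \<Lambda> g" "card (\<Lambda> g) \<le> 20 * card {a \<in> \<Lambda> g. ltriple (fst g) a b c}"
      using that unfolding W_def lrich_def by auto
    moreover from this have "0 < card {a \<in> \<Lambda> g. ltriple (fst g) a b c}" using big[of g] assms(2) by linarith
    then have "{a \<in> \<Lambda> g. ltriple (fst g) a b c} \<noteq> {}" by (metis card.empty less_numeral_extra(3))
    ultimately show "b \<in> \<Lambda> g" "c \<in> \<Lambda> g" "lgood b c" unfolding ltriple_def by auto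
  qed
  have fib: "card {x \<in> W. F x = yz} \<le> 2 ^ (12 * w + 3)" for yz
  proof -
    obtain y z where yz: "yz = (y, z)" by (cases yz)
    define \<Gamma>' where "\<Gamma>' = {g \<in> \<Gamma>. \<exists>b\<in>\<Lambda> g. \<exists>c\<in>\<Lambda> g. lgood b c \<and> ltip b = y \<and> ltip c = z}"
    have cG: "card \<Gamma>' \<le> 2 ^ (8 * w + 3)"
      by (rule linked_groups_bound[of _ w \<Lambda> y z]) (use fin gr in \<open>auto simp: \<Gamma>'_def\<close>)
    have fG: "finite \<Gamma>'" unfolding \<Gamma>'_def using fin by simp
    define X where "X g = {b \<in> \<Lambda> g. ltip b = y} \<times> {c \<in> \<Lambda> g. ltip c = z}" for g
    have fX: "finite (X g)" if "g \<in> \<Gamma>'" for g using finL that unfolding X_def \<Gamma>'_def by auto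
    have "{x \<in> W. F x = yz} \<subseteq> Sigma \<Gamma>' X"
    proof
      fix x assume x: "x \<in> {x \<in> W. F x = yz}"
      obtain g b c where gbc: "x = (g, b, c)" by (cases x)
      have W: "(g, b, c) \<in> W" using x gbc by simp
      moreover have "g \<in> \<Gamma>" using W unfolding W_def by simp
      moreover have "ltip b = y" "ltip c = z" using x gbc yz unfolding F_def by auto
      ultimately show "x \<in> Sigma \<Gamma>' X" using good[OF W] gbc unfolding \<Gamma>'_def X_def by blast
    qed
    then have "card {x \<in> W. F x = yz} \<le> card (Sigma \<Gamma>' X)" using fG fX by (intro card_mono) auto
    also have "\<dots> = (\<Sum>g\<in>\<Gamma>'. card (X g))" using fG fX by simp
    also have "\<dots> \<le> (\<Sum>g\<in>\<Gamma>'. 2 ^ (2 * w) * 2 ^ (2 * w))"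
    proof (rule sum_mono)
      fix g assume "g \<in> \<Gamma>'"
      then have "leg_group w (fst g) (snd g) (\<Lambda> g)" using gr unfolding \<Gamma>'_def by simp
      then show "card (X g) \<le> 2 ^ (2 * w) * 2 ^ (2 * w)"
        unfolding X_def card_cartesian_product by (intro mult_le_mono same_tip_bound)
    qed
    also have "\<dots> \<le> 2 ^ (8 * w + 3) * (2 ^ (2 * w) * 2 ^ (2 * w))" using cG by simp
    also have "\<dots> = 2 ^ ((8 * w + 3) + (2 * w + 2 * w))" by (simp only: power_add)
    also have "(8 * w + 3) + (2 * w + 2 * w) = 12 * w + 3" by simp
    finally show ?thesis .
  qed
  have cW: "card W \<le> card (F ` W) * 2 ^ (12 * w + 3)"
    by (rule card_le_fibers[OF finW]) (rule fib)
  have "20 * 2 ^ (12 * w + 3) * Q \<le> (\<Sum>g\<in>\<Gamma>. (card (\<Lambda> g))\<^sup>2)" using Q sum by linarith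
  also have "\<dots> \<le> (\<Sum>g\<in>\<Gamma>. 20 * card (lrich (fst g) (\<Lambda> g)))" by (rule sum_mono) (rule lrich_card[OF gr])
  also have "\<dots> = 20 * card W" unfolding W_def using fin finr by (simp add: sum_distrib_left)
  also have "\<dots> \<le> 20 * (card (F ` W) * 2 ^ (12 * w + 3))" using cW by simp
  finally have "(20 * 2 ^ (12 * w + 3)) * Q \<le> (20 * 2 ^ (12 * w + 3)) * card (F ` W)" by (simp only: ac_simps)
  then have cQ: "Q \<le> card (F ` W)" by (subst (asm) mult_le_cancel1) auto
  have "\<forall>q\<in>F ` W. \<exists>B. finite B \<and> card B = f \<and> (\<forall>x\<in>B. \<exists>t. tripod_ok w t \<and> tx t = x \<and> tu t = fst q \<and> tu' t = snd q)"
  proof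
    fix q assume "q \<in> F ` W"
    then obtain g b c where W: "(g, b, c) \<in> W" and q: "q = (ltip b, ltip c)" unfolding F_def by auto
    have g: "g \<in> \<Gamma>" using W unfolding W_def by simp
    define T where "T = {a \<in> \<Lambda> g. ltriple (fst g) a b c}"
    have finT: "finite T" unfolding T_def using finL[OF g] by simp
    have T20: "\<mu> \<le> 20 * card T" using W big[OF g] unfolding W_def lrich_def T_def by auto
    have "card T \<le> card (ltip ` T) * 2 ^ (2 * w)"
    proof (rule card_le_fibers[OF finT])
      fix y
      have "card {a \<in> T. ltip a = y} \<le> card {a \<in> \<Lambda> g. ltip a = y}"
        using finL[OF g] by (intro card_mono) (auto simp: T_def)
      also have "\<dots> \<le> 2 ^ (2 * w)" by (rule same_tip_bound[OF gr[OF g]])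
      finally show "card {a \<in> T. ltip a = y} \<le> 2 ^ (2 * w)" .
    qed
    then have "20 * card T \<le> 20 * (card (ltip ` T) * 2 ^ (2 * w))" by simp
    with f T20 have "(20 * 2 ^ (2 * w)) * f \<le> 20 * (card (ltip ` T) * 2 ^ (2 * w))" by linarith
    also have "\<dots> = (20 * 2 ^ (2 * w)) * card (ltip ` T)" by (simp only: ac_simps)
    finally have "f \<le> card (ltip ` T)" by (subst (asm) mult_le_cancel1) auto
    then obtain B where B: "B \<subseteq> ltip ` T" "card B = f" by (rule obtain_subset_with_card_n)
    have "\<exists>t. tripod_ok w t \<and> tx t = x \<and> tu t = fst q \<and> tu' t = snd q" if xB: "x \<in> B" for x
    proof -
      obtain a where a: "a \<in> \<Lambda> g" "ltriple (fst g) a b c" "x = ltip a" using xB B(1) unfolding T_def by blast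
      have ok: "leg_ok w (fst g) (snd g) a" "leg_ok w (fst g) (snd g) b" "leg_ok w (fst g) (snd g) c" "fst g \<noteq> snd g"
        using gr[OF g] a(1) good[OF W] unfolding leg_group_def by auto
      show ?thesis
        using legs_tripod[OF ok(4,1,2,3)] a(2,3) q unfolding ltriple_def by simp
    qed
    moreover have "finite B" using B(1) finT finite_subset by blast
    ultimately show "\<exists>B. finite B \<and> card B = f \<and> (\<forall>x\<in>B. \<exists>t. tripod_ok w t \<and> tx t = x \<and> tu t = fst q \<and> tu' t = snd q)"
      using B(2) by blast
  qed
  then obtain Bl where "\<forall>q\<in>F ` W. finite (Bl q) \<and> card (Bl q) = f \<and> (\<forall>x\<in>Bl q. \<exists>t. tripod_ok w t \<and> tx t = x \<and> tu t = fst q \<and> tu' t = snd q)"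
    by (rule bchoice[THEN exE])
  moreover have "finite (F ` W)" using finW by simp
  ultimately show ?thesis unfolding tri_state_def using cQ by blast
qed

end

subsection \<open>From tripods to legs\<close>

text \<open>The feet of the tripod become the feet of the leg. Core and branch are merged into one
  label set of size at most \<open>2 * w + 1\<close>; this is where the width grows.\<close>

definition leg_of :: "tripod \<Rightarrow> leg" where
  "leg_of t = \<lparr>ltip = tx t, lfoot = tu t, lfoot' = tu' t,
     ldown = tC t \<union> ({tf t} \<union> tD t), lup = tDm t \<union> {tj t} \<union> tCm t,
     ldown' = tC t \<union> ({tf t} \<union> tD' t), lup' = tDm' t \<union> {tj t} \<union> tCm t\<rparr>"

lemma leg_of_simps:
  "ltip (leg_of t) = tx t" "lfoot (leg_of t) = tu t" "lfoot' (leg_of t) = tu' t"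
  "ldown (leg_of t) = tC t \<union> ({tf t} \<union> tD t)" "lup (leg_of t) = tDm t \<union> {tj t} \<union> tCm t"
  "ldown' (leg_of t) = tC t \<union> ({tf t} \<union> tD' t)" "lup' (leg_of t) = tDm' t \<union> {tj t} \<union> tCm t"
  by (simp_all add: leg_of_def)

lemma llab_leg_of: "llab (leg_of t) = tlab t"
  unfolding llab_def leg_of_simps tlab_def tcore_def by blast

context bridge_free
begin

lemma leg_ok_leg_of:
  assumes ok: "tripod_ok w t"
  shows "leg_ok (2 * w + 1) (lam (tu t)) (lam (tu' t)) (leg_of t)"
proof -
  note K = tripod_coloring[OF ok] and cs = tripod_cards[OF ok]
  have ne: "tf t \<noteq> tj t" "tj t \<noteq> tf t" using tripod_disjoint(28)[OF ok] by auto
  obtain s a a' q b b' where W: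
    "walk pr (tC t \<union> ({tf t} \<union> tD t)) (tx t) (tu t)" "walk pr (tC t \<union> ({tf t} \<union> tD' t)) (tx t) (tu' t)"
    "walk pr (tDm t \<union> {tj t} \<union> tCm t) (tu t) (tx t)" "walk pr (tDm' t \<union> {tj t} \<union> tCm t) (tu' t) (tx t)"
    by (rule tripod_walks[OF ok])
  have T: "tu t \<in> on (lam (tu t))" "tu' t \<in> on (lam (tu' t))" "tx t \<in> on (lam (tx t))"
    "lam (tu t) < lam (tx t)" "lam (tu' t) < lam (tx t)"
    using ok unfolding tripod_ok_def ttimes_def by simp_all
  show ?thesis unfolding leg_ok_def llab_leg_of leg_of_simps
  proof (intro conjI)
    show "(tC t \<union> ({tf t} \<union> tD t) \<union> (tC t \<union> ({tf t} \<union> tD' t))) \<inter>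
      (tDm t \<union> {tj t} \<union> tCm t \<union> (tDm' t \<union> {tj t} \<union> tCm t)) = {}"
      by (auto dest!: K(1-6) simp: K(7,8) ne)
    show "card (tC t \<union> ({tf t} \<union> tD t)) \<le> 2 * w + 1" using card_Un_bound[OF cs(1) card_Un_bound[OF cs(7,2)]] by simp
    show "card (tC t \<union> ({tf t} \<union> tD' t)) \<le> 2 * w + 1" using card_Un_bound[OF cs(1) card_Un_bound[OF cs(7,3)]] by simp
    show "card (tDm t \<union> {tj t} \<union> tCm t) \<le> 2 * w + 1" using card_Un_bound[OF card_Un_bound[OF cs(5,8)] cs(4)] by simp
    show "card (tDm' t \<union> {tj t} \<union> tCm t) \<le> 2 * w + 1" using card_Un_bound[OF card_Un_bound[OF cs(6,8)] cs(4)] by simp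
    show "\<forall>l\<in>tlab t. l < lam (tu t) \<and> l < lam (tu' t)" by (rule tripod_lab(5)[OF ok])
  qed (fact W T)+
qed

text \<open>All these nodes \<open>v\<close> lie on \<open>m'\<close> and are mutually reachable
  with \<open>u\<close>. Two of them with cross-disjoint walks would be joined by a detour through
  \<open>u\<close> in either direction, against their order on \<open>m'\<close>. The walks to and
  from \<open>u\<close> have \<open>2 * (2w + 1)\<close> labels in total.\<close>

lemma same_foot_bound:
  assumes fin: "finite K" and ok: "\<And>v. v \<in> K \<Longrightarrow> \<exists>t. tripod_ok w t \<and> tu t = u \<and> tu' t = v" and m: "\<And>v. v \<in> K \<Longrightarrow> lam v = m'"
  shows "card K \<le> 2 ^ (4 * w + 2)"
proof -
  obtain T where T: "\<And>v. v \<in> K \<Longrightarrow> tripod_ok w (T v)" "\<And>v. v \<in> K \<Longrightarrow> tu (T v) = u" "\<And>v. v \<in> K \<Longrightarrow> tu' (T v) = v"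
    using ok by metis
  have D: "walk pr (tV (T v)) u v" "walk pr (tV' (T v)) v u" "tV (T v) \<inter> tV' (T v) = {}"
    "card (tV (T v)) \<le> 2 * w + 1" "card (tV' (T v)) \<le> 2 * w + 1" "\<forall>l\<in>tV (T v) \<union> tV' (T v). l < m'" "v \<in> on m'"
    if "v \<in> K" for v
    using T[OF that] m[OF that] unfolding tripod_ok_def tdisj_def tsize_def twalks_def ttimes_def by auto
  have key: "\<not> pr m' x y" if "x \<in> K" "y \<in> K" "tV' (T x) \<inter> tV (T y) = {}" for x y
  proof (rule no_bridge)
    show "walk pr (tV' (T x) \<union> tV (T y)) x y" by (rule walk_trans[OF D(1)[OF that(2)] D(2)[OF that(1)] that(3)])
  qed (use D(6) that in blast)
  show ?thesis
  proof (rule set_pair_inequality[where A = "\<lambda>v. tV' (T v)" and B = "\<lambda>v. tV (T v)"])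
    fix x assume x: "x \<in> K"
    show "finite (tV' (T x)) \<and> finite (tV (T x))" using D(1,2)[OF x] walk_finite by blast
    show "tV' (T x) \<inter> tV (T x) = {}" using D(3)[OF x] by blast
    show "card (tV' (T x)) + card (tV (T x)) \<le> 4 * w + 2" using D(4,5)[OF x] by linarith
    fix y assume y: "y \<in> K" and ne: "x \<noteq> y"
    show "tV' (T x) \<inter> tV (T y) \<noteq> {} \<or> tV' (T y) \<inter> tV (T x) \<noteq> {}"
      using key[OF x y] key[OF y x] pr_total[OF D(7)[OF x] D(7)[OF y] ne] by blast
  qed (rule fin)
qed

lemma same_foot_bound':
  assumes fin: "finite K" and ok: "\<And>v. v \<in> K \<Longrightarrow> \<exists>t. tripod_ok w t \<and> tu t = v \<and> tu' t = u" and m: "\<And>v. v \<in> K \<Longrightarrow> lam v = m'"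
  shows "card K \<le> 2 ^ (4 * w + 2)"
proof (rule same_foot_bound[OF fin _ m, where u = u])
  fix v assume "v \<in> K"
  then obtain t where "tripod_ok w t" "tu t = v" "tu' t = u" using ok by blast
  then show "\<exists>t. tripod_ok w t \<and> tu t = u \<and> tu' t = v"
    using tripod_ok_swap[of w t] by (intro exI[of _ "tswap t"]) (simp add: tswap_def)
qed

end

locale finite_bridge_free = bridge_free +
  fixes p n :: nat
  assumes on_bounds: "x \<in> on k \<Longrightarrow> k < p \<and> x < n"
begin

text \<open>Classes are given by the last paths through the two feet. A class with at least
  \<open>\<kappa>\<close> pairs becomes a group: a leg conflicts only with blocks that share a foot
  or a label with it, and \<open>\<kappa>\<close> is chosen so that these are at most one percent of
  the blocks.\<close>

lemma tripods_to_legs: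
  assumes st: "tri_state w f Q" and f: "1 \<le> f"
    and Q: "2 * \<kappa> * p\<^sup>2 * (2 * 2 ^ (4 * w + 2) + 1) \<le> Q"
    and \<kappa>: "100 * (1 + (6 * w + 2) * (2 ^ (w + 1)) ^ 115) \<le> \<kappa>"
  shows "leg_state (p\<^sup>2) (2 * w + 1) (\<kappa> * f)"
proof -
  obtain \<P> :: "(nat \<times> nat) set" and Bl where finP: "finite \<P>" and cP: "Q \<le> card \<P>"
    and Bl: "\<And>q. q \<in> \<P> \<Longrightarrow> finite (Bl q)" "\<And>q. q \<in> \<P> \<Longrightarrow> card (Bl q) = f"
    and ex: "\<And>q x. q \<in> \<P> \<Longrightarrow> x \<in> Bl q \<Longrightarrow> \<exists>t. tripod_ok w t \<and> tx t = x \<and> tu t = fst q \<and> tu' t = snd q"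
    using st unfolding tri_state_def by blast
  define T where "T q x = (SOME t. tripod_ok w t \<and> tx t = x \<and> tu t = fst q \<and> tu' t = snd q)" for q :: "nat \<times> nat" and x
  have T: "tripod_ok w (T q x)" "tx (T q x) = x" "tu (T q x) = fst q" "tu' (T q x) = snd q"
    if "q \<in> \<P>" "x \<in> Bl q" for q x
    using someI_ex[OF ex[OF that]] unfolding T_def by auto
  have ex1: "\<exists>t. tripod_ok w t \<and> tu t = fst q \<and> tu' t = snd q" if "q \<in> \<P>" for q
  proof -
    have "Bl q \<noteq> {}" using Bl(2)[OF that] f by auto
    then show ?thesis using ex[OF that] by blast
  qed
  \<comment> \<open>Conflict means a shared foot within one class. After thinning, different pairs
    of a class differ in both feet, as \<open>lgood\<close> and \<open>heavy_label\<close>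
    demand.\<close>
  define C where "C q q' \<longleftrightarrow> lam (fst q) = lam (fst q') \<and> lam (snd q) = lam (snd q') \<and> (fst q = fst q' \<or> snd q = snd q')"
    for q q' :: "nat \<times> nat"
  have deg: "card {q' \<in> \<P>. C q q'} \<le> 2 * 2 ^ (4 * w + 2)" if q: "q \<in> \<P>" for q
  proof -
    let ?A = "{q' \<in> \<P>. fst q' = fst q \<and> lam (snd q') = lam (snd q)}"
    let ?B = "{q' \<in> \<P>. snd q' = snd q \<and> lam (fst q') = lam (fst q)}"
    have "card ?A = card (snd ` ?A)" by (intro card_image[symmetric] inj_onI) (auto simp: prod_eq_iff)
    also have "\<dots> \<le> 2 ^ (4 * w + 2)"
      by (rule same_foot_bound[of _ w "fst q" "lam (snd q)"]) (use finP ex1 in \<open>force+\<close>)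
    finally have 1: "card ?A \<le> 2 ^ (4 * w + 2)" .
    have "card ?B = card (fst ` ?B)" by (intro card_image[symmetric] inj_onI) (auto simp: prod_eq_iff)
    also have "\<dots> \<le> 2 ^ (4 * w + 2)"
      by (rule same_foot_bound'[of _ w "snd q" "lam (fst q)"]) (use finP ex1 in \<open>force+\<close>)
    finally have 2: "card ?B \<le> 2 ^ (4 * w + 2)" .
    have "{q' \<in> \<P>. C q q'} \<subseteq> ?A \<union> ?B" unfolding C_def by auto
    then have "card {q' \<in> \<P>. C q q'} \<le> card (?A \<union> ?B)" using finP by (intro card_mono) auto
    also have "\<dots> \<le> 2 ^ (4 * w + 2) + 2 ^ (4 * w + 2)" by (intro card_Un_bound 1 2)
    finally show ?thesis by (simp only: mult_2)
  qed
  obtain I where I: "I \<subseteq> \<P>" "card \<P> \<le> (2 * 2 ^ (4 * w + 2) + 1) * card I"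
    and indep: "\<And>q q'. q \<in> I \<Longrightarrow> q' \<in> I \<Longrightarrow> q \<noteq> q' \<Longrightarrow> \<not> C q q'"
    by (rule independent_subset[of \<P> C, OF finP _ deg]) (auto simp: C_def)
  have finI: "finite I" using I(1) finP finite_subset by blast
  have "(2 * 2 ^ (4 * w + 2) + 1) * (2 * \<kappa> * p\<^sup>2) \<le> (2 * 2 ^ (4 * w + 2) + 1) * card I"
    using Q cP I(2) by (simp only: ac_simps)
  then have cI: "2 * \<kappa> * p\<^sup>2 \<le> card I" by (subst (asm) mult_le_cancel1) auto
  define G where "G g = {q \<in> I. lam (fst q) = fst g \<and> lam (snd q) = snd g}" for g :: "nat \<times> nat"
  \<comment> \<open>The dropped classes contain at most \<open>\<kappa> * p^2\<close> pairs
    together, which is at most half of \<open>I\<close>.\<close>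
  define \<Gamma> where "\<Gamma> = {g \<in> {..<p} \<times> {..<p}. \<kappa> \<le> card (G g)}"
  define h where "h = (\<lambda>(q, x). leg_of (T q x))"
  define \<Lambda> where "\<Lambda> g = h ` Sigma (G g) Bl" for g
  have GP: "q \<in> \<P>" "q \<in> I" "lam (fst q) = fst g" "lam (snd q) = snd g" if "q \<in> G g" for q g
    using that I(1) unfolding G_def by auto
  have finG: "finite (G g)" for g unfolding G_def using finI by simp
  have Gdiff: "fst q \<noteq> fst q'" "snd q \<noteq> snd q'" if "q \<in> G g" "q' \<in> G g" "q \<noteq> q'" for q q' g
    using indep[of q q'] that GP[OF that(1)] GP[OF that(2)] unfolding C_def by auto
  have hs: "ltip (h (q, x)) = x" "lfoot (h (q, x)) = fst q" "lfoot' (h (q, x)) = snd q" "llab (h (q, x)) = tlab (T q x)"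
    if "q \<in> \<P>" "x \<in> Bl q" for q x
    using T(2-4)[OF that] by (simp_all add: h_def leg_of_simps llab_leg_of)
  have injh: "inj_on h (Sigma (G g) Bl)" for g
  proof (rule inj_onI)
    fix y y' assume y: "y \<in> Sigma (G g) Bl" "y' \<in> Sigma (G g) Bl" "h y = h y'"
    obtain q x q' x' where e: "y = (q, x)" "y' = (q', x')" by (cases y, cases y')
    have "q \<in> \<P>" "x \<in> Bl q" "q' \<in> \<P>" "x' \<in> Bl q'" using y e GP(1)[of q g] GP(1)[of q' g] by auto
    then show "y = y'" using y(3) e hs(1-3)[of q x] hs(1-3)[of q' x'] by (simp add: prod_eq_iff)
  qed
  have finS: "finite (Sigma (G g) Bl)" for g by (rule finite_SigmaI[OF finG Bl(1)[OF GP(1)]])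
  have cS: "card (Sigma S Bl) = card S * f" if "S \<subseteq> G g" for S g
  proof -
    have "card (Sigma S Bl) = (\<Sum>q\<in>S. card (Bl q))"
      using that finG[of g] finite_subset GP(1) Bl(1) by (intro card_SigmaI) blast+
    also have "\<dots> = (\<Sum>q\<in>S. f)" by (rule sum.cong[OF refl], rule Bl(2), rule GP(1)[of _ g]) (use that in blast)
    finally show ?thesis by simp
  qed
  have cL: "card (\<Lambda> g) = card (G g) * f" for g
    unfolding \<Lambda>_def card_image[OF injh] by (rule cS[of _ g]) simp
  have group: "leg_group (2 * w + 1) (fst g) (snd g) (\<Lambda> g)" if g: "g \<in> \<Gamma>" for g
  proof -
    have K: "\<kappa> \<le> card (G g)" using g unfolding \<Gamma>_def by simp
    then have "G g \<noteq> {}" using \<kappa> by auto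
    then obtain q0 where q0: "q0 \<in> G g" by auto
    obtain t0 where "tripod_ok w t0" "tu t0 = fst q0" "tu' t0 = snd q0" using ex1[OF GP(1)[OF q0]] by blast
    then have ne: "fst g \<noteq> snd g" using GP(3,4)[OF q0] unfolding tripod_ok_def ttimes_def by auto
    have finL: "finite (\<Lambda> g)" unfolding \<Lambda>_def using finS by simp
    have inj: "inj_on (\<lambda>a. (ltip a, lfoot a)) (\<Lambda> g)"
    proof (rule inj_onI)
      fix a a' assume a: "a \<in> \<Lambda> g" "a' \<in> \<Lambda> g" "(ltip a, lfoot a) = (ltip a', lfoot a')"
      obtain q x q' x' where e: "a = h (q, x)" "q \<in> G g" "x \<in> Bl q" "a' = h (q', x')" "q' \<in> G g" "x' \<in> Bl q'"
        using a(1,2) unfolding \<Lambda>_def by auto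
      have "x = x'" "fst q = fst q'" 
        using a(3) hs(1,2)[OF GP(1)[OF e(2)] e(3)] hs(1,2)[OF GP(1)[OF e(5)] e(6)] e(1,4) by simp_all
      then show "a = a'" using Gdiff(1)[OF e(2,5)] e by auto
    qed
    have ok: "leg_ok (2 * w + 1) (fst g) (snd g) a" if "a \<in> \<Lambda> g" for a
    proof -
      obtain q x where e: "a = h (q, x)" "q \<in> G g" "x \<in> Bl q" using \<open>a \<in> \<Lambda> g\<close> unfolding \<Lambda>_def by auto
      show ?thesis using leg_ok_leg_of[OF T(1)[OF GP(1)[OF e(2)] e(3)]] T(3,4)[OF GP(1)[OF e(2)] e(3)] GP(3,4)[OF e(2)] e(1)
        by (simp add: h_def)
    qed
    \<comment> \<open>From each affected block one tripod containing \<open>l\<close> is selected.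
      The selected tripods have distinct feet, so the bound for a single label applies, whatever the
      size of the blocks.\<close>
    have heavy: "card {q \<in> G g. \<exists>x\<in>Bl q. l \<in> tlab (T q x)} \<le> (2 ^ (w + 1)) ^ 115" for l
    proof -
      let ?S = "{q \<in> G g. \<exists>x\<in>Bl q. l \<in> tlab (T q x)}"
      have "\<forall>q\<in>?S. \<exists>y. y \<in> Bl q \<and> l \<in> tlab (T q y)" by auto
      then obtain x where "\<forall>q\<in>?S. x q \<in> Bl q \<and> l \<in> tlab (T q (x q))" by (rule bchoice[THEN exE])
      then have x: "\<And>q. q \<in> ?S \<Longrightarrow> x q \<in> Bl q" "\<And>q. q \<in> ?S \<Longrightarrow> l \<in> tlab (T q (x q))" by blast+
      have SP: "q \<in> \<P>" "q \<in> G g" if "q \<in> ?S" for q using that GP(1)[of q g] by simp_all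
      define t where "t q = T q (x q)" for q
      have tt: "tripod_ok w (t q)" "tu (t q) = fst q" "tu' (t q) = snd q" if "q \<in> ?S" for q
        using T[OF SP(1)[OF that] x(1)[OF that]] unfolding t_def by auto
      have "inj_on t ?S"
      proof (rule inj_onI)
        fix q q' assume "q \<in> ?S" "q' \<in> ?S" "t q = t q'"
        then show "q = q'" using tt(2,3)[of q] tt(2,3)[of q'] by (simp add: prod_eq_iff)
      qed
      then have "card ?S = card (t ` ?S)" by (rule card_image[symmetric])
      also have "\<dots> \<le> (2 ^ (w + 1)) ^ 115"
      proof (rule heavy_label[where m = "fst g" and m' = "snd g" and r = l])
        show "finite (t ` ?S)" using finG by simp
        show "inj_on tu (t ` ?S)"
        proof (rule inj_onI)
          fix a b assume "a \<in> t ` ?S" "b \<in> t ` ?S" and eq: "tu a = tu b"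
          then obtain q q' where "a = t q" "b = t q'" "q \<in> ?S" "q' \<in> ?S" by blast
          then show "a = b" using eq tt(2) Gdiff(1)[of q g q'] by auto
        qed
        show "inj_on tu' (t ` ?S)"
        proof (rule inj_onI)
          fix a b assume "a \<in> t ` ?S" "b \<in> t ` ?S" and eq: "tu' a = tu' b"
          then obtain q q' where "a = t q" "b = t q'" "q \<in> ?S" "q' \<in> ?S" by blast
          then show "a = b" using eq tt(3) Gdiff(2)[of q g q'] by auto
        qed
        fix a assume "a \<in> t ` ?S"
        then obtain q where q: "a = t q" "q \<in> ?S" by blast
        show "tripod_ok w a" "lam (tu a) = fst g" "lam (tu' a) = snd g" "l \<in> tlab a"
          using tt[OF q(2)] GP(3,4)[OF SP(2)[OF q(2)]] x(2)[OF q(2)] q(1) unfolding t_def by simp_all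
      qed
      finally show ?thesis .
    qed
    have bad: "100 * card {b \<in> \<Lambda> g. \<not> lgood a b} \<le> card (\<Lambda> g)" if a: "a \<in> \<Lambda> g" for a
    proof -
      define N where "N = ((2::nat) ^ (w + 1)) ^ 115"
      obtain q x where e: "a = h (q, x)" "q \<in> G g" "x \<in> Bl q" using a unfolding \<Lambda>_def by auto
      have qP: "q \<in> \<P>" by (rule GP(1)[OF e(2)])
      note lab = tripod_lab[OF T(1)[OF qP e(3)]]
      \<comment> \<open>Whole blocks are charged as soon as one of their tripods shares a label with
        that of \<open>a\<close>. As all blocks have size \<open>f\<close>, it suffices to count
        pairs of feet.\<close>
      define S where "S l = {q \<in> G g. \<exists>x\<in>Bl q. l \<in> tlab (T q x)}" for l
      define S' where "S' = insert q (\<Union>l\<in>tlab (T q x). S l)"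
      have "S l \<subseteq> G g" for l unfolding S_def by blast
      then have S'G: "S' \<subseteq> G g" using e(2) unfolding S'_def by blast
      have "Sigma S' Bl \<subseteq> Sigma (G g) Bl" using S'G by blast
      then have finS': "finite (Sigma S' Bl)" using finS[of g] by (rule finite_subset)
      have cS': "card S' \<le> 1 + (6 * w + 2) * N"
      proof -
        have "card S' \<le> card {q} + card (\<Union>l\<in>tlab (T q x). S l)"
          using card_Un_le[of "{q}" "\<Union>l\<in>tlab (T q x). S l"] unfolding S'_def by simp
        moreover have "card (\<Union>l\<in>tlab (T q x). S l) \<le> (\<Sum>l\<in>tlab (T q x). card (S l))"
          by (rule card_UN_le[OF lab(1)])
        moreover have "(\<Sum>l\<in>tlab (T q x). card (S l)) \<le> (\<Sum>l\<in>tlab (T q x). N)"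
          unfolding S_def N_def by (rule sum_mono) (rule heavy)
        moreover have "(\<Sum>l\<in>tlab (T q x). N) \<le> (6 * w + 2) * N" using mult_right_mono[OF lab(2), of N] by simp
        ultimately show ?thesis by simp
      qed
      have "{b \<in> \<Lambda> g. \<not> lgood a b} \<subseteq> h ` Sigma S' Bl"
      proof
        fix b assume "b \<in> {b \<in> \<Lambda> g. \<not> lgood a b}"
        then obtain q' x' where b: "b = h (q', x')" "q' \<in> G g" "x' \<in> Bl q'" "\<not> lgood a b" unfolding \<Lambda>_def by auto
        note H = hs[OF qP e(3)] hs[OF GP(1)[OF b(2)] b(3)]
        have "q' \<in> S'"
        proof (cases "q' = q")
          case True then show ?thesis unfolding S'_def by simp
        next
          case False
          then have "tlab (T q x) \<inter> tlab (T q' x') \<noteq> {}"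
            using b(4) Gdiff[OF e(2) b(2)] H unfolding lgood_def e(1) b(1) by auto
          then show ?thesis unfolding S'_def S_def using b by blast
        qed
        then show "b \<in> h ` Sigma S' Bl" using b by auto
      qed
      then have "card {b \<in> \<Lambda> g. \<not> lgood a b} \<le> card (h ` Sigma S' Bl)"
        
        by (rule card_mono[OF finite_imageI[OF finS']])
      also have "\<dots> \<le> card (Sigma S' Bl)"
        by (rule card_image_le[OF finS'])
      also have "\<dots> = card S' * f" by (rule cS[OF S'G])
      also have "\<dots> \<le> (1 + (6 * w + 2) * N) * f" using cS' by (rule mult_right_mono) simp
      finally have "card {b \<in> \<Lambda> g. \<not> lgood a b} \<le> (1 + (6 * w + 2) * N) * f" .
      then have "100 * card {b \<in> \<Lambda> g. \<not> lgood a b} \<le> (100 * (1 + (6 * w + 2) * N)) * f"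
        unfolding mult.assoc by (rule mult_le_mono2)
      also have "\<dots> \<le> \<kappa> * f" using \<kappa> unfolding N_def by (rule mult_right_mono) simp
      also have "\<dots> \<le> card (G g) * f" using K by simp
      finally show ?thesis unfolding cL .
    qed
    show ?thesis unfolding leg_group_def using ne finL inj ok bad by blast
  qed
  have sumG: "(\<Sum>g\<in>{..<p} \<times> {..<p}. card (G g)) = card I"
  proof -
    have "(\<Sum>g\<in>{..<p} \<times> {..<p}. card (G g)) = card (\<Union>g\<in>{..<p} \<times> {..<p}. G g)"
      by (rule card_UN_disjoint[symmetric]) (use finG in \<open>auto simp: G_def\<close>)
    also have "(\<Union>g\<in>{..<p} \<times> {..<p}. G g) = I"
    proof
      show "I \<subseteq> (\<Union>g\<in>{..<p} \<times> {..<p}. G g)"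
      proof
        fix q assume q: "q \<in> I"
        then obtain t where "tripod_ok w t" "tu t = fst q" "tu' t = snd q" using ex1 I(1) by blast
        then have "fst q \<in> on (lam (fst q))" "snd q \<in> on (lam (snd q))" unfolding tripod_ok_def ttimes_def by auto
        then have "(lam (fst q), lam (snd q)) \<in> {..<p} \<times> {..<p}" using on_bounds by auto
        moreover have "q \<in> G (lam (fst q), lam (snd q))" using q unfolding G_def by simp
        ultimately show "q \<in> (\<Union>g\<in>{..<p} \<times> {..<p}. G g)" by blast
      qed
    qed (auto simp: G_def)
    finally show ?thesis .
  qed
  have "card I \<le> (\<Sum>g\<in>{..<p} \<times> {..<p}. (if g \<in> \<Gamma> then card (G g) else 0) + \<kappa>)"
    unfolding sumG[symmetric] by (rule sum_mono) (auto simp: \<Gamma>_def)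
  also have "\<dots> = (\<Sum>g\<in>\<Gamma>. card (G g)) + p\<^sup>2 * \<kappa>"
  proof -
    have "{..<p} \<times> {..<p} \<inter> {g. g \<in> \<Gamma>} = \<Gamma>" unfolding \<Gamma>_def by auto
    then show ?thesis by (simp add: sum.distrib sum.If_cases card_cartesian_product power2_eq_square)
  qed
  finally have S1: "\<kappa> * p\<^sup>2 \<le> (\<Sum>g\<in>\<Gamma>. card (G g))" using cI by (simp add: mult.commute)
  have "p\<^sup>2 * (\<kappa> * f)\<^sup>2 = \<kappa> * f\<^sup>2 * (\<kappa> * p\<^sup>2)" by (simp add: power2_eq_square ac_simps)
  also have "\<dots> \<le> \<kappa> * f\<^sup>2 * (\<Sum>g\<in>\<Gamma>. card (G g))" using S1 by (rule mult_left_mono) simp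
  also have "\<dots> = (\<Sum>g\<in>\<Gamma>. \<kappa> * f\<^sup>2 * card (G g))" by (rule sum_distrib_left)
  also have "\<dots> \<le> (\<Sum>g\<in>\<Gamma>. (card (\<Lambda> g))\<^sup>2)"
  proof (rule sum_mono)
    fix g assume "g \<in> \<Gamma>"
    then have "\<kappa> \<le> card (G g)" unfolding \<Gamma>_def by simp
    then have "\<kappa> * f\<^sup>2 * card (G g) \<le> card (G g) * f\<^sup>2 * card (G g)" by simp
    then show "\<kappa> * f\<^sup>2 * card (G g) \<le> (card (\<Lambda> g))\<^sup>2" unfolding cL by (simp add: power2_eq_square ac_simps)
  qed
  finally have "p\<^sup>2 * (\<kappa> * f)\<^sup>2 \<le> (\<Sum>g\<in>\<Gamma>. (card (\<Lambda> g))\<^sup>2)" .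
  moreover have "finite \<Gamma>" unfolding \<Gamma>_def by simp
  moreover have "\<kappa> * f \<le> card (\<Lambda> g)" if "g \<in> \<Gamma>" for g using that unfolding cL \<Gamma>_def by simp
  ultimately show ?thesis unfolding leg_state_def using group by blast
qed

end

subsection \<open>The recursion\<close>

context finite_bridge_free
begin

text \<open>With \<open>Z = 2^(w+1)\<close> the new width belongs to \<open>Z^2\<close>, so the new
  group size \<open>Z^160\<close> is split as \<open>\<kappa> * f = Z^136 * Z^24\<close>. From
  \<open>\<mu> = Z^80\<close> one gets \<open>p^2 * Z^143\<close> pairs of feet, as
  \<open>20 * 2^(12w+3)\<close> costs at most \<open>Z^17\<close>. Thinning costs at most another
  \<open>Z^5\<close>, which leaves room for \<open>\<kappa> = Z^136\<close>, while the one-percent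
  condition asks for at most \<open>Z^126\<close>.\<close>

lemma leg_state_step:
  assumes st: "leg_state (p\<^sup>2) w ((2 ^ (w + 1)) ^ 80)"
  shows "tri_state w ((2 ^ (w + 1)) ^ 24) (p\<^sup>2 * (2 ^ (w + 1)) ^ 143)"
    and "leg_state (p\<^sup>2) (2 * w + 1) ((2 ^ (2 * w + 1 + 1)) ^ 80)"
proof -
  define Z :: nat where "Z = 2 ^ (w + 1)"
  have Z2: "2 \<le> Z" unfolding Z_def by simp
  have Z1: "1 \<le> Z" using Z2 by simp
  have num: "20 \<le> Z ^ 5" "100 \<le> Z ^ 7"
    using power_mono[OF Z2, of 5] power_mono[OF Z2, of 7] by simp_all
  have zz: "2 ^ (k * w + k) = Z ^ k" for k unfolding Z_def by (simp only: power_mult[symmetric] distrib_left distrib_right mult.commute mult_1_left)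
  have e2: "2 ^ (2 * w) \<le> Z ^ 2" unfolding zz[symmetric] by (intro power_increasing) auto
  have e12: "2 ^ (12 * w + 3) \<le> Z ^ 12" unfolding zz[symmetric] by (intro power_increasing) auto
  have e4: "2 * 2 ^ (4 * w + 2) + 1 \<le> Z ^ 4"
  proof -
    have "2 * 2 ^ (4 * w + 2) + 1 \<le> (2 * 2 ^ (4 * w + 2) + 2 * 2 ^ (4 * w + 2) :: nat)" by simp
    also have "\<dots> = 2 ^ (4 * w + 4)" by (simp add: power_add)
    finally show ?thesis unfolding zz .
  qed
  show tri: "tri_state w ((2 ^ (w + 1)) ^ 24) (p\<^sup>2 * (2 ^ (w + 1)) ^ 143)"
  proof (rule legs_to_tripods[OF st])
    have "20 * 2 ^ (2 * w) * Z ^ 24 \<le> Z ^ 5 * Z ^ 2 * Z ^ 24" using num(1) e2 by (intro mult_le_mono) auto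
    also have "\<dots> = Z ^ (5 + 2 + 24)" by (simp only: power_add)
    also have "\<dots> \<le> Z ^ 80" using Z1 by (rule power_increasing[rotated]) simp
    finally show "(20::nat) * 2 ^ (2 * w) * (2 ^ (w + 1)) ^ 24 \<le> (2 ^ (w + 1)) ^ 80" unfolding Z_def .
    have "20 * 2 ^ (12 * w + 3) * (p\<^sup>2 * Z ^ 143) \<le> Z ^ 5 * Z ^ 12 * (p\<^sup>2 * Z ^ 143)" using num(1) e12 by (intro mult_le_mono) auto
    also have "\<dots> = p\<^sup>2 * Z ^ (5 + 12 + 143)" by (simp only: power_add ac_simps)
    also have "5 + 12 + 143 = 80 * (2::nat)" by simp
    also have "Z ^ (80 * 2) = (Z ^ 80)\<^sup>2" by (rule power_mult)
    finally show "20 * 2 ^ (12 * w + 3) * (p\<^sup>2 * (2 ^ (w + 1)) ^ 143) \<le> p\<^sup>2 * ((2 ^ (w + 1)) ^ 80)\<^sup>2" unfolding Z_def .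
  qed simp
  have "leg_state (p\<^sup>2) (2 * w + 1) (Z ^ 136 * Z ^ 24)"
  proof (rule tripods_to_legs[OF tri[folded Z_def]])
    have "2 * Z ^ 136 * p\<^sup>2 * (2 * 2 ^ (4 * w + 2) + 1) \<le> Z * Z ^ 136 * p\<^sup>2 * Z ^ 4" using Z2 e4 by (intro mult_le_mono) auto
    also have "\<dots> = p\<^sup>2 * Z ^ (1 + 136 + 4)" by (simp only: power_add power_one_right ac_simps)
    also have "\<dots> \<le> p\<^sup>2 * Z ^ 143" by (rule mult_le_mono2, rule power_increasing[OF _ Z1]) simp
    finally show "2 * Z ^ 136 * p\<^sup>2 * (2 * 2 ^ (4 * w + 2) + 1) \<le> p\<^sup>2 * Z ^ 143" .
    have "w + 1 \<le> 2 ^ w" by (induction w) auto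
    then have "6 * w + 2 \<le> 3 * Z" unfolding Z_def by simp
    also have "\<dots> \<le> Z ^ 2 * Z"
      using power_mono[OF Z2, of 2] by (intro mult_right_mono) auto
    also have "\<dots> = Z ^ (2 + 1)" by (simp only: power_add power_one_right)
    finally have w3: "6 * w + 2 \<le> Z ^ 3" by simp
    have "1 + (6 * w + 2) * Z ^ 115 \<le> Z ^ 118 + Z ^ 3 * Z ^ 115" using Z1 w3 by (intro add_mono mult_right_mono one_le_power) auto
    also have "Z ^ 3 * Z ^ 115 = Z ^ (3 + 115)" by (simp only: power_add)
    also have "3 + 115 = (118::nat)" by simp
    also have "Z ^ 118 + Z ^ 118 = 2 * Z ^ 118" by simp
    also have "\<dots> \<le> Z * Z ^ 118" using Z2 by (rule mult_right_mono) simp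
    finally have "100 * (1 + (6 * w + 2) * Z ^ 115) \<le> Z ^ 7 * (Z * Z ^ 118)" using num(2) by (intro mult_le_mono) auto
    also have "\<dots> = Z ^ (7 + (1 + 118))" by (simp only: power_add power_one_right)
    also have "\<dots> \<le> Z ^ 136" using Z1 by (rule power_increasing[rotated]) simp
    finally show "100 * (1 + (6 * w + 2) * (2 ^ (w + 1)) ^ 115) \<le> Z ^ 136" unfolding Z_def .
    show "1 \<le> Z ^ 24" using Z1 by (rule one_le_power)
  qed
  moreover have "Z ^ 136 * Z ^ 24 = (2 ^ (2 * w + 1 + 1)) ^ 80"
  proof -
    have "2 * w + 1 + 1 = (w + 1) * 2" by simp
    then have "(2 ^ (2 * w + 1 + 1)) ^ 80 = (Z ^ 2) ^ 80" unfolding Z_def by (simp only: power_mult)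
    also have "\<dots> = Z ^ (2 * 80)" by (rule power_mult[symmetric])
    also have "2 * 80 = 136 + (24::nat)" by simp
    finally show ?thesis by (simp only: power_add)
  qed
  ultimately show "leg_state (p\<^sup>2) (2 * w + 1) ((2 ^ (2 * w + 1 + 1)) ^ 80)" by simp
qed

lemma tri_state_bound:
  assumes "tri_state w f Q" "1 \<le> f"
  shows "Q \<le> n\<^sup>2"
proof -
  obtain \<P> :: "(nat \<times> nat) set" and Bl where P: "Q \<le> card \<P>"
    "\<forall>q\<in>\<P>. finite (Bl q) \<and> card (Bl q) = f
         \<and> (\<forall>x\<in>Bl q. \<exists>t. tripod_ok w t \<and> tx t = x \<and> tu t = fst q \<and> tu' t = snd q)"
    using assms(1) unfolding tri_state_def by blast
  have "\<P> \<subseteq> {..<n} \<times> {..<n}"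
  proof
    fix q assume q: "q \<in> \<P>"
    then have "Bl q \<noteq> {}" using P(2) assms(2) by auto
    then obtain t where "tripod_ok w t" "tu t = fst q" "tu' t = snd q" using P(2) q by blast
    then have "fst q \<in> on (lam (fst q))" "snd q \<in> on (lam (snd q))" unfolding tripod_ok_def ttimes_def by auto
    then have "fst q < n" "snd q < n" using on_bounds by blast+
    then show "q \<in> {..<n} \<times> {..<n}" by (cases q) auto
  qed
  then have "card \<P> \<le> card ({..<n} \<times> {..<n})" by (intro card_mono) auto
  then show ?thesis using P(1) by (simp add: card_cartesian_product power2_eq_square)
qed

text \<open>Rounds can be repeated forever with \<open>n\<close> and \<open>p\<close> fixed, so
  \<open>w\<close> exceeds \<open>n^2\<close>; but the number of pairs of feet, at least
  \<open>p^2 * 2^(143(w+1))\<close>, cannot exceed \<open>n^2\<close>.\<close>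

lemma no_leg_state:
  assumes "1 \<le> p"
  shows "\<not> leg_state (p\<^sup>2) 0 (2 ^ 80)"
proof
  assume "leg_state (p\<^sup>2) 0 (2 ^ 80)"
  then have base: "leg_state (p\<^sup>2) 0 ((2 ^ (0 + 1)) ^ 80)" by simp
  have "\<exists>w\<ge>j. leg_state (p\<^sup>2) w ((2 ^ (w + 1)) ^ 80)" for j
  proof (induction j)
    case 0
    then show ?case using base by blast
  next
    case (Suc j)
    then obtain w where w: "j \<le> w" "leg_state (p\<^sup>2) w ((2 ^ (w + 1)) ^ 80)" by blast
    then have "leg_state (p\<^sup>2) (2 * w + 1) ((2 ^ (2 * w + 1 + 1)) ^ 80)" by (intro leg_state_step(2))
    moreover have "Suc j \<le> 2 * w + 1" using w(1) by simp
    ultimately show ?case by blast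
  qed
  then obtain w where w: "n\<^sup>2 \<le> w" "leg_state (p\<^sup>2) w ((2 ^ (w + 1)) ^ 80)" by blast
  have Q: "p\<^sup>2 * (2 ^ (w + 1)) ^ 143 \<le> n\<^sup>2"
    by (rule tri_state_bound[OF leg_state_step(1)[OF w(2)]]) (rule one_le_power, simp)
  have "w < 2 ^ w" by (rule less_exp)
  also have "(2::nat) ^ w \<le> 2 ^ (w + 1)" by simp
  also have "\<dots> \<le> (2 ^ (w + 1)) ^ 143" by (rule self_le_power) auto
  also have "\<dots> \<le> p\<^sup>2 * (2 ^ (w + 1)) ^ 143" using assms by simp
  finally show False using Q w(1) by linarith
qed

text \<open>A common node of two paths is a leg of width 0 whose tip and feet coincide, provided a
  later path passes through it to be the last one. Pairs with fewer than \<open>2^80\<close> such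
  nodes contribute at most \<open>2^80 * p^2\<close>; if the total exceeded twice this, the other
  pairs would form the initial state of the recursion.\<close>

lemma crossing_pairs_bound:
  assumes "1 \<le> p"
  defines "X \<equiv> \<lambda>g. {v \<in> on (fst g) \<inter> on (snd g). fst g < lam v \<and> snd g < lam v \<and> v \<in> on (lam v)}"
  shows "(\<Sum>g\<in>{g \<in> {..<p} \<times> {..<p}. fst g \<noteq> snd g}. card (X g)) \<le> 2 ^ 81 * p\<^sup>2"
proof (rule ccontr)
  define G0 where "G0 = {g \<in> {..<p} \<times> {..<p}. fst g \<noteq> snd g}"
  define M where "M = (2::nat) ^ 80"
  assume "\<not> ?thesis"
  then have big: "2 ^ 81 * p\<^sup>2 < (\<Sum>g\<in>G0. card (X g))" unfolding G0_def by simp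
  have fin: "finite G0" unfolding G0_def by simp
  have cPi: "card G0 \<le> p\<^sup>2"
  proof -
    have "card G0 \<le> card ({..<p} \<times> {..<p})" unfolding G0_def by (intro card_mono) auto
    then show ?thesis by (simp add: card_cartesian_product power2_eq_square)
  qed
  define \<Gamma> where "\<Gamma> = {g \<in> G0. M \<le> card (X g)}"
  have finX: "finite (X g)" for g
    by (rule finite_subset[of _ "{..<n}"]) (use on_bounds in \<open>auto simp: X_def\<close>)
  define lg :: "nat \<Rightarrow> leg" where "lg v = \<lparr>ltip = v, lfoot = v, lfoot' = v, ldown = {}, lup = {}, ldown' = {}, lup' = {}\<rparr>" for v
  have injl: "inj_on lg A" for A by (rule inj_on_inverseI[of _ ltip]) (simp add: lg_def)
  have cl: "card (lg ` X g) = card (X g)" for g by (rule card_image[OF injl])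
  have gd: "lgood (lg u) (lg v) \<longleftrightarrow> u \<noteq> v" for u v by (simp add: lgood_def lg_def llab_def)
  have "leg_group 0 (fst g) (snd g) (lg ` X g) \<and> M \<le> card (lg ` X g)" if g: "g \<in> \<Gamma>" for g
  proof -
    have "100 * card {b \<in> lg ` X g. \<not> lgood a b} \<le> card (lg ` X g) \<and> leg_ok 0 (fst g) (snd g) a" if aX: "a \<in> lg ` X g" for a
    proof
      obtain v where v: "a = lg v" "v \<in> X g" using aX by blast
      \<comment> \<open>Label sets are empty, so a leg conflicts with itself only, and
        \<open>100 \<le> 2^80\<close>.\<close>
      have "{b \<in> lg ` X g. \<not> lgood a b} = {a}" using v gd by auto
      then have "100 * card {b \<in> lg ` X g. \<not> lgood a b} \<le> M" by (simp add: M_def)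
      also have "M \<le> card (lg ` X g)" using g unfolding \<Gamma>_def cl by simp
      finally show "100 * card {b \<in> lg ` X g. \<not> lgood a b} \<le> card (lg ` X g)" .
      show "leg_ok 0 (fst g) (snd g) a" using v unfolding leg_ok_def v(1) lg_def X_def llab_def by (simp add: walk.walk_refl)
    qed
    moreover have "fst g \<noteq> snd g" using g unfolding \<Gamma>_def G0_def by simp
    moreover have "inj_on (\<lambda>a. (ltip a, lfoot a)) (lg ` X g)" by (rule inj_onI) (auto simp: lg_def)
    moreover have "M \<le> card (lg ` X g)" using g unfolding \<Gamma>_def cl by simp
    ultimately show ?thesis unfolding leg_group_def using finX by blast
  qed
  moreover have "p\<^sup>2 * M\<^sup>2 \<le> (\<Sum>g\<in>\<Gamma>. (card (lg ` X g))\<^sup>2)"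
  proof -
    have "(\<Sum>g\<in>G0. card (X g)) \<le> (\<Sum>g\<in>G0. (if g \<in> \<Gamma> then card (X g) else 0) + M)"
      by (rule sum_mono) (auto simp: \<Gamma>_def)
    also have "\<dots> = (\<Sum>g\<in>\<Gamma>. card (X g)) + card G0 * M"
    proof -
      have "G0 \<inter> {g. g \<in> \<Gamma>} = \<Gamma>" unfolding \<Gamma>_def by auto
      then show ?thesis using fin by (simp add: sum.distrib sum.If_cases)
    qed
    also have "\<dots> \<le> (\<Sum>g\<in>\<Gamma>. card (X g)) + p\<^sup>2 * M" using cPi by simp
    finally have "2 * M * p\<^sup>2 \<le> (\<Sum>g\<in>\<Gamma>. card (X g)) + p\<^sup>2 * M" using big unfolding M_def by simp
    then have 1: "M * p\<^sup>2 \<le> (\<Sum>g\<in>\<Gamma>. card (X g))" by (simp add: mult.commute)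
    have "p\<^sup>2 * M\<^sup>2 = M * (M * p\<^sup>2)" by (simp only: power2_eq_square ac_simps)
    also have "\<dots> \<le> M * (\<Sum>g\<in>\<Gamma>. card (X g))" using 1 by (rule mult_le_mono2)
    also have "\<dots> = (\<Sum>g\<in>\<Gamma>. M * card (X g))" by (rule sum_distrib_left)
    also have "\<dots> \<le> (\<Sum>g\<in>\<Gamma>. (card (lg ` X g))\<^sup>2)"
      by (rule sum_mono) (auto simp: \<Gamma>_def cl power2_eq_square)
    finally show ?thesis .
  qed
  moreover have "finite \<Gamma>" unfolding \<Gamma>_def using fin by simp
  ultimately have "leg_state (p\<^sup>2) 0 M" unfolding leg_state_def by (intro exI[of _ \<Gamma>] exI[of _ "\<lambda>g. lg ` X g"]) blast
  then show False using no_leg_state[OF assms(1)] unfolding M_def by simp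
qed

end

subsection \<open>Path systems\<close>

text \<open>For \<open>E\<close> the sum and \<open>N\<close> the number of terms, nonnegativity of
  the variance gives \<open>E * (E - N) \<le> N * B\<close>. If \<open>E > N\<close>, the left side
  is at least \<open>(E - N)^2\<close>.\<close>

lemma sum_le_of_sum_pairs:
  fixes e :: "'i \<Rightarrow> nat"
  assumes fin: "finite I" and B: "(\<Sum>i\<in>I. real (e i) * (real (e i) - 1)) \<le> B"
  shows "real (\<Sum>i\<in>I. e i) \<le> real (card I) + sqrt (real (card I) * B)"
proof (cases "real (\<Sum>i\<in>I. e i) \<le> real (card I)")
  case True
  have "0 \<le> (\<Sum>i\<in>I. real (e i) * (real (e i) - 1))"
  proof (rule sum_nonneg)
    fix i show "0 \<le> real (e i) * (real (e i) - 1)" by (cases "e i") auto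
  qed
  then have "0 \<le> B" using B by linarith
  then have "0 \<le> sqrt (real (card I) * B)" by simp
  then show ?thesis using True by linarith
next
  case False
  define E where "E = real (\<Sum>i\<in>I. e i)"
  define N where "N = real (card I)"
  have EN: "N < E" using False unfolding E_def N_def by simp
  have E': "E = (\<Sum>i\<in>I. real (e i))" unfolding E_def by simp
  have N0: "0 < N"
  proof -
    have "I \<noteq> {}" using EN unfolding E_def N_def by auto
    then show ?thesis unfolding N_def using fin by (simp add: card_gt_0_iff)
  qed
  have "0 \<le> (\<Sum>i\<in>I. (N * real (e i) - E)\<^sup>2)" by (rule sum_nonneg) simp
  also have "\<dots> = (\<Sum>i\<in>I. N * N * (real (e i) * (real (e i) - 1)) + (N * N - 2 * N * E) * real (e i) + E * E)"
    by (rule sum.cong) (auto simp: power2_eq_square algebra_simps)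
  also have "\<dots> = N * N * (\<Sum>i\<in>I. real (e i) * (real (e i) - 1)) + (N * N - 2 * N * E) * E + N * (E * E)"
    by (simp add: sum.distrib sum_distrib_left[symmetric] E' N_def)
  also have "\<dots> \<le> N * N * B + (N * N - 2 * N * E) * E + N * (E * E)" using B N0 by (simp add: mult_left_mono)
  also have "\<dots> = N * (N * B + N * E - E * E)" by (simp add: algebra_simps)
  finally have "0 \<le> N * B + N * E - E * E" using N0 by (simp add: zero_le_mult_iff)
  moreover have "N * (E - N) \<ge> 0" using EN N0 by simp
  ultimately have "(E - N)\<^sup>2 \<le> N * B" by (simp add: power2_eq_square algebra_simps)
  then have "E - N \<le> sqrt (N * B)" by (rule real_le_rsqrt)
  then show ?thesis unfolding E_def N_def by linarith
qed

section \<open>Ordered path systems without ordered bridges as instances of the locale\<close>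

definition sys_pr :: "nat list list \<Rightarrow> nat \<Rightarrow> nat \<Rightarrow> nat \<Rightarrow> bool" where
  "sys_pr P k x y \<longleftrightarrow> k < length P \<and> prec (P ! k) x y"

definition sys_on :: "nat list list \<Rightarrow> nat \<Rightarrow> nat set" where
  "sys_on P k = (if k < length P then set (P ! k) else {})"

text \<open>For a node on no path the value is unspecified; membership in the last path is therefore
  stated explicitly wherever it matters.\<close>

definition sys_last :: "nat list list \<Rightarrow> nat \<Rightarrow> nat" where
  "sys_last P v = Max {k. v \<in> sys_on P k}"

text \<open>Bridges require distinct nodes, walks only distinct labels. In a walk with the fewest
  labels no node repeats, because the part between two visits could be cut out. The river is
  appended as label number \<open>Suc m\<close>.\<close>

lemma walk_to_bridge:
  assumes w: "walk (sys_pr P) L x y" and L: "\<And>l. l \<in> L \<Longrightarrow> l < k" and r: "sys_pr P k x y" and "x \<noteq> y"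
  shows "\<exists>b. has_ordered_bridge P b"
proof -
  define good where "good L \<longleftrightarrow> walk (sys_pr P) L x y \<and> (\<forall>l\<in>L. l < k)" for L
  have "good L" using w L unfolding good_def by blast
  then obtain L where g: "good L" and min: "\<And>L'. good L' \<Longrightarrow> card L \<le> card L'"
    using ex_has_least_nat[of good L card] by blast
  define m where "m = card L"
  obtain v q where v: "v (1::nat) = x" "v (Suc m) = y" and q: "inj_on q {1..m}" "q ` {1..m} = L"
    and arc: "\<And>i. i \<in> {1..m} \<Longrightarrow> sys_pr P (q i) (v i) (v (Suc i))"
    using g unfolding good_def m_def by (blast elim: walk_sequence)
  have qk: "q i < k" if "i \<in> {1..m}" for i using g q(2) that unfolding good_def by blast
  have "inj_on v {1..Suc m}"
  proof (rule linorder_inj_onI)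
    fix i j assume ij: "i < j" "i \<in> {1..Suc m}" "j \<in> {1..Suc m}"
    show "v i \<noteq> v j"
    proof
      assume eq: "v i = v j"
      have 1: "walk (sys_pr P) (q ` {1..<i}) (v 1) (v i)" by (rule walk_segment[where v = v, OF q(1), of "sys_pr P", OF arc]) (use ij in auto)
      have 2: "walk (sys_pr P) (q ` {j..<Suc m}) (v j) (v (Suc m))" by (rule walk_segment[where v = v, OF q(1), of "sys_pr P", OF arc]) (use ij in auto)
      have "{1..<i} \<inter> {j..<Suc m} = {}" "{1..<i} \<subseteq> {1..m}" "{j..<Suc m} \<subseteq> {1..m}" using ij by auto
      then have d: "q ` {1..<i} \<inter> q ` {j..<Suc m} = {}"
        using inj_on_image_Int[OF q(1), of "{1..<i}" "{j..<Suc m}"] by (metis image_empty)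
      have "walk (sys_pr P) (q ` {1..<i} \<union> q ` {j..<Suc m}) x y"
        using walk_trans[OF 2[folded eq] 1 d] v by simp
      moreover have "q ` {1..<i} \<union> q ` {j..<Suc m} \<subseteq> L"
        using \<open>{1..<i} \<subseteq> {1..m}\<close> \<open>{j..<Suc m} \<subseteq> {1..m}\<close> q(2) by blast
      ultimately have "good (q ` {1..<i} \<union> q ` {j..<Suc m})" using g unfolding good_def by blast
      then have "m \<le> card (q ` ({1..<i} \<union> {j..<Suc m}))" using min unfolding m_def by (simp add: image_Un)
      also have "\<dots> \<le> card ({1..<i} \<union> {j..<Suc m})" by (rule card_image_le) simp
      also have "\<dots> \<le> card {1..<i} + card {j..<Suc m}" by (rule card_Un_le)
      also have "\<dots> = (i - 1) + (Suc m - j)" by simp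
      also have "\<dots> < m" using ij by auto
      finally show False by simp
    qed
  qed auto
  moreover define q' where "q' = q(Suc m := k)"
  have q': "q' i = q i" if "i \<in> {1..m}" for i using that unfolding q'_def by auto
  have q'k: "q' (Suc m) = k" unfolding q'_def by simp
  have iv: "{1..Suc m} = insert (Suc m) {1..m}" "{1..<Suc m} = {1..m}" by auto
  have "inj_on q' {1..Suc m}"
  proof -
    have "inj_on q' {1..m}" using q(1) q' inj_on_cong[of "{1..m}" q' q] by blast
    moreover have "k \<notin> q' ` ({1..m} - {Suc m})"
    proof
      assume "k \<in> q' ` ({1..m} - {Suc m})"
      then obtain i where "i \<in> {1..m}" "k = q' i" by blast
      then show False using qk[of i] q'[of i] by simp
    qed
    ultimately show ?thesis unfolding iv inj_on_insert q'k by simp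
  qed
  moreover have "q' i < length P" if "i \<in> {1..Suc m}" for i
  proof (cases "i = Suc m")
    case True then show ?thesis using r q'k unfolding sys_pr_def by simp
  next
    case False then show ?thesis using arc[of i] q'[of i] that unfolding sys_pr_def by auto
  qed
  moreover have "prec (P ! q' i) (v i) (v (Suc i))" if "i \<in> {1..<Suc m}" for i
    using arc[of i] q'[of i] that unfolding sys_pr_def by auto
  moreover have "prec (P ! q' (Suc m)) (v 1) (v (Suc m))" using r v q'k unfolding sys_pr_def by simp
  moreover have "q' i < q' (Suc m)" if "i \<in> {1..<Suc m}" for i using qk[of i] q'[of i] q'k that by simp
  ultimately have "ordered_bridge P (Suc m) v q'" unfolding ordered_bridge_def by simp
  then show ?thesis unfolding has_ordered_bridge_def by blast
qed

lemma system_bridge_free: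
  assumes ps: "is_path_system n P" and girth: "ordered_bridge_girth_gt P \<infinity>"
  shows "finite_bridge_free (sys_pr P) (sys_on P) (length P) n"
proof -
  have nob: "\<not> has_ordered_bridge P b" for b using girth unfolding ordered_bridge_girth_gt_def by simp
  have dist: "distinct (P ! k)" "set (P ! k) \<subseteq> {..<n}" if "k < length P" for k
    using ps that unfolding is_path_system_def by auto
  have irr: "x \<noteq> y" if "sys_pr P k x y" for k x y
    using that dist unfolding sys_pr_def prec_def by (metis less_trans nat_neq_iff nth_eq_iff_index_eq)
  show ?thesis
  proof
    fix k x y z assume xy: "sys_pr P k x y" and yz: "sys_pr P k y z"
    then have k: "k < length P" unfolding sys_pr_def by simp
    obtain i j where ij: "i < j" "j < length (P ! k)" "P ! k ! i = x" "P ! k ! j = y"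
      using xy unfolding sys_pr_def prec_def by blast
    obtain j' l where jl: "j' < l" "l < length (P ! k)" "P ! k ! j' = y" "P ! k ! l = z"
      using yz unfolding sys_pr_def prec_def by blast
    have "j = j'" using ij jl nth_eq_iff_index_eq[OF dist(1)[OF k], of j j'] by simp
    then have "i < l" using ij(1) jl(1) by simp
    then show "sys_pr P k x z" using ij(3) jl(2,4) k unfolding sys_pr_def prec_def by blast
  next
    fix k x show "\<not> sys_pr P k x x" using irr by blast
  next
    fix k x y assume "x \<in> sys_on P k" "y \<in> sys_on P k" "x \<noteq> y"
    then have "k < length P" "x \<in> set (P ! k)" "y \<in> set (P ! k)" unfolding sys_on_def by (auto split: if_splits)
    then show "sys_pr P k x y \<or> sys_pr P k y x"
      using \<open>x \<noteq> y\<close> unfolding sys_pr_def prec_def in_set_conv_nth by (metis linorder_neqE_nat)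
  next
    fix k x y assume "sys_pr P k x y"
    then show "x \<in> sys_on P k \<and> y \<in> sys_on P k" unfolding sys_pr_def prec_def sys_on_def
      by (auto intro: nth_mem less_trans)
  next
    fix L x y k assume "walk (sys_pr P) L x y" "\<And>l. l \<in> L \<Longrightarrow> l < k"
    then show "\<not> sys_pr P k x y" using walk_to_bridge[of P L x y k] nob irr by blast
  next
    fix x k assume "x \<in> sys_on P k"
    then show "k < length P \<and> x < n" using dist unfolding sys_on_def by (auto split: if_splits)
  qed
qed

lemma ps_size_sum:
  assumes "is_path_system n P"
  shows "ps_size P = (\<Sum>k<length P. card (sys_on P k))"
proof -
  have "ps_size P = (\<Sum>k<length P. length (P ! k))"
    unfolding ps_size_def by (simp add: sum_list_sum_nth atLeast0LessThan)
  also have "\<dots> = (\<Sum>k<length P. card (sys_on P k))"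
    using assms by (intro sum.cong) (auto simp: is_path_system_def sys_on_def distinct_card)
  finally show ?thesis .
qed

section \<open>The two bounds on the size\<close>

lemma size_bound_pairs_of_nodes:
  assumes ps: "is_path_system n P" and girth: "ordered_bridge_girth_gt P \<infinity>"
  shows "real (ps_size P) \<le> real (length P) + sqrt (real (length P) * (2 * (real n)\<^sup>2))"
proof -
  interpret finite_bridge_free "sys_pr P" "sys_on P" "sys_last P" "length P" n
    by (rule system_bridge_free[OF assms])
  define R where "R k = {xy. sys_pr P k (fst xy) (snd xy)}" for k
  have RN: "R k \<subseteq> {..<n} \<times> {..<n}" for k
  proof
    fix xy assume "xy \<in> R k"
    then have "fst xy < n" "snd xy < n" using pr_on on_bounds unfolding R_def by blast+
    then show "xy \<in> {..<n} \<times> {..<n}" by (cases xy) auto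
  qed
  then have finR: "finite (R k)" for k by (rule finite_subset) simp
  \<comment> \<open>If two paths run through \<open>x\<close> before \<open>y\<close>, the earlier
    one is the single arc of a bridge whose river is the later one.\<close>
  have disj: "R k \<inter> R l = {}" if kl: "k < l" for k l
  proof (rule ccontr)
    assume "R k \<inter> R l \<noteq> {}"
    then obtain x y where "sys_pr P k x y" "sys_pr P l x y" unfolding R_def by auto
    then show False using no_bridge[of "{k}" x y l] walk_arc[of "sys_pr P" k x y] kl by blast
  qed
  have "(\<Sum>k<length P. card (R k)) = card (\<Union>k<length P. R k)"
    using finR disj by (intro card_UN_disjoint[symmetric]) (auto, metis Int_commute linorder_neqE_nat disjoint_iff)
  also have "\<dots> \<le> card ({..<n} \<times> {..<n})" using RN by (intro card_mono) auto
  finally have tot: "(\<Sum>k<length P. card (R k)) \<le> n * n" by (simp add: card_cartesian_product)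
  have each: "real (card (sys_on P k)) * (real (card (sys_on P k)) - 1) \<le> 2 * real (card (R k))" for k
  proof -
    have fo: "finite (sys_on P k)" by (rule finite_subset[of _ "{..<n}"]) (use on_bounds in auto)
    have "sys_on P k \<times> sys_on P k \<subseteq> (\<lambda>x. (x, x)) ` sys_on P k \<union> (R k \<union> prod.swap ` R k)"
    proof
      fix z assume z: "z \<in> sys_on P k \<times> sys_on P k"
      obtain x y where xy: "z = (x, y)" "x \<in> sys_on P k" "y \<in> sys_on P k" using z by auto
      show "z \<in> (\<lambda>x. (x, x)) ` sys_on P k \<union> (R k \<union> prod.swap ` R k)"
      proof (cases "x = y")
        case True then show ?thesis using xy by blast
      next
        case False
        then have "(x, y) \<in> R k \<or> (y, x) \<in> R k" using pr_total[OF xy(2,3)] unfolding R_def by simp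
        moreover have "(x, y) = prod.swap (y, x)" by simp
        ultimately show ?thesis unfolding xy(1) by (metis UnI1 UnI2 imageI)
      qed
    qed
    then have "card (sys_on P k \<times> sys_on P k) \<le> card ((\<lambda>x. (x, x)) ` sys_on P k \<union> (R k \<union> prod.swap ` R k))"
      using fo finR by (intro card_mono) auto
    also have "\<dots> \<le> card (sys_on P k) + (card (R k) + card (R k))"
      by (intro card_Un_bound card_image_le fo order.refl finR)
    finally have "real (card (sys_on P k) * card (sys_on P k)) \<le> real (card (sys_on P k) + (card (R k) + card (R k)))"
      unfolding card_cartesian_product by (subst of_nat_le_iff)
    then show ?thesis by (simp add: algebra_simps)
  qed
  have "(\<Sum>k<length P. real (card (sys_on P k)) * (real (card (sys_on P k)) - 1)) \<le> (\<Sum>k<length P. 2 * real (card (R k)))"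
    by (rule sum_mono) (rule each)
  also have "\<dots> = 2 * real (\<Sum>k<length P. card (R k))" by (simp add: sum_distrib_left)
  also have "\<dots> \<le> 2 * real (n * n)" using tot by (intro mult_left_mono of_nat_mono) simp_all
  finally have "(\<Sum>k<length P. real (card (sys_on P k)) * (real (card (sys_on P k)) - 1)) \<le> 2 * (real n)\<^sup>2"
    by (simp add: power2_eq_square)
  from sum_le_of_sum_pairs[OF _ this] show ?thesis unfolding ps_size_sum[OF ps] by simp
qed

lemma size_bound_pairs_of_paths:
  assumes ps: "is_path_system n P" and girth: "ordered_bridge_girth_gt P \<infinity>" and p1: "1 \<le> length P"
  shows "real (ps_size P) \<le> 2 * real n + sqrt (real n * (2 ^ 81 * (real (length P))\<^sup>2))"
proof -
  interpret finite_bridge_free "sys_pr P" "sys_on P" "sys_last P" "length P" n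
    by (rule system_bridge_free[OF assms(1,2)])
  define p where "p = length P"
  define D where "D v = {k. v \<in> sys_on P k}" for v
  \<comment> \<open>At every node the last path is set aside, since the crossing bound counts only
    pairs of paths that are earlier than it. This costs one incidence per node, hence the second
    summand \<open>n\<close>.\<close>
  define D' where "D' v = D v - {sys_last P v}" for v
  define X where "X g = {v \<in> sys_on P (fst g) \<inter> sys_on P (snd g). fst g < sys_last P v \<and> snd g < sys_last P v \<and> v \<in> sys_on P (sys_last P v)}" for g
  define G0 where "G0 = {g \<in> {..<p} \<times> {..<p}. fst g \<noteq> snd g}"
  have Dp: "D v \<subseteq> {..<p}" for v unfolding D_def p_def using on_bounds by blast
  then have finD: "finite (D v)" for v by (rule finite_subset) simp
  have finX: "finite (X g)" for g
    by (rule finite_subset[of _ "{..<n}"]) (use on_bounds in \<open>auto simp: X_def\<close>)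
  have last: "k < sys_last P v" if "k \<in> D' v" for k v
  proof -
    have "k \<in> D v" "k \<noteq> sys_last P v" using that unfolding D'_def by auto
    moreover from this have "k \<le> Max (D v)" using finD by simp
    ultimately show ?thesis unfolding sys_last_def D_def by simp
  qed
  have lastin: "v \<in> sys_on P (sys_last P v)" if "k \<in> D v" for k v
    using Max_in[of "D v"] finD that unfolding sys_last_def D_def by auto
  have "(\<Sum>g\<in>G0. card (X g)) \<le> 2 ^ 81 * p\<^sup>2"
    using crossing_pairs_bound[OF p1] unfolding X_def G0_def p_def by simp
  moreover have "(\<Sum>v<n. card (D' v) * (card (D' v) - 1)) \<le> (\<Sum>g\<in>G0. card (X g))"
  proof -
    define Od where "Od v = {g \<in> D' v \<times> D' v. fst g \<noteq> snd g}" for v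
    have finD': "finite (D' v)" for v unfolding D'_def using finD by simp
    have cO: "card (Od v) = card (D' v) * (card (D' v) - 1)" for v
    proof -
      have "Od v = Sigma (D' v) (\<lambda>a. D' v - {a})" unfolding Od_def by auto
      then show ?thesis using finD'[of v] by simp
    qed
    have finO: "finite (Od v)" for v unfolding Od_def using finD' by simp
    have "(\<Sum>v<n. card (D' v) * (card (D' v) - 1)) = card (Sigma {..<n} Od)" using finO by (simp add: cO)
    also have "\<dots> \<le> card (Sigma G0 X)"
    proof (rule card_inj_on_le[where f = "\<lambda>(v, g). (g, v)"])
      show "(\<lambda>(v, g). (g, v)) ` Sigma {..<n} Od \<subseteq> Sigma G0 X"
      proof
        fix z assume "z \<in> (\<lambda>(v, g). (g, v)) ` Sigma {..<n} Od"
        then obtain v a b where z: "z = ((a, b), v)" "(a, b) \<in> Od v" by auto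
        then have ab: "a \<in> D' v" "b \<in> D' v" "a \<noteq> b" unfolding Od_def by auto
        then have D: "a \<in> D v" "b \<in> D v" unfolding D'_def by auto
        then have "(a, b) \<in> G0" using Dp ab(3) unfolding G0_def by auto
        moreover have "v \<in> X (a, b)" using last[OF ab(1)] last[OF ab(2)] D lastin[OF D(1)] unfolding X_def D_def by simp
        ultimately show "z \<in> Sigma G0 X" unfolding z(1) by blast
      qed
      show "finite (Sigma G0 X)" using finX unfolding G0_def by simp
    qed (auto simp: inj_on_def)
    also have "\<dots> = (\<Sum>g\<in>G0. card (X g))" using finX unfolding G0_def by simp
    finally show ?thesis .
  qed
  ultimately have "(\<Sum>v<n. card (D' v) * (card (D' v) - 1)) \<le> 2 ^ 81 * p\<^sup>2" by linarith
  then have "real (\<Sum>v<n. card (D' v) * (card (D' v) - 1)) \<le> real (2 ^ 81 * p\<^sup>2)" by (subst of_nat_le_iff)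
  moreover have "real (\<Sum>v<n. card (D' v) * (card (D' v) - 1)) = (\<Sum>v<n. real (card (D' v)) * (real (card (D' v)) - 1))"
    unfolding of_nat_sum
  proof (rule sum.cong)
    fix v show "real (card (D' v) * (card (D' v) - 1)) = real (card (D' v)) * (real (card (D' v)) - 1)"
      by (cases "card (D' v)") (auto simp: algebra_simps)
  qed simp
  ultimately have "(\<Sum>v<n. real (card (D' v)) * (real (card (D' v)) - 1)) \<le> 2 ^ 81 * (real p)\<^sup>2" by simp
  from sum_le_of_sum_pairs[OF _ this] have E: "real (\<Sum>v<n. card (D' v)) \<le> real n + sqrt (real n * (2 ^ 81 * (real p)\<^sup>2))" by simp
  have "ps_size P = (\<Sum>v<n. card (D v))"
  proof -
    have fo: "finite (sys_on P k)" for k by (rule finite_subset[of _ "{..<n}"]) (use on_bounds in auto)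
    have "ps_size P = card (Sigma {..<p} (sys_on P))" unfolding ps_size_sum[OF ps] p_def using fo by simp
    also have "\<dots> = card (Sigma {..<n} D)"
      by (rule bij_betw_same_card[of prod.swap], rule bij_betw_byWitness[where f' = prod.swap])
        (use on_bounds Dp in \<open>auto simp: D_def p_def\<close>)
    also have "\<dots> = (\<Sum>v<n. card (D v))" using finD by simp
    finally show ?thesis .
  qed
  also have "\<dots> \<le> (\<Sum>v<n. card (D' v) + 1)"
  proof (rule sum_mono)
    fix v show "card (D v) \<le> card (D' v) + 1"
      unfolding D'_def using diff_card_le_card_Diff[of "{sys_last P v}" "D v"] by simp
  qed
  also have "\<dots> = (\<Sum>v<n. card (D' v)) + n" unfolding sum.distrib by simp
  finally have "real (ps_size P) \<le> real (\<Sum>v<n. card (D' v)) + real n" by (metis of_nat_add of_nat_le_iff)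
  then show ?thesis using E unfolding p_def by linarith
qed

text \<open>The maximum is taken over a finite nonempty set: sizes are at most \<open>p * n\<close>,
  and \<open>p\<close> empty paths form an admissible system.\<close>

lemma beta_star_attained:
  obtains P where "is_path_system n P" "length P = p" "ordered_bridge_girth_gt P \<infinity>" "beta_star n p \<infinity> = ps_size P"
proof -
  define S where "S = {ps_size P | P. is_path_system n P \<and> length P = p \<and> ordered_bridge_girth_gt P \<infinity>}"
  have "S \<subseteq> {..p * n}"
  proof
    fix s assume "s \<in> S"
    then obtain P where P: "s = ps_size P" "is_path_system n P" "length P = p" unfolding S_def by blast
    have "(\<Sum>\<pi>\<leftarrow>P. length \<pi>) \<le> (\<Sum>\<pi>\<leftarrow>P. n)"
    proof (rule sum_list_mono)
      fix \<pi> assume "\<pi> \<in> set P"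
      then have "distinct \<pi>" "set \<pi> \<subseteq> {..<n}" using P(2) unfolding is_path_system_def by auto
      then show "length \<pi> \<le> n" using card_mono[of "{..<n}" "set \<pi>"] by (simp add: distinct_card)
    qed
    then show "s \<in> {..p * n}" using P by (simp add: ps_size_def sum_list_triv)
  qed
  then have "finite S" by (rule finite_subset) simp
  moreover have "ps_size (replicate p []) \<in> S"
  proof -
    have "\<not> ordered_bridge (replicate p []) b v r" for b v r
      unfolding ordered_bridge_def prec_def by auto
    then have "ordered_bridge_girth_gt (replicate p []) \<infinity>"
      unfolding ordered_bridge_girth_gt_def has_ordered_bridge_def by blast
    moreover have "is_path_system n (replicate p [])" unfolding is_path_system_def by auto
    ultimately show ?thesis unfolding S_def by force
  qed
  ultimately have "Max S \<in> S" by (intro Max_in) auto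
  moreover have "beta_star n p \<infinity> = Max S" unfolding beta_star_def S_def by simp
  ultimately show ?thesis using that unfolding S_def by auto
qed

theorem theorem3p18:
  shows "\<exists>C::real. \<forall>n p :: nat. n \<ge> 1 \<longrightarrow> p \<ge> 1 \<longrightarrow>
     real (beta_star n p \<infinity>) \<le> C * (min (sqrt (real n) * real p) (real n * sqrt (real p)) + real n + real p)"
proof (intro exI allI impI)
  fix n p :: nat
  assume "1 \<le> n" and p1: "1 \<le> p"
  obtain P where P: "is_path_system n P" "length P = p" "ordered_bridge_girth_gt P \<infinity>" "beta_star n p \<infinity> = ps_size P"
    by (rule beta_star_attained)
  define s where "s = real (ps_size P)"
  define A where "A = sqrt (real n) * real p"
  define B where "B = real n * sqrt (real p)"
  have AB: "0 \<le> A" "0 \<le> B" unfolding A_def B_def by simp_all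
  have "sqrt (real n * (2 ^ 81 * (real p)\<^sup>2)) = sqrt (2 ^ 81) * A"
    unfolding A_def by (simp add: real_sqrt_mult)
  \<comment> \<open>The square root of \<open>2^81\<close> is \<open>2^40.5\<close>.\<close>
  also have "\<dots> \<le> 2 ^ 41 * A"
    using AB(1) by (intro mult_right_mono real_le_lsqrt) auto
  finally have 1: "s \<le> 2 * real n + 2 ^ 41 * A"
    using size_bound_pairs_of_paths[OF P(1,3)] p1 P(2) unfolding s_def by simp
  have "sqrt (real p * (2 * (real n)\<^sup>2)) = sqrt 2 * B" unfolding B_def by (simp add: real_sqrt_mult)
  also have "\<dots> \<le> 2 * B" using AB(2) by (intro mult_right_mono real_le_lsqrt) auto
  finally have 2: "s \<le> real p + 2 * B"
    using size_bound_pairs_of_nodes[OF P(1,3)] P(2) unfolding s_def by simp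
  have "s \<le> 2 ^ 41 * (min A B + real n + real p)"
  proof (cases "A \<le> B")
    case True then show ?thesis using 1 by (simp add: min_def algebra_simps)
  next
    case False
    then have "min A B = B" by simp
    then show ?thesis using 2 AB(2) by (simp add: algebra_simps)
  qed
  then show "real (beta_star n p \<infinity>) \<le> 2 ^ 41 * (min (sqrt (real n) * real p) (real n * sqrt (real p)) + real n + real p)"
    unfolding P(4) s_def A_def B_def .
qed

end
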